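(* Let $R$ be a right coherent ring. There exists an equivalence $$\mathbb{D}(\mathrm{Mod}\text{-}R)\simeq\mathbb{D}_R(\mathrm{Mod}\text{-}(\mathrm{mod}\text{-}R))$$ of triangulated categories.
   Context: $\mathrm{Mod}\text{-}R$ is the category of all right $R$-modules and $\mathrm{mod}\text{-}R$ the full subcategory of finitely presented modules. $\mathrm{Mod}\text{-}(\mathrm{mod}\text{-}R)$ is the abelian category of additive contravariant functors from $\mathrm{mod}\text{-}R$ to abelian groups. $\mathbb{K}$ and $\mathbb{D}$ denote the unbounded homotopy and derived categories. $\mathbb{K}_{R\text{-}\mathrm{ac}}(\mathrm{Mod}\text{-}(\mathrm{mod}\text{-}R))$ is the full (thick) subcategory of $\mathbb{K}(\mathrm{Mod}\text{-}(\mathrm{mod}\text{-}R))$ of all complexes $\mathbf{X}$ such that the evaluated complex $\mathbf{X}(R)$ of abelian groups is acyclic. $\mathbb{D}_R(\mathrm{Mod}\text{-}(\mathrm{mod}\text{-}R))$ is the Verdier quotient $\mathbb{K}(\mathrm{Mod}\text{-}(\mathrm{mod}\text{-}R))/\mathbb{K}_{R\text{-}\mathrm{ac}}(\mathrm{Mod}\text{-}(\mathrm{mod}\text{-}R))$. *)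

theory Defs
  imports "HOL-Algebra.Module" "HOL-Algebra.AbelCoset" "HOL-Library.Equipollence"
begin

section \<open>Categories, functors, natural transformations\<close>

text \<open>
  Hom-sets are indexed by pairs of objects, so composition takes the three objects as arguments:
  \<open>Cmp C X Y Z g f\<close> is \<open>g\<close> after \<open>f\<close> for \<open>f\<close> from \<open>X\<close> to \<open>Y\<close> and \<open>g\<close> from \<open>Y\<close> to \<open>Z\<close>.
  The fields are only meaningful on objects in \<open>Ob C\<close> and morphisms in the respective \<open>Hom\<close>.
\<close>

record ('o, 'm) category =
  Ob :: "'o set"
  Hom :: "'o \<Rightarrow> 'o \<Rightarrow> 'm set"
  Idm :: "'o \<Rightarrow> 'm"
  Cmp :: "'o \<Rightarrow> 'o \<Rightarrow> 'o \<Rightarrow> 'm \<Rightarrow> 'm \<Rightarrow> 'm"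

record ('o, 'm) preadditive = "('o, 'm) category" +
  Plus :: "'o \<Rightarrow> 'o \<Rightarrow> 'm \<Rightarrow> 'm \<Rightarrow> 'm"
  Zero :: "'o \<Rightarrow> 'o \<Rightarrow> 'm"
  Neg :: "'o \<Rightarrow> 'o \<Rightarrow> 'm \<Rightarrow> 'm"

definition is_iso :: "('o, 'm, 'x) category_scheme \<Rightarrow> 'o \<Rightarrow> 'o \<Rightarrow> 'm \<Rightarrow> bool" where
  "is_iso C X Y f \<longleftrightarrow> f \<in> Hom C X Y \<and>
     (\<exists>g \<in> Hom C Y X. Cmp C X Y X g f = Idm C X \<and> Cmp C Y X Y f g = Idm C Y)"

definition full_subcategory ::
  "('o, 'm, 'x) category_scheme \<Rightarrow> ('o \<Rightarrow> bool) \<Rightarrow> ('o, 'm, 'x) category_scheme" where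
  "full_subcategory C P = C\<lparr>Ob := {X \<in> Ob C. P X}\<rparr>"

definition opposite :: "('o, 'm) preadditive \<Rightarrow> ('o, 'm) preadditive" where
  "opposite C =
     \<lparr>Ob = Ob C,
      Hom = (\<lambda>X Y. Hom C Y X),
      Idm = Idm C,
      Cmp = (\<lambda>X Y Z g f. Cmp C Z Y X f g),
      Plus = (\<lambda>X Y. Plus C Y X),
      Zero = (\<lambda>X Y. Zero C Y X),
      Neg = (\<lambda>X Y. Neg C Y X)\<rparr>"

record ('o, 'm, 'p, 'n) cfunctor =
  on_ob :: "'o \<Rightarrow> 'p"
  on_hom :: "'o \<Rightarrow> 'o \<Rightarrow> 'm \<Rightarrow> 'n"

definition is_functor ::
  "('o, 'm, 'x) category_scheme \<Rightarrow> ('p, 'n, 'y) category_scheme \<Rightarrow> ('o, 'm, 'p, 'n) cfunctor \<Rightarrow> bool"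
  where
  "is_functor C D F \<longleftrightarrow>
     (\<forall>X \<in> Ob C. on_ob F X \<in> Ob D) \<and>
     (\<forall>X \<in> Ob C. \<forall>Y \<in> Ob C. \<forall>f \<in> Hom C X Y. on_hom F X Y f \<in> Hom D (on_ob F X) (on_ob F Y)) \<and>
     (\<forall>X \<in> Ob C. on_hom F X X (Idm C X) = Idm D (on_ob F X)) \<and>
     (\<forall>X \<in> Ob C. \<forall>Y \<in> Ob C. \<forall>Z \<in> Ob C. \<forall>f \<in> Hom C X Y. \<forall>g \<in> Hom C Y Z.
        on_hom F X Z (Cmp C X Y Z g f) =
        Cmp D (on_ob F X) (on_ob F Y) (on_ob F Z) (on_hom F Y Z g) (on_hom F X Y f))"

definition additive_functor ::
  "('o, 'm) preadditive \<Rightarrow> ('p, 'n) preadditive \<Rightarrow> ('o, 'm, 'p, 'n) cfunctor \<Rightarrow> bool" where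
  "additive_functor C D F \<longleftrightarrow> is_functor C D F \<and>
     (\<forall>X \<in> Ob C. \<forall>Y \<in> Ob C. \<forall>f \<in> Hom C X Y. \<forall>g \<in> Hom C X Y.
        on_hom F X Y (Plus C X Y f g) =
        Plus D (on_ob F X) (on_ob F Y) (on_hom F X Y f) (on_hom F X Y g))"

definition natural_transformation ::
  "('o, 'm, 'x) category_scheme \<Rightarrow> ('p, 'n, 'y) category_scheme \<Rightarrow>
   ('o, 'm, 'p, 'n) cfunctor \<Rightarrow> ('o, 'm, 'p, 'n) cfunctor \<Rightarrow> ('o \<Rightarrow> 'n) \<Rightarrow> bool" where
  "natural_transformation C D F G \<eta> \<longleftrightarrow>
     (\<forall>X \<in> Ob C. \<eta> X \<in> Hom D (on_ob F X) (on_ob G X)) \<and>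
     (\<forall>X \<in> Ob C. \<forall>Y \<in> Ob C. \<forall>f \<in> Hom C X Y.
        Cmp D (on_ob F X) (on_ob F Y) (on_ob G Y) (\<eta> Y) (on_hom F X Y f) =
        Cmp D (on_ob F X) (on_ob G X) (on_ob G Y) (on_hom G X Y f) (\<eta> X))"

definition natural_isomorphism ::
  "('o, 'm, 'x) category_scheme \<Rightarrow> ('p, 'n, 'y) category_scheme \<Rightarrow>
   ('o, 'm, 'p, 'n) cfunctor \<Rightarrow> ('o, 'm, 'p, 'n) cfunctor \<Rightarrow> ('o \<Rightarrow> 'n) \<Rightarrow> bool" where
  "natural_isomorphism C D F G \<eta> \<longleftrightarrow> natural_transformation C D F G \<eta> \<and>
     (\<forall>X \<in> Ob C. is_iso D (on_ob F X) (on_ob G X) (\<eta> X))"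

definition id_functor :: "('o, 'm, 'o, 'm) cfunctor" where
  "id_functor = \<lparr>on_ob = (\<lambda>X. X), on_hom = (\<lambda>X Y f. f)\<rparr>"

definition comp_functor ::
  "('p, 'n, 'q, 'l) cfunctor \<Rightarrow> ('o, 'm, 'p, 'n) cfunctor \<Rightarrow> ('o, 'm, 'q, 'l) cfunctor" where
  "comp_functor G F =
     \<lparr>on_ob = (\<lambda>X. on_ob G (on_ob F X)),
      on_hom = (\<lambda>X Y f. on_hom G (on_ob F X) (on_ob F Y) (on_hom F X Y f))\<rparr>"

definition equivalence_of_categories ::
  "('o, 'm, 'x) category_scheme \<Rightarrow> ('p, 'n, 'y) category_scheme \<Rightarrow> ('o, 'm, 'p, 'n) cfunctor \<Rightarrow> bool"
  where
  "equivalence_of_categories C D F \<longleftrightarrow> is_functor C D F \<and>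
     (\<exists>G. is_functor D C G \<and>
        (\<exists>\<eta>. natural_isomorphism C C id_functor (comp_functor G F) \<eta>) \<and>
        (\<exists>\<epsilon>. natural_isomorphism D D (comp_functor F G) id_functor \<epsilon>))"

text \<open>
  The category of additive functors, with pointwise operations. Natural transformations are made
  extensional on \<open>Ob C\<close>, so that equality of morphisms is equality of all components.
\<close>

definition additive_functor_category ::
  "('o, 'm) preadditive \<Rightarrow> ('p, 'n) preadditive \<Rightarrow>
   (('o, 'm, 'p, 'n) cfunctor, 'o \<Rightarrow> 'n) preadditive" where
  "additive_functor_category C D =
     \<lparr>Ob = {F. additive_functor C D F},
      Hom = (\<lambda>F G. {\<eta>. natural_transformation C D F G \<eta>} \<inter> extensional (Ob C)),
      Idm = (\<lambda>F. \<lambda>X \<in> Ob C. Idm D (on_ob F X)),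
      Cmp = (\<lambda>F G H \<beta> \<alpha>. \<lambda>X \<in> Ob C. Cmp D (on_ob F X) (on_ob G X) (on_ob H X) (\<beta> X) (\<alpha> X)),
      Plus = (\<lambda>F G \<alpha> \<beta>. \<lambda>X \<in> Ob C. Plus D (on_ob F X) (on_ob G X) (\<alpha> X) (\<beta> X)),
      Zero = (\<lambda>F G. \<lambda>X \<in> Ob C. Zero D (on_ob F X) (on_ob G X)),
      Neg = (\<lambda>F G \<alpha>. \<lambda>X \<in> Ob C. Neg D (on_ob F X) (on_ob G X) (\<alpha> X))\<rparr>"


section \<open>Triangulated structure\<close>

text \<open>
  A category with a shift endofunctor (\<open>ShO\<close>, \<open>ShM\<close>) and a class \<open>Tri\<close> of distinguished triangles;
  \<open>(X, Y, Z, u, v, w)\<close> stands for \<open>X \<rightarrow> Y \<rightarrow> Z \<rightarrow> ShO X\<close>.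
\<close>

type_synonym ('o, 'm) triangle = "'o \<times> 'o \<times> 'o \<times> 'm \<times> 'm \<times> 'm"

record ('o, 'm) tricategory = "('o, 'm) category" +
  ShO :: "'o \<Rightarrow> 'o"
  ShM :: "'o \<Rightarrow> 'o \<Rightarrow> 'm \<Rightarrow> 'm"
  Tri :: "('o, 'm) triangle set"

fun is_triangle :: "('o, 'm) tricategory \<Rightarrow> ('o, 'm) triangle \<Rightarrow> bool" where
  "is_triangle T (X, Y, Z, u, v, w) \<longleftrightarrow>
     X \<in> Ob T \<and> Y \<in> Ob T \<and> Z \<in> Ob T \<and>
     u \<in> Hom T X Y \<and> v \<in> Hom T Y Z \<and> w \<in> Hom T Z (ShO T X)"

fun isomorphic_triangles ::
  "('o, 'm) tricategory \<Rightarrow> ('o, 'm) triangle \<Rightarrow> ('o, 'm) triangle \<Rightarrow> bool" where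
  "isomorphic_triangles T (X, Y, Z, u, v, w) (X', Y', Z', u', v', w') \<longleftrightarrow>
     is_triangle T (X, Y, Z, u, v, w) \<and> is_triangle T (X', Y', Z', u', v', w') \<and>
     (\<exists>a b c. is_iso T X X' a \<and> is_iso T Y Y' b \<and> is_iso T Z Z' c \<and>
        Cmp T X Y Y' b u = Cmp T X X' Y' u' a \<and>
        Cmp T Y Z Z' c v = Cmp T Y Y' Z' v' b \<and>
        Cmp T Z (ShO T X) (ShO T X') (ShM T X X' a) w = Cmp T Z Z' (ShO T X') w' c)"

definition close_triangles :: "('o, 'm) tricategory \<Rightarrow> ('o, 'm) tricategory" where
  "close_triangles T = T\<lparr>Tri := {t. \<exists>s \<in> Tri T. isomorphic_triangles T s t}\<rparr>"

definition shift_functor :: "('o, 'm) tricategory \<Rightarrow> ('o, 'm, 'o, 'm) cfunctor" where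
  "shift_functor T = \<lparr>on_ob = ShO T, on_hom = ShM T\<rparr>"

definition triangle_functor ::
  "('o, 'm) tricategory \<Rightarrow> ('p, 'n) tricategory \<Rightarrow>
   ('o, 'm, 'p, 'n) cfunctor \<Rightarrow> ('o \<Rightarrow> 'n) \<Rightarrow> bool" where
  "triangle_functor T T' F \<theta> \<longleftrightarrow> is_functor T T' F \<and>
     natural_isomorphism T T' (comp_functor F (shift_functor T)) (comp_functor (shift_functor T') F) \<theta> \<and>
     (\<forall>X Y Z u v w. (X, Y, Z, u, v, w) \<in> Tri T \<longrightarrow>
        (on_ob F X, on_ob F Y, on_ob F Z, on_hom F X Y u, on_hom F Y Z v,
         Cmp T' (on_ob F Z) (on_ob F (ShO T X)) (ShO T' (on_ob F X)) (\<theta> X) (on_hom F Z (ShO T X) w))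
        \<in> Tri T')"

definition triangle_equivalent :: "('o, 'm) tricategory \<Rightarrow> ('p, 'n) tricategory \<Rightarrow> bool" where
  "triangle_equivalent T T' \<longleftrightarrow>
     (\<exists>F \<theta>. triangle_functor T T' F \<theta> \<and> equivalence_of_categories T T' F)"


section \<open>Verdier quotients\<close>

text \<open>
  The Verdier quotient of \<open>T\<close> by a triangulated subcategory with object class \<open>N\<close> is the localization
  of \<open>T\<close> at the morphisms whose cone lies in \<open>N\<close>. We use the construction of the localization that
  is available for every class \<open>S\<close> of morphisms: zigzags of morphisms of \<open>T\<close> and formal inverses of
  members of \<open>S\<close>, modulo the least congruence that makes the morphisms of \<open>T\<close> compose as in \<open>T\<close>
  and the formal inverses inverse. Zigzags are listed in the order in which they are traversed.
\<close>

definition cone_in :: "('o, 'm) tricategory \<Rightarrow> 'o set \<Rightarrow> ('o \<times> 'o \<times> 'm) set" where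
  "cone_in T N = {(X, Y, s). \<exists>Z v w. (X, Y, Z, s, v, w) \<in> Tri T \<and> Z \<in> N}"

text \<open>Both kinds of step record source and target of the underlying morphism of \<open>T\<close>;
  \<open>Bwd X Y s\<close> leads from \<open>Y\<close> to \<open>X\<close>.\<close>

datatype ('o, 'm) zstep = Fwd 'o 'o 'm | Bwd 'o 'o 'm

inductive zigzag ::
  "('o, 'm, 'x) category_scheme \<Rightarrow> ('o \<times> 'o \<times> 'm) set \<Rightarrow> 'o \<Rightarrow> 'o \<Rightarrow> ('o, 'm) zstep list \<Rightarrow> bool"
  for T S where
  zz_nil: "X \<in> Ob T \<Longrightarrow> zigzag T S X X []"
| zz_fwd: "\<lbrakk>X \<in> Ob T; Y \<in> Ob T; f \<in> Hom T X Y; zigzag T S Y Z p\<rbrakk> \<Longrightarrow> zigzag T S X Z (Fwd X Y f # p)"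
| zz_bwd: "\<lbrakk>X \<in> Ob T; Y \<in> Ob T; s \<in> Hom T X Y; (X, Y, s) \<in> S; zigzag T S X Z p\<rbrakk>
            \<Longrightarrow> zigzag T S Y Z (Bwd X Y s # p)"

inductive zz_eq ::
  "('o, 'm, 'x) category_scheme \<Rightarrow> ('o \<times> 'o \<times> 'm) set \<Rightarrow> 'o \<Rightarrow> 'o \<Rightarrow>
   ('o, 'm) zstep list \<Rightarrow> ('o, 'm) zstep list \<Rightarrow> bool"
  for T S where
  zeq_refl: "zigzag T S X Y p \<Longrightarrow> zz_eq T S X Y p p"
| zeq_sym: "zz_eq T S X Y p q \<Longrightarrow> zz_eq T S X Y q p"
| zeq_trans: "\<lbrakk>zz_eq T S X Y p q; zz_eq T S X Y q r\<rbrakk> \<Longrightarrow> zz_eq T S X Y p r"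
| zeq_append: "\<lbrakk>zz_eq T S X Y p p'; zz_eq T S Y Z q q'\<rbrakk> \<Longrightarrow> zz_eq T S X Z (p @ q) (p' @ q')"
| zeq_id: "X \<in> Ob T \<Longrightarrow> zz_eq T S X X [Fwd X X (Idm T X)] []"
| zeq_comp: "\<lbrakk>X \<in> Ob T; Y \<in> Ob T; Z \<in> Ob T; f \<in> Hom T X Y; g \<in> Hom T Y Z\<rbrakk>
    \<Longrightarrow> zz_eq T S X Z [Fwd X Y f, Fwd Y Z g] [Fwd X Z (Cmp T X Y Z g f)]"
| zeq_inv1: "\<lbrakk>X \<in> Ob T; Y \<in> Ob T; s \<in> Hom T X Y; (X, Y, s) \<in> S\<rbrakk>
    \<Longrightarrow> zz_eq T S X X [Fwd X Y s, Bwd X Y s] []"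
| zeq_inv2: "\<lbrakk>X \<in> Ob T; Y \<in> Ob T; s \<in> Hom T X Y; (X, Y, s) \<in> S\<rbrakk>
    \<Longrightarrow> zz_eq T S Y Y [Bwd X Y s, Fwd X Y s] []"

definition zz_rel ::
  "('o, 'm, 'x) category_scheme \<Rightarrow> ('o \<times> 'o \<times> 'm) set \<Rightarrow> 'o \<Rightarrow> 'o \<Rightarrow>
   (('o, 'm) zstep list \<times> ('o, 'm) zstep list) set" where
  "zz_rel T S X Y = {(p, q). zz_eq T S X Y p q}"

fun shift_step :: "('o, 'm) tricategory \<Rightarrow> ('o, 'm) zstep \<Rightarrow> ('o, 'm) zstep" where
  "shift_step T (Fwd X Y f) = Fwd (ShO T X) (ShO T Y) (ShM T X Y f)"
| "shift_step T (Bwd X Y s) = Bwd (ShO T X) (ShO T Y) (ShM T X Y s)"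

definition verdier_quotient ::
  "('o, 'm) tricategory \<Rightarrow> 'o set \<Rightarrow> ('o, ('o, 'm) zstep list set) tricategory" where
  "verdier_quotient T N =
     (let S = cone_in T N;
          Q = (\<lambda>X Y f. zz_rel T S X Y `` {[Fwd X Y f]})
      in close_triangles
        \<lparr>Ob = Ob T,
         Hom = (\<lambda>X Y. {p. zigzag T S X Y p} // zz_rel T S X Y),
         Idm = (\<lambda>X. zz_rel T S X X `` {[]}),
         Cmp = (\<lambda>X Y Z G F. \<Union>q \<in> G. \<Union>p \<in> F. zz_rel T S X Z `` {p @ q}),
         ShO = ShO T,
         ShM = (\<lambda>X Y F. \<Union>p \<in> F. zz_rel T S (ShO T X) (ShO T Y) `` {map (shift_step T) p}),
         Tri = {(X, Y, Z, Q X Y u, Q Y Z v, Q Z (ShO T X) w) | X Y Z u v w.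
                  (X, Y, Z, u, v, w) \<in> Tri T}\<rparr>)"


section \<open>The homotopy category of an additive category\<close>

record ('o, 'm) cochain =
  cobj :: "int \<Rightarrow> 'o"
  cdiff :: "int \<Rightarrow> 'm"

definition complexes :: "('o, 'm) preadditive \<Rightarrow> ('o, 'm) cochain set" where
  "complexes A = {X. \<forall>n. cobj X n \<in> Ob A \<and> cdiff X n \<in> Hom A (cobj X n) (cobj X (n + 1)) \<and>
     Cmp A (cobj X n) (cobj X (n + 1)) (cobj X (n + 2)) (cdiff X (n + 1)) (cdiff X n) =
     Zero A (cobj X n) (cobj X (n + 2))}"

definition chain_maps ::
  "('o, 'm) preadditive \<Rightarrow> ('o, 'm) cochain \<Rightarrow> ('o, 'm) cochain \<Rightarrow> (int \<Rightarrow> 'm) set" where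
  "chain_maps A X Y = {f. \<forall>n. f n \<in> Hom A (cobj X n) (cobj Y n) \<and>
     Cmp A (cobj X n) (cobj Y n) (cobj Y (n + 1)) (cdiff Y n) (f n) =
     Cmp A (cobj X n) (cobj X (n + 1)) (cobj Y (n + 1)) (f (n + 1)) (cdiff X n)}"

text \<open>The homotopy relation \<open>f = g + (d s + s d)\<close>.\<close>

definition homotopy_rel ::
  "('o, 'm) preadditive \<Rightarrow> ('o, 'm) cochain \<Rightarrow> ('o, 'm) cochain \<Rightarrow>
   ((int \<Rightarrow> 'm) \<times> (int \<Rightarrow> 'm)) set" where
  "homotopy_rel A X Y = {(f, g). f \<in> chain_maps A X Y \<and> g \<in> chain_maps A X Y \<and>
     (\<exists>s. \<forall>n. s n \<in> Hom A (cobj X n) (cobj Y (n - 1)) \<and>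
        f n = Plus A (cobj X n) (cobj Y n) (g n)
          (Plus A (cobj X n) (cobj Y n)
            (Cmp A (cobj X n) (cobj Y (n - 1)) (cobj Y n) (cdiff Y (n - 1)) (s n))
            (Cmp A (cobj X n) (cobj X (n + 1)) (cobj Y n) (s (n + 1)) (cdiff X n))))}"

definition shift_complex :: "('o, 'm) preadditive \<Rightarrow> ('o, 'm) cochain \<Rightarrow> ('o, 'm) cochain" where
  "shift_complex A X =
     \<lparr>cobj = (\<lambda>n. cobj X (n + 1)),
      cdiff = (\<lambda>n. Neg A (cobj X (n + 1)) (cobj X (n + 2)) (cdiff X (n + 1)))\<rparr>"

definition is_biproduct ::
  "('o, 'm) preadditive \<Rightarrow> 'o \<Rightarrow> 'o \<Rightarrow> 'o \<Rightarrow> 'm \<Rightarrow> 'm \<Rightarrow> 'm \<Rightarrow> 'm \<Rightarrow> bool" where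
  "is_biproduct A U V W iU iV pU pV \<longleftrightarrow>
     iU \<in> Hom A U W \<and> iV \<in> Hom A V W \<and> pU \<in> Hom A W U \<and> pV \<in> Hom A W V \<and>
     Cmp A U W U pU iU = Idm A U \<and> Cmp A V W V pV iV = Idm A V \<and>
     Cmp A U W V pV iU = Zero A U V \<and> Cmp A V W U pU iV = Zero A V U \<and>
     Plus A W W (Cmp A W U W iU pU) (Cmp A W V W iV pV) = Idm A W"

text \<open>
  \<open>C\<close> is a mapping cone of \<open>f : X \<rightarrow> Y\<close> with canonical chain maps \<open>i : Y \<rightarrow> C\<close> and \<open>p : C \<rightarrow> X[1]\<close>:
  in degree \<open>n\<close> it is a biproduct of \<open>X\<^sup>n\<^sup>+\<^sup>1\<close> (inclusion \<open>j n\<close>, projection \<open>p n\<close>) and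
  \<open>Y\<^sup>n\<close> (inclusion \<open>i n\<close>, projection \<open>q n\<close>), and its differential is
  \<open>i d q + (i f p + j (-d) p)\<close>, that is \<open>(x, y) \<mapsto> (- d x, f x + d y)\<close>.
\<close>

definition is_mapping_cone ::
  "('o, 'm) preadditive \<Rightarrow> ('o, 'm) cochain \<Rightarrow> ('o, 'm) cochain \<Rightarrow> (int \<Rightarrow> 'm) \<Rightarrow>
   ('o, 'm) cochain \<Rightarrow> (int \<Rightarrow> 'm) \<Rightarrow> (int \<Rightarrow> 'm) \<Rightarrow> bool" where
  "is_mapping_cone A X Y f C i p \<longleftrightarrow>
     X \<in> complexes A \<and> Y \<in> complexes A \<and> C \<in> complexes A \<and>
     f \<in> chain_maps A X Y \<and> i \<in> chain_maps A Y C \<and> p \<in> chain_maps A C (shift_complex A X) \<and>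
     (\<exists>j q. \<forall>n.
        is_biproduct A (cobj X (n + 1)) (cobj Y n) (cobj C n) (j n) (i n) (p n) (q n) \<and>
        cdiff C n =
          Plus A (cobj C n) (cobj C (n + 1))
            (Cmp A (cobj C n) (cobj Y (n + 1)) (cobj C (n + 1)) (i (n + 1))
              (Cmp A (cobj C n) (cobj Y n) (cobj Y (n + 1)) (cdiff Y n) (q n)))
            (Plus A (cobj C n) (cobj C (n + 1))
              (Cmp A (cobj C n) (cobj Y (n + 1)) (cobj C (n + 1)) (i (n + 1))
                (Cmp A (cobj C n) (cobj X (n + 1)) (cobj Y (n + 1)) (f (n + 1)) (p n)))
              (Cmp A (cobj C n) (cobj X (n + 2)) (cobj C (n + 1)) (j (n + 1))
                (Cmp A (cobj C n) (cobj X (n + 1)) (cobj X (n + 2))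
                  (cdiff (shift_complex A X) n) (p n)))))"

definition homotopy_category ::
  "('o, 'm) preadditive \<Rightarrow> (('o, 'm) cochain, (int \<Rightarrow> 'm) set) tricategory" where
  "homotopy_category A =
     (let cls = (\<lambda>X Y f. homotopy_rel A X Y `` {f}) in
      close_triangles
        \<lparr>Ob = complexes A,
         Hom = (\<lambda>X Y. chain_maps A X Y // homotopy_rel A X Y),
         Idm = (\<lambda>X. cls X X (\<lambda>n. Idm A (cobj X n))),
         Cmp = (\<lambda>X Y Z G F. \<Union>g \<in> G. \<Union>f \<in> F.
                  cls X Z (\<lambda>n. Cmp A (cobj X n) (cobj Y n) (cobj Z n) (g n) (f n))),
         ShO = shift_complex A,
         ShM = (\<lambda>X Y F. \<Union>f \<in> F. cls (shift_complex A X) (shift_complex A Y) (\<lambda>n. f (n + 1))),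
         Tri = {(X, Y, C, cls X Y f, cls Y C i, cls C (shift_complex A X) p) | X Y C f i p.
                  is_mapping_cone A X Y f C i p}\<rparr>)"


section \<open>Modules and abelian groups\<close>

text \<open>
  Size convention. The type \<open>'u\<close> plays the role of the universe: the small sets are the subsets
  of \<open>'u\<close> of cardinality less than that of \<open>'u\<close>, rings are small rings, and "all" modules or
  abelian groups means all small ones. If the cardinality of \<open>'u\<close> is inaccessible, these are, up to
  isomorphism, the modules and abelian groups in a Grothendieck universe.
\<close>

definition small :: "'u set \<Rightarrow> bool" where
  "small A \<longleftrightarrow> A \<prec> (UNIV :: 'u set)"

text \<open>
  The scalar operation \<open>a \<odot>\<^bsub>M\<^esub> x\<close> of the record type of modules denotes \<open>x\<close> times \<open>a\<close>,
  with the scalar acting from the right. The multiplicative fields of the record are not used.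
\<close>

locale right_module = R?: ring R + M?: abelian_group M
  for R (structure) and M (structure) +
  assumes smult_closed: "\<lbrakk>a \<in> carrier R; x \<in> carrier M\<rbrakk> \<Longrightarrow> a \<odot>\<^bsub>M\<^esub> x \<in> carrier M"
    and smult_l_distr: "\<lbrakk>a \<in> carrier R; b \<in> carrier R; x \<in> carrier M\<rbrakk>
          \<Longrightarrow> (a \<oplus>\<^bsub>R\<^esub> b) \<odot>\<^bsub>M\<^esub> x = (a \<odot>\<^bsub>M\<^esub> x) \<oplus>\<^bsub>M\<^esub> (b \<odot>\<^bsub>M\<^esub> x)"
    and smult_r_distr: "\<lbrakk>a \<in> carrier R; x \<in> carrier M; y \<in> carrier M\<rbrakk>
          \<Longrightarrow> a \<odot>\<^bsub>M\<^esub> (x \<oplus>\<^bsub>M\<^esub> y) = (a \<odot>\<^bsub>M\<^esub> x) \<oplus>\<^bsub>M\<^esub> (a \<odot>\<^bsub>M\<^esub> y)"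
    and smult_assoc: "\<lbrakk>a \<in> carrier R; b \<in> carrier R; x \<in> carrier M\<rbrakk>
          \<Longrightarrow> (a \<otimes>\<^bsub>R\<^esub> b) \<odot>\<^bsub>M\<^esub> x = b \<odot>\<^bsub>M\<^esub> (a \<odot>\<^bsub>M\<^esub> x)"
    and smult_one: "x \<in> carrier M \<Longrightarrow> \<one>\<^bsub>R\<^esub> \<odot>\<^bsub>M\<^esub> x = x"

definition rmod_hom ::
  "('r, 'x) ring_scheme \<Rightarrow> ('r, 'a) module \<Rightarrow> ('r, 'b) module \<Rightarrow> ('a \<Rightarrow> 'b) set" where
  "rmod_hom R M N = {f \<in> hom (add_monoid M) (add_monoid N) \<inter> extensional (carrier M).
     \<forall>a \<in> carrier R. \<forall>x \<in> carrier M. f (a \<odot>\<^bsub>M\<^esub> x) = a \<odot>\<^bsub>N\<^esub> f x}"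

definition regular_rmod :: "('r, 'x) ring_scheme \<Rightarrow> ('r, 'r) module" where
  "regular_rmod R =
     \<lparr>carrier = carrier R, mult = mult R, one = one R, zero = zero R, add = add R,
      smult = (\<lambda>a x. x \<otimes>\<^bsub>R\<^esub> a)\<rparr>"

definition free_rmod :: "('r, 'x) ring_scheme \<Rightarrow> nat \<Rightarrow> ('r, nat \<Rightarrow> 'r) module" where
  "free_rmod R n =
     \<lparr>carrier = (\<Pi>\<^sub>E i \<in> {..<n}. carrier R),
      mult = undefined, one = undefined,
      zero = (\<lambda>i \<in> {..<n}. \<zero>\<^bsub>R\<^esub>),
      add = (\<lambda>x y. \<lambda>i \<in> {..<n}. x i \<oplus>\<^bsub>R\<^esub> y i),
      smult = (\<lambda>a x. \<lambda>i \<in> {..<n}. x i \<otimes>\<^bsub>R\<^esub> a)\<rparr>"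

definition finitely_generated :: "('r, 'x) ring_scheme \<Rightarrow> ('r, 'a) module \<Rightarrow> bool" where
  "finitely_generated R M \<longleftrightarrow>
     (\<exists>n. \<exists>\<psi> \<in> rmod_hom R (free_rmod R n) M. \<psi> ` carrier (free_rmod R n) = carrier M)"

definition finitely_presented :: "('r, 'x) ring_scheme \<Rightarrow> ('r, 'a) module \<Rightarrow> bool" where
  "finitely_presented R M \<longleftrightarrow>
     (\<exists>m n. \<exists>\<phi> \<in> rmod_hom R (free_rmod R m) (free_rmod R n). \<exists>\<psi> \<in> rmod_hom R (free_rmod R n) M.
        \<psi> ` carrier (free_rmod R n) = carrier M \<and>
        \<phi> ` carrier (free_rmod R m) = a_kernel (free_rmod R n) M \<psi>)"

definition right_ideal :: "'r set \<Rightarrow> ('r, 'x) ring_scheme \<Rightarrow> bool" where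
  "right_ideal I R \<longleftrightarrow> additive_subgroup I R \<and>
     (\<forall>x \<in> I. \<forall>a \<in> carrier R. x \<otimes>\<^bsub>R\<^esub> a \<in> I)"

definition right_coherent :: "('r, 'x) ring_scheme \<Rightarrow> bool" where
  "right_coherent R \<longleftrightarrow>
     (\<forall>I. right_ideal I R \<and> finitely_generated R ((regular_rmod R)\<lparr>carrier := I\<rparr>) \<longrightarrow>
        finitely_presented R ((regular_rmod R)\<lparr>carrier := I\<rparr>))"

text \<open>\<open>Mod-R\<close>, \<open>mod-R\<close>, and the category of abelian groups. Morphisms are extensional functions.\<close>

definition Mod_cat :: "('u, 'x) ring_scheme \<Rightarrow> (('u, 'u) module, 'u \<Rightarrow> 'u) preadditive" where
  "Mod_cat R =
     \<lparr>Ob = {M. right_module R M \<and> small (carrier M)},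
      Hom = rmod_hom R,
      Idm = (\<lambda>M. \<lambda>x \<in> carrier M. x),
      Cmp = (\<lambda>L M N g f. compose (carrier L) g f),
      Plus = (\<lambda>M N f g. \<lambda>x \<in> carrier M. f x \<oplus>\<^bsub>N\<^esub> g x),
      Zero = (\<lambda>M N. \<lambda>x \<in> carrier M. \<zero>\<^bsub>N\<^esub>),
      Neg = (\<lambda>M N f. \<lambda>x \<in> carrier M. \<ominus>\<^bsub>N\<^esub> f x)\<rparr>"

definition fp_mod_cat :: "('u, 'x) ring_scheme \<Rightarrow> (('u, 'u) module, 'u \<Rightarrow> 'u) preadditive" where
  "fp_mod_cat R = full_subcategory (Mod_cat R) (finitely_presented R)"

definition Ab_cat :: "('u monoid, 'u \<Rightarrow> 'u) preadditive" where
  "Ab_cat =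
     \<lparr>Ob = {G. comm_group G \<and> small (carrier G)},
      Hom = (\<lambda>G H. hom G H \<inter> extensional (carrier G)),
      Idm = (\<lambda>G. \<lambda>x \<in> carrier G. x),
      Cmp = (\<lambda>G H K g f. compose (carrier G) g f),
      Plus = (\<lambda>G H f g. \<lambda>x \<in> carrier G. f x \<otimes>\<^bsub>H\<^esub> g x),
      Zero = (\<lambda>G H. \<lambda>x \<in> carrier G. \<one>\<^bsub>H\<^esub>),
      Neg = (\<lambda>G H f. \<lambda>x \<in> carrier G. inv\<^bsub>H\<^esub> f x)\<rparr>"

text \<open>\<open>Mod-(mod-R)\<close>: additive contravariant functors from \<open>mod-R\<close> to abelian groups.\<close>

definition fp_functor_cat :: "('u, 'x) ring_scheme \<Rightarrow>
   ((('u, 'u) module, 'u \<Rightarrow> 'u, 'u monoid, 'u \<Rightarrow> 'u) cfunctor,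
    ('u, 'u) module \<Rightarrow> 'u \<Rightarrow> 'u) preadditive" where
  "fp_functor_cat R = additive_functor_category (opposite (fp_mod_cat R)) Ab_cat"


section \<open>The two derived categories\<close>

definition acyclic_groups :: "(('a, 'x) monoid_scheme, 'a \<Rightarrow> 'a) cochain \<Rightarrow> bool" where
  "acyclic_groups X \<longleftrightarrow>
     (\<forall>n. kernel (cobj X (n + 1)) (cobj X (n + 2)) (cdiff X (n + 1)) =
          cdiff X n ` carrier (cobj X n))"

definition acyclic_modules :: "(('r, 'a) module, 'a \<Rightarrow> 'a) cochain \<Rightarrow> bool" where
  "acyclic_modules X \<longleftrightarrow>
     (\<forall>n. a_kernel (cobj X (n + 1)) (cobj X (n + 2)) (cdiff X (n + 1)) =
          cdiff X n ` carrier (cobj X n))"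

definition evaluate_complex ::
  "'o \<Rightarrow> (('o, 'm, 'p, 'n) cfunctor, 'o \<Rightarrow> 'n) cochain \<Rightarrow> ('p, 'n) cochain" where
  "evaluate_complex P X = \<lparr>cobj = (\<lambda>n. on_ob (cobj X n) P), cdiff = (\<lambda>n. cdiff X n P)\<rparr>"

definition derived_Mod :: "('u, 'x) ring_scheme \<Rightarrow>
   ((('u, 'u) module, 'u \<Rightarrow> 'u) cochain,
    ((('u, 'u) module, 'u \<Rightarrow> 'u) cochain, (int \<Rightarrow> 'u \<Rightarrow> 'u) set) zstep list set) tricategory"
  where
  "derived_Mod R =
     (let K = homotopy_category (Mod_cat R)
      in verdier_quotient K {X \<in> Ob K. acyclic_modules X})"

type_synonym 'u fp_functor_complex =
  "((('u, 'u) module, 'u \<Rightarrow> 'u, 'u monoid, 'u \<Rightarrow> 'u) cfunctor,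
    ('u, 'u) module \<Rightarrow> 'u \<Rightarrow> 'u) cochain"

definition derived_R_fp_functors :: "('u, 'x) ring_scheme \<Rightarrow>
   ('u fp_functor_complex,
    ('u fp_functor_complex, (int \<Rightarrow> ('u, 'u) module \<Rightarrow> 'u \<Rightarrow> 'u) set) zstep list set) tricategory"
  where
  "derived_R_fp_functors R =
     (let K = homotopy_category (fp_functor_cat R)
      in verdier_quotient K {X \<in> Ob K. acyclic_groups (evaluate_complex (regular_rmod R) X)})"

end

theory Submission
  imports Defs
begin

text \<open>
  Evaluation at \<open>R\<close> is an additive functor \<open>e\<close> from \<open>Mod-(mod-R)\<close> to \<open>Mod-R\<close>, and the restricted Yoneda functor
  \<open>h M = Hom(-, M)\<close> goes the other way. The Yoneda map \<open>M \<rightarrow> e (h M)\<close> is an isomorphism, and the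
  transformation \<open>u: F \<rightarrow> h (e F)\<close>, \<open>x \<mapsto> (p \<mapsto> F(r \<mapsto> p r) x)\<close>, becomes this isomorphism under \<open>e\<close>. A complex of
  functors is \<open>R\<close>-acyclic iff \<open>e\<close> makes it acyclic, so \<open>e\<close> and \<open>h\<close> pass to the two Verdier quotients; the
  cone of \<open>u\<close> at a complex of functors is sent by \<open>e\<close> to a contractible complex, so \<open>u\<close> is
  inverted in the quotient, and the induced functors are mutually inverse equivalences. Both
  commute strictly with the shift and preserve mapping cones.
\<close>

section \<open>Preadditive categories\<close>

text \<open>Two obstacles shape the argument. The first is that \<open>h\<close> is only left exact:
  it may send an acyclic complex of modules to a complex of functors with cohomology at some
  finitely presented module. The class to be divided out ignores this, because it inspects a complex
  of functors at \<open>R\<close> alone, where \<open>h M\<close> gives back \<open>M\<close>.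
  Dually, what \<open>e\<close> forgets away from \<open>R\<close> is exactly what the quotient
  makes invisible. Since the quotient consists of zigzags with formal inverses, functors and natural
  transformations are extended to it one step at a time, by induction over zigzags and over the
  generators of the congruence. The second obstacle is size. A group of homomorphisms consists of
  functions on \<open>'u\<close>, whereas an object of \<open>Ab_cat\<close> has a small subset of
  \<open>'u\<close> as carrier. Maps out of a finitely generated module are determined by finitely
  many values, so in an infinite universe they can be copied into \<open>'u\<close> by an injection.
  Direct sums, from which mapping cones are built, likewise require pairs to be coded in
  \<open>'u\<close>.\<close>

locale category_laws =
  fixes C :: "('o, 'm, 'x) category_scheme"
  assumes idm_closed [simp]: "X \<in> Ob C \<Longrightarrow> Idm C X \<in> Hom C X X"
    and cmp_closed [simp]: "\<lbrakk>X \<in> Ob C; Y \<in> Ob C; Z \<in> Ob C; f \<in> Hom C X Y; g \<in> Hom C Y Z\<rbrakk>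
      \<Longrightarrow> Cmp C X Y Z g f \<in> Hom C X Z"
    and cmp_idm_left [simp]: "\<lbrakk>X \<in> Ob C; Y \<in> Ob C; f \<in> Hom C X Y\<rbrakk> \<Longrightarrow> Cmp C X Y Y (Idm C Y) f = f"
    and cmp_idm_right [simp]: "\<lbrakk>X \<in> Ob C; Y \<in> Ob C; f \<in> Hom C X Y\<rbrakk> \<Longrightarrow> Cmp C X X Y f (Idm C X) = f"
    and cmp_assoc: "\<lbrakk>W \<in> Ob C; X \<in> Ob C; Y \<in> Ob C; Z \<in> Ob C;
        f \<in> Hom C W X; g \<in> Hom C X Y; h \<in> Hom C Y Z\<rbrakk>
      \<Longrightarrow> Cmp C W X Z (Cmp C X Y Z h g) f = Cmp C W Y Z h (Cmp C W X Y g f)"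
begin

lemma is_iso_idm: "X \<in> Ob C \<Longrightarrow> is_iso C X X (Idm C X)"
  unfolding is_iso_def by auto

end

locale preadditive_laws = category_laws A for A :: "('o, 'm) preadditive" +
  assumes plus_closed [simp]: "\<lbrakk>X \<in> Ob A; Y \<in> Ob A; f \<in> Hom A X Y; g \<in> Hom A X Y\<rbrakk>
      \<Longrightarrow> Plus A X Y f g \<in> Hom A X Y"
    and zero_closed [simp]: "\<lbrakk>X \<in> Ob A; Y \<in> Ob A\<rbrakk> \<Longrightarrow> Zero A X Y \<in> Hom A X Y"
    and neg_closed [simp]: "\<lbrakk>X \<in> Ob A; Y \<in> Ob A; f \<in> Hom A X Y\<rbrakk> \<Longrightarrow> Neg A X Y f \<in> Hom A X Y"
    and plus_assoc: "\<lbrakk>X \<in> Ob A; Y \<in> Ob A; f \<in> Hom A X Y; g \<in> Hom A X Y; h \<in> Hom A X Y\<rbrakk>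
      \<Longrightarrow> Plus A X Y (Plus A X Y f g) h = Plus A X Y f (Plus A X Y g h)"
    and plus_comm: "\<lbrakk>X \<in> Ob A; Y \<in> Ob A; f \<in> Hom A X Y; g \<in> Hom A X Y\<rbrakk>
      \<Longrightarrow> Plus A X Y f g = Plus A X Y g f"
    and zero_plus [simp]: "\<lbrakk>X \<in> Ob A; Y \<in> Ob A; f \<in> Hom A X Y\<rbrakk> \<Longrightarrow> Plus A X Y (Zero A X Y) f = f"
    and neg_plus [simp]: "\<lbrakk>X \<in> Ob A; Y \<in> Ob A; f \<in> Hom A X Y\<rbrakk>
      \<Longrightarrow> Plus A X Y (Neg A X Y f) f = Zero A X Y"
    and cmp_plus_left: "\<lbrakk>X \<in> Ob A; Y \<in> Ob A; Z \<in> Ob A; f \<in> Hom A X Y; g \<in> Hom A Y Z; h \<in> Hom A Y Z\<rbrakk>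
      \<Longrightarrow> Cmp A X Y Z (Plus A Y Z g h) f = Plus A X Z (Cmp A X Y Z g f) (Cmp A X Y Z h f)"
    and cmp_plus_right: "\<lbrakk>X \<in> Ob A; Y \<in> Ob A; Z \<in> Ob A; f \<in> Hom A X Y; g \<in> Hom A X Y; h \<in> Hom A Y Z\<rbrakk>
      \<Longrightarrow> Cmp A X Y Z h (Plus A X Y f g) = Plus A X Z (Cmp A X Y Z h f) (Cmp A X Y Z h g)"
begin

lemma plus_lcomm:
  "\<lbrakk>X \<in> Ob A; Y \<in> Ob A; f \<in> Hom A X Y; g \<in> Hom A X Y; h \<in> Hom A X Y\<rbrakk>
      \<Longrightarrow> Plus A X Y f (Plus A X Y g h) = Plus A X Y g (Plus A X Y f h)"
  by (metis plus_assoc plus_comm)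

lemma plus_zero [simp]: "\<lbrakk>X \<in> Ob A; Y \<in> Ob A; f \<in> Hom A X Y\<rbrakk> \<Longrightarrow> Plus A X Y f (Zero A X Y) = f"
  by (metis plus_comm zero_plus zero_closed)

lemma plus_neg [simp]: "\<lbrakk>X \<in> Ob A; Y \<in> Ob A; f \<in> Hom A X Y\<rbrakk>
      \<Longrightarrow> Plus A X Y f (Neg A X Y f) = Zero A X Y"
  by (metis plus_comm neg_plus neg_closed)

lemma neg_unique:
  "\<lbrakk>X \<in> Ob A; Y \<in> Ob A; f \<in> Hom A X Y; g \<in> Hom A X Y; Plus A X Y f g = Zero A X Y\<rbrakk> \<Longrightarrow> g = Neg A X Y f"
  by (metis plus_assoc zero_plus plus_zero neg_plus neg_closed)

text \<open>The test by which zero morphisms are recognised: composition and additive functors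
  preserve sums, so they send zero to a solution of \<open>f + f = f\<close>.\<close>

lemma plus_idem_zero:
  "\<lbrakk>X \<in> Ob A; Y \<in> Ob A; f \<in> Hom A X Y; Plus A X Y f f = f\<rbrakk> \<Longrightarrow> f = Zero A X Y"
  by (metis plus_assoc zero_plus neg_plus neg_closed)

lemma neg_neg [simp]: "\<lbrakk>X \<in> Ob A; Y \<in> Ob A; f \<in> Hom A X Y\<rbrakk> \<Longrightarrow> Neg A X Y (Neg A X Y f) = f"
  by (metis neg_closed neg_plus neg_unique)

lemma neg_zero [simp]: "\<lbrakk>X \<in> Ob A; Y \<in> Ob A\<rbrakk> \<Longrightarrow> Neg A X Y (Zero A X Y) = Zero A X Y"
  by (metis zero_closed zero_plus neg_unique)

lemma cmp_zero_left [simp]: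
  assumes "X \<in> Ob A" "Y \<in> Ob A" "Z \<in> Ob A" "f \<in> Hom A X Y"
  shows "Cmp A X Y Z (Zero A Y Z) f = Zero A X Z"
  by (rule plus_idem_zero) (use assms in \<open>simp_all flip: cmp_plus_left\<close>)

lemma cmp_zero_right [simp]:
  assumes "X \<in> Ob A" "Y \<in> Ob A" "Z \<in> Ob A" "f \<in> Hom A Y Z"
  shows "Cmp A X Y Z f (Zero A X Y) = Zero A X Z"
  by (rule plus_idem_zero) (use assms in \<open>simp_all flip: cmp_plus_right\<close>)

lemma cmp_neg_left [simp]:
  assumes "X \<in> Ob A" "Y \<in> Ob A" "Z \<in> Ob A" "f \<in> Hom A X Y" "g \<in> Hom A Y Z"
  shows "Cmp A X Y Z (Neg A Y Z g) f = Neg A X Z (Cmp A X Y Z g f)"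
  by (rule neg_unique) (use assms in \<open>simp_all flip: cmp_plus_left\<close>)

lemma cmp_neg_right [simp]:
  assumes "X \<in> Ob A" "Y \<in> Ob A" "Z \<in> Ob A" "f \<in> Hom A X Y" "g \<in> Hom A Y Z"
  shows "Cmp A X Y Z g (Neg A X Y f) = Neg A X Z (Cmp A X Y Z g f)"
  by (rule neg_unique) (use assms in \<open>simp_all flip: cmp_plus_right\<close>)

lemma neg_plus_distrib [simp]:
  assumes "X \<in> Ob A" "Y \<in> Ob A" "f \<in> Hom A X Y" "g \<in> Hom A X Y"
  shows "Neg A X Y (Plus A X Y f g) = Plus A X Y (Neg A X Y f) (Neg A X Y g)"
proof -
  have "Plus A X Y (Plus A X Y f g) (Plus A X Y (Neg A X Y f) (Neg A X Y g)) =
        Plus A X Y (Plus A X Y f (Neg A X Y f)) (Plus A X Y g (Neg A X Y g))"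
    using assms by (simp only: plus_assoc plus_lcomm plus_closed neg_closed)
  also have "\<dots> = Zero A X Y" using assms by simp
  finally show ?thesis using assms by (metis neg_unique plus_closed neg_closed)
qed

text \<open>Associativity is used to bracket composites to the right, after which a known product
  \<open>h g = k\<close> is no longer a subterm. This form applies it inside a longer
  composite.\<close>

lemma cmp_eq_left:
  assumes "W \<in> Ob A" "X \<in> Ob A" "Y \<in> Ob A" "Z \<in> Ob A"
    and "f \<in> Hom A W X" "g \<in> Hom A X Y" "h \<in> Hom A Y Z" and "Cmp A X Y Z h g = k"
  shows "Cmp A W Y Z h (Cmp A W X Y g f) = Cmp A W X Z k f"
  using assms cmp_assoc by metis

end


section \<open>The homotopy category\<close>

text \<open>The differential of the Hom complex on a family of degree -1. Homotopic maps differ by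
  such a boundary, so only its additivity and its behaviour under composition matter.\<close>

definition homotopy_boundary ::
  "('o, 'm) preadditive \<Rightarrow> ('o, 'm) cochain \<Rightarrow> ('o, 'm) cochain \<Rightarrow> (int \<Rightarrow> 'm) \<Rightarrow> int \<Rightarrow> 'm" where
  "homotopy_boundary A X Y s n = Plus A (cobj X n) (cobj Y n)
     (Cmp A (cobj X n) (cobj Y (n - 1)) (cobj Y n) (cdiff Y (n - 1)) (s n))
     (Cmp A (cobj X n) (cobj X (n + 1)) (cobj Y n) (s (n + 1)) (cdiff X n))"

definition homotopy_class ::
  "('o, 'm) preadditive \<Rightarrow> ('o, 'm) cochain \<Rightarrow> ('o, 'm) cochain \<Rightarrow> (int \<Rightarrow> 'm) \<Rightarrow> (int \<Rightarrow> 'm) set" where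
  "homotopy_class A X Y f = homotopy_rel A X Y `` {f}"

definition chain_id :: "('o, 'm) preadditive \<Rightarrow> ('o, 'm) cochain \<Rightarrow> int \<Rightarrow> 'm" where
  "chain_id A X = (\<lambda>n. Idm A (cobj X n))"

definition chain_comp :: "('o, 'm) preadditive \<Rightarrow> ('o, 'm) cochain \<Rightarrow> ('o, 'm) cochain \<Rightarrow>
    ('o, 'm) cochain \<Rightarrow> (int \<Rightarrow> 'm) \<Rightarrow> (int \<Rightarrow> 'm) \<Rightarrow> int \<Rightarrow> 'm" where
  "chain_comp A X Y Z g f = (\<lambda>n. Cmp A (cobj X n) (cobj Y n) (cobj Z n) (g n) (f n))"

lemma homotopy_rel_iff:
  "(f, g) \<in> homotopy_rel A X Y \<longleftrightarrow> f \<in> chain_maps A X Y \<and> g \<in> chain_maps A X Y \<and>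
     (\<exists>s. \<forall>n. s n \<in> Hom A (cobj X n) (cobj Y (n - 1)) \<and>
        f n = Plus A (cobj X n) (cobj Y n) (g n) (homotopy_boundary A X Y s n))"
  unfolding homotopy_rel_def homotopy_boundary_def by simp

lemma complex_ob [simp]: "X \<in> complexes A \<Longrightarrow> cobj X n \<in> Ob A"
  unfolding complexes_def by blast

text \<open>The instances at \<open>n - 1\<close> and \<open>n + 1\<close> are separate because
  \<open>n - 1 + 1\<close> and \<open>n + 1 + 1\<close> do not match \<open>n\<close> and
  \<open>n + 2\<close> syntactically.\<close>

lemma cdiff_closed [simp]:
  assumes "X \<in> complexes A"
  shows "cdiff X n \<in> Hom A (cobj X n) (cobj X (n + 1))"
    and "cdiff X (n - 1) \<in> Hom A (cobj X (n - 1)) (cobj X n)"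
    and "cdiff X (n + 1) \<in> Hom A (cobj X (n + 1)) (cobj X (n + 2))"
proof -
  show *: "cdiff X n \<in> Hom A (cobj X n) (cobj X (n + 1))" for n
    using assms unfolding complexes_def by blast
  show "cdiff X (n - 1) \<in> Hom A (cobj X (n - 1)) (cobj X n)"
    using *[of "n - 1"] by simp
  show "cdiff X (n + 1) \<in> Hom A (cobj X (n + 1)) (cobj X (n + 2))"
    using *[of "n + 1"] by (simp add: add.assoc)
qed

lemma cdiff_cdiff [simp]:
  assumes "X \<in> complexes A"
  shows "Cmp A (cobj X n) (cobj X (n + 1)) (cobj X (n + 2)) (cdiff X (n + 1)) (cdiff X n) =
      Zero A (cobj X n) (cobj X (n + 2))"
    and "Cmp A (cobj X (n - 1)) (cobj X n) (cobj X (n + 1)) (cdiff X n) (cdiff X (n - 1)) =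
      Zero A (cobj X (n - 1)) (cobj X (n + 1))"
proof -
  show *: "Cmp A (cobj X n) (cobj X (n + 1)) (cobj X (n + 2)) (cdiff X (n + 1)) (cdiff X n) =
      Zero A (cobj X n) (cobj X (n + 2))" for n
    using assms unfolding complexes_def by blast
  show "Cmp A (cobj X (n - 1)) (cobj X n) (cobj X (n + 1)) (cdiff X n) (cdiff X (n - 1)) =
      Zero A (cobj X (n - 1)) (cobj X (n + 1))"
    using *[of "n - 1"] by (simp add: add.commute)
qed

lemma chain_map_closed [simp]: "f \<in> chain_maps A X Y \<Longrightarrow> f n \<in> Hom A (cobj X n) (cobj Y n)"
  unfolding chain_maps_def by blast

lemma chain_map_comm:
  assumes "f \<in> chain_maps A X Y"
  shows "Cmp A (cobj X n) (cobj Y n) (cobj Y (n + 1)) (cdiff Y n) (f n) =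
     Cmp A (cobj X n) (cobj X (n + 1)) (cobj Y (n + 1)) (f (n + 1)) (cdiff X n)"
    and "Cmp A (cobj X (n - 1)) (cobj Y (n - 1)) (cobj Y n) (cdiff Y (n - 1)) (f (n - 1)) =
     Cmp A (cobj X (n - 1)) (cobj X n) (cobj Y n) (f n) (cdiff X (n - 1))"
    and "Cmp A (cobj X (n + 1)) (cobj Y (n + 1)) (cobj Y (n + 2)) (cdiff Y (n + 1)) (f (n + 1)) =
     Cmp A (cobj X (n + 1)) (cobj X (n + 2)) (cobj Y (n + 2)) (f (n + 2)) (cdiff X (n + 1))"
proof -
  show *: "Cmp A (cobj X n) (cobj Y n) (cobj Y (n + 1)) (cdiff Y n) (f n) =
     Cmp A (cobj X n) (cobj X (n + 1)) (cobj Y (n + 1)) (f (n + 1)) (cdiff X n)" for n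
    using assms unfolding chain_maps_def by blast
  show "Cmp A (cobj X (n - 1)) (cobj Y (n - 1)) (cobj Y n) (cdiff Y (n - 1)) (f (n - 1)) =
     Cmp A (cobj X (n - 1)) (cobj X n) (cobj Y n) (f n) (cdiff X (n - 1))"
    using *[of "n - 1"] by simp
  show "Cmp A (cobj X (n + 1)) (cobj Y (n + 1)) (cobj Y (n + 2)) (cdiff Y (n + 1)) (f (n + 1)) =
     Cmp A (cobj X (n + 1)) (cobj X (n + 2)) (cobj Y (n + 2)) (f (n + 2)) (cdiff X (n + 1))"
    using *[of "n + 1"] by (simp add: add.assoc)
qed

section \<open>Homotopy as a congruence on chain maps\<close>

context preadditive_laws
begin

lemma chain_id_closed [simp]: "X \<in> complexes A \<Longrightarrow> chain_id A X \<in> chain_maps A X X"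
  unfolding chain_maps_def chain_id_def by simp

lemma chain_comp_closed [simp]:
  assumes "X \<in> complexes A" "Y \<in> complexes A" "Z \<in> complexes A"
    and f: "f \<in> chain_maps A X Y" and g: "g \<in> chain_maps A Y Z"
  shows "chain_comp A X Y Z g f \<in> chain_maps A X Z"
proof -
  have "Cmp A (cobj X n) (cobj Z n) (cobj Z (n + 1)) (cdiff Z n) (Cmp A (cobj X n) (cobj Y n) (cobj Z n) (g n) (f n)) =
    Cmp A (cobj X n) (cobj X (n + 1)) (cobj Z (n + 1))
      (Cmp A (cobj X (n + 1)) (cobj Y (n + 1)) (cobj Z (n + 1)) (g (n + 1)) (f (n + 1))) (cdiff X n)" for n
  proof -
    have "Cmp A (cobj X n) (cobj Z n) (cobj Z (n + 1)) (cdiff Z n) (Cmp A (cobj X n) (cobj Y n) (cobj Z n) (g n) (f n)) =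
      Cmp A (cobj X n) (cobj Y n) (cobj Z (n + 1))
       (Cmp A (cobj Y n) (cobj Z n) (cobj Z (n + 1)) (cdiff Z n) (g n)) (f n)"
      using assms by (simp add: cmp_assoc)
    also have "\<dots> = Cmp A (cobj X n) (cobj Y (n + 1)) (cobj Z (n + 1)) (g (n + 1))
        (Cmp A (cobj X n) (cobj Y n) (cobj Y (n + 1)) (cdiff Y n) (f n))"
      using assms by (simp add: chain_map_comm[OF g] cmp_assoc)
    finally show ?thesis using assms by (simp add: chain_map_comm[OF f] cmp_assoc)
  qed
  then show ?thesis using assms unfolding chain_maps_def chain_comp_def by simp
qed

lemma homotopy_boundary_closed [simp]:
  assumes "X \<in> complexes A" "Y \<in> complexes A" and s: "\<And>n. s n \<in> Hom A (cobj X n) (cobj Y (n - 1))"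
  shows "homotopy_boundary A X Y s n \<in> Hom A (cobj X n) (cobj Y n)"
  using assms(1,2) s[of n] s[of "n + 1"] unfolding homotopy_boundary_def by simp

lemma homotopy_boundary_zero:
  assumes "X \<in> complexes A" "Y \<in> complexes A"
  shows "homotopy_boundary A X Y (\<lambda>n. Zero A (cobj X n) (cobj Y (n - 1))) n = Zero A (cobj X n) (cobj Y n)"
  using assms unfolding homotopy_boundary_def by simp

lemma homotopy_boundary_neg:
  assumes "X \<in> complexes A" "Y \<in> complexes A" and s: "\<And>n. s n \<in> Hom A (cobj X n) (cobj Y (n - 1))"
  shows "homotopy_boundary A X Y (\<lambda>n. Neg A (cobj X n) (cobj Y (n - 1)) (s n)) n =
    Neg A (cobj X n) (cobj Y n) (homotopy_boundary A X Y s n)"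
  using assms(1,2) s[of n] s[of "n + 1"] unfolding homotopy_boundary_def by simp

lemma homotopy_boundary_plus:
  assumes "X \<in> complexes A" "Y \<in> complexes A"
    and s: "\<And>n. s n \<in> Hom A (cobj X n) (cobj Y (n - 1))" and t: "\<And>n. t n \<in> Hom A (cobj X n) (cobj Y (n - 1))"
  shows "homotopy_boundary A X Y (\<lambda>n. Plus A (cobj X n) (cobj Y (n - 1)) (s n) (t n)) n =
    Plus A (cobj X n) (cobj Y n) (homotopy_boundary A X Y s n) (homotopy_boundary A X Y t n)"
  using assms(1,2) s[of n] s[of "n + 1"] t[of n] t[of "n + 1"] unfolding homotopy_boundary_def
  by (simp add: cmp_plus_left cmp_plus_right plus_assoc plus_lcomm)

text \<open>A chain map is a cycle of the Hom complex, so by the Leibniz rule only the boundary of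
  the homotopy survives. As \<open>s n\<close> ends in degree \<open>n - 1\<close>, it is followed
  by \<open>g (n - 1)\<close>; precomposition uses \<open>f n\<close> instead.\<close>

lemma homotopy_boundary_cmp_left:
  assumes X: "X \<in> complexes A" "Y \<in> complexes A" "Z \<in> complexes A"
    and s: "\<And>n. s n \<in> Hom A (cobj X n) (cobj Y (n - 1))" and g: "g \<in> chain_maps A Y Z"
  shows "homotopy_boundary A X Z (\<lambda>n. Cmp A (cobj X n) (cobj Y (n - 1)) (cobj Z (n - 1)) (g (n - 1)) (s n)) n =
    Cmp A (cobj X n) (cobj Y n) (cobj Z n) (g n) (homotopy_boundary A X Y s n)"
proof -
  have s': "s (n + 1) \<in> Hom A (cobj X (n + 1)) (cobj Y n)" using s[of "n + 1"] by simp
  show ?thesis using X s[of n] s' g unfolding homotopy_boundary_def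
    by (simp add: cmp_plus_right cmp_assoc cmp_eq_left[OF _ _ _ _ _ _ _ chain_map_comm(2)[OF g]])
qed

lemma homotopy_boundary_cmp_right:
  assumes X: "X \<in> complexes A" "Y \<in> complexes A" "Z \<in> complexes A"
    and s: "\<And>n. s n \<in> Hom A (cobj Y n) (cobj Z (n - 1))" and f: "f \<in> chain_maps A X Y"
  shows "homotopy_boundary A X Z (\<lambda>n. Cmp A (cobj X n) (cobj Y n) (cobj Z (n - 1)) (s n) (f n)) n =
    Cmp A (cobj X n) (cobj Y n) (cobj Z n) (homotopy_boundary A Y Z s n) (f n)"
proof -
  have s': "s (n + 1) \<in> Hom A (cobj Y (n + 1)) (cobj Z n)" using s[of "n + 1"] by simp
  show ?thesis using X s[of n] s' f unfolding homotopy_boundary_def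
    by (simp add: cmp_plus_left cmp_assoc chain_map_comm(1)[OF f])
qed

text \<open>The boundary is additive in the homotopy, so zero, negated and added homotopies witness
  the three properties.\<close>

lemma homotopy_rel_equiv:
  assumes X: "X \<in> complexes A" "Y \<in> complexes A"
  shows "equiv (chain_maps A X Y) (homotopy_rel A X Y)"
proof (rule equivI)
  show "homotopy_rel A X Y \<subseteq> chain_maps A X Y \<times> chain_maps A X Y"
    by (auto simp: homotopy_rel_iff)
  show "refl_on (chain_maps A X Y) (homotopy_rel A X Y)"
  proof (rule refl_onI)
    fix f assume "f \<in> chain_maps A X Y"
    then show "(f, f) \<in> homotopy_rel A X Y" using X unfolding homotopy_rel_iff
      by (intro conjI exI[of _ "\<lambda>n. Zero A (cobj X n) (cobj Y (n - 1))"])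
         (simp_all add: homotopy_boundary_zero)
  qed
  show "sym (homotopy_rel A X Y)"
  proof (rule symI)
    fix f g assume "(f, g) \<in> homotopy_rel A X Y"
    then obtain s where fg: "f \<in> chain_maps A X Y" "g \<in> chain_maps A X Y"
      and s: "\<And>n. s n \<in> Hom A (cobj X n) (cobj Y (n - 1))"
      and eq: "\<And>n. f n = Plus A (cobj X n) (cobj Y n) (g n) (homotopy_boundary A X Y s n)"
      unfolding homotopy_rel_iff by blast
    then show "(g, f) \<in> homotopy_rel A X Y" using X unfolding homotopy_rel_iff
      by (intro conjI exI[of _ "\<lambda>n. Neg A (cobj X n) (cobj Y (n - 1)) (s n)"])
         (simp_all add: homotopy_boundary_neg plus_assoc)
  qed
  show "trans (homotopy_rel A X Y)"
  proof (rule transI)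
    fix f g h assume "(f, g) \<in> homotopy_rel A X Y" "(g, h) \<in> homotopy_rel A X Y"
    then obtain s t where fg: "f \<in> chain_maps A X Y" "g \<in> chain_maps A X Y" "h \<in> chain_maps A X Y"
      and s: "\<And>n. s n \<in> Hom A (cobj X n) (cobj Y (n - 1))"
      and eq: "\<And>n. f n = Plus A (cobj X n) (cobj Y n) (g n) (homotopy_boundary A X Y s n)"
      and t: "\<And>n. t n \<in> Hom A (cobj X n) (cobj Y (n - 1))"
      and eq': "\<And>n. g n = Plus A (cobj X n) (cobj Y n) (h n) (homotopy_boundary A X Y t n)"
      unfolding homotopy_rel_iff by blast
    then show "(f, h) \<in> homotopy_rel A X Y" using X unfolding homotopy_rel_iff
      by (intro conjI exI[of _ "\<lambda>n. Plus A (cobj X n) (cobj Y (n - 1)) (t n) (s n)"])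
         (simp_all add: homotopy_boundary_plus plus_assoc)
  qed
qed

lemma chain_comp_cong_left:
  assumes X: "X \<in> complexes A" "Y \<in> complexes A" "Z \<in> complexes A"
    and f: "f \<in> chain_maps A X Y" and g: "(g, g') \<in> homotopy_rel A Y Z"
  shows "(chain_comp A X Y Z g f, chain_comp A X Y Z g' f) \<in> homotopy_rel A X Z"
proof -
  obtain s where fg: "g \<in> chain_maps A Y Z" "g' \<in> chain_maps A Y Z"
      and s: "\<And>n. s n \<in> Hom A (cobj Y n) (cobj Z (n - 1))"
      and eq: "\<And>n. g n = Plus A (cobj Y n) (cobj Z n) (g' n) (homotopy_boundary A Y Z s n)"
    using g unfolding homotopy_rel_iff by blast
  show ?thesis unfolding homotopy_rel_iff using fg X f s
    by (intro conjI exI[of _ "\<lambda>n. Cmp A (cobj X n) (cobj Y n) (cobj Z (n - 1)) (s n) (f n)"])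
       (simp_all add: homotopy_boundary_cmp_right, simp_all add: chain_comp_def eq cmp_plus_left)
qed

lemma chain_comp_cong_right:
  assumes X: "X \<in> complexes A" "Y \<in> complexes A" "Z \<in> complexes A"
    and f: "(f, f') \<in> homotopy_rel A X Y" and g: "g \<in> chain_maps A Y Z"
  shows "(chain_comp A X Y Z g f, chain_comp A X Y Z g f') \<in> homotopy_rel A X Z"
proof -
  obtain s where fg: "f \<in> chain_maps A X Y" "f' \<in> chain_maps A X Y"
      and s: "\<And>n. s n \<in> Hom A (cobj X n) (cobj Y (n - 1))"
      and eq: "\<And>n. f n = Plus A (cobj X n) (cobj Y n) (f' n) (homotopy_boundary A X Y s n)"
    using f unfolding homotopy_rel_iff by blast
  show ?thesis unfolding homotopy_rel_iff using fg X g s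
    by (intro conjI exI[of _ "\<lambda>n. Cmp A (cobj X n) (cobj Y (n - 1)) (cobj Z (n - 1)) (g (n - 1)) (s n)"])
       (simp_all add: homotopy_boundary_cmp_left, simp_all add: chain_comp_def eq cmp_plus_right)
qed

end

section \<open>Triangulated data\<close>

text \<open>Closing changes only the field \<open>Tri\<close>, on which isomorphism of triangles
  does not depend. Hence the isomorphisms may be taken in the closed category, the one in which
  everything else is stated.\<close>

lemma Tri_close_triangles:
  "Tri (close_triangles T) = {t. \<exists>s \<in> Tri T. isomorphic_triangles (close_triangles T) s t}"
proof -
  have "isomorphic_triangles (close_triangles T) s t = isomorphic_triangles T s t" for s t
    unfolding close_triangles_def by (cases s; cases t) (simp add: is_iso_def)
  then show ?thesis by (simp add: close_triangles_def)
qed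

lemma is_functorD:
  assumes "is_functor C D F"
  shows "X \<in> Ob C \<Longrightarrow> on_ob F X \<in> Ob D"
    and "\<lbrakk>X \<in> Ob C; Y \<in> Ob C; f \<in> Hom C X Y\<rbrakk> \<Longrightarrow> on_hom F X Y f \<in> Hom D (on_ob F X) (on_ob F Y)"
    and "X \<in> Ob C \<Longrightarrow> on_hom F X X (Idm C X) = Idm D (on_ob F X)"
    and "\<lbrakk>X \<in> Ob C; Y \<in> Ob C; Z \<in> Ob C; f \<in> Hom C X Y; g \<in> Hom C Y Z\<rbrakk> \<Longrightarrow>
      on_hom F X Z (Cmp C X Y Z g f) =
        Cmp D (on_ob F X) (on_ob F Y) (on_ob F Z) (on_hom F Y Z g) (on_hom F X Y f)"
  using assms unfolding is_functor_def by blast+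

lemma is_functor_comp:
  assumes "is_functor C D F" "is_functor D E G"
  shows "is_functor C E (comp_functor G F)"
  using is_functorD[OF assms(1)] is_functorD[OF assms(2)]
  unfolding is_functor_def comp_functor_def by simp

lemma is_functor_iso:
  assumes F: "is_functor C D F" and "X \<in> Ob C" "Y \<in> Ob C" and f: "is_iso C X Y f"
  shows "is_iso D (on_ob F X) (on_ob F Y) (on_hom F X Y f)"
proof -
  obtain g where g: "f \<in> Hom C X Y" "g \<in> Hom C Y X"
    "Cmp C X Y X g f = Idm C X" "Cmp C Y X Y f g = Idm C Y"
    using f unfolding is_iso_def by blast
  then have "Cmp D (on_ob F X) (on_ob F Y) (on_ob F X) (on_hom F Y X g) (on_hom F X Y f) = Idm D (on_ob F X)"
    and "Cmp D (on_ob F Y) (on_ob F X) (on_ob F Y) (on_hom F X Y f) (on_hom F Y X g) = Idm D (on_ob F Y)"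
    using assms is_functorD[OF F] by metis+
  then show ?thesis unfolding is_iso_def using g assms is_functorD[OF F] by blast
qed

text \<open>A triangle equivalence compares shifts and classes of distinguished triangles; this
  locale is the common framework for doing so in homotopy categories and in their Verdier
  quotients.\<close>

locale shift_category = category_laws T for T :: "('o, 'm) tricategory" +
  assumes shift: "is_functor T T (shift_functor T)"
    and tri: "t \<in> Tri T \<Longrightarrow> is_triangle T t"
begin

lemma ShO_closed [simp]: "X \<in> Ob T \<Longrightarrow> ShO T X \<in> Ob T"
  using is_functorD(1)[OF shift] by (simp add: shift_functor_def)

lemma ShM_closed [simp]:
  "\<lbrakk>X \<in> Ob T; Y \<in> Ob T; f \<in> Hom T X Y\<rbrakk> \<Longrightarrow> ShM T X Y f \<in> Hom T (ShO T X) (ShO T Y)"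
  using is_functorD(2)[OF shift] by (simp add: shift_functor_def)

lemma ShM_idm: "X \<in> Ob T \<Longrightarrow> ShM T X X (Idm T X) = Idm T (ShO T X)"
  using is_functorD(3)[OF shift] by (simp add: shift_functor_def)

lemma isomorphic_triangles_refl:
  assumes "is_triangle T t" shows "isomorphic_triangles T t t"
proof -
  obtain X Y Z u v w where t: "t = (X, Y, Z, u, v, w)" by (cases t) auto
  show ?thesis unfolding t isomorphic_triangles.simps
    by (rule conjI[OF _ conjI], rule assms[unfolded t], rule assms[unfolded t],
        rule exI[of _ "Idm T X"], rule exI[of _ "Idm T Y"], rule exI[of _ "Idm T Z"])
       (use assms[unfolded t] in \<open>simp add: is_iso_idm ShM_idm\<close>)
qed

end

section \<open>Functors that commute strictly with the shift\<close>

definition shift_commuting ::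
  "('o, 'm) tricategory \<Rightarrow> ('p, 'n) tricategory \<Rightarrow> ('o, 'm, 'p, 'n) cfunctor \<Rightarrow> bool" where
  "shift_commuting T T' F \<longleftrightarrow> is_functor T T' F \<and>
     (\<forall>X \<in> Ob T. on_ob F (ShO T X) = ShO T' (on_ob F X)) \<and>
     (\<forall>X \<in> Ob T. \<forall>Y \<in> Ob T. \<forall>f \<in> Hom T X Y.
        on_hom F (ShO T X) (ShO T Y) (ShM T X Y f) = ShM T' (on_ob F X) (on_ob F Y) (on_hom F X Y f))"

lemma shift_commutingD:
  assumes "shift_commuting T T' F"
  shows "is_functor T T' F"
    and "X \<in> Ob T \<Longrightarrow> on_ob F (ShO T X) = ShO T' (on_ob F X)"
    and "\<lbrakk>X \<in> Ob T; Y \<in> Ob T; f \<in> Hom T X Y\<rbrakk> \<Longrightarrow>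
        on_hom F (ShO T X) (ShO T Y) (ShM T X Y f) = ShM T' (on_ob F X) (on_ob F Y) (on_hom F X Y f)"
  using assms unfolding shift_commuting_def by blast+

text \<open>The third morphism ends at \<open>on_ob F (ShO T X)\<close>. The result is a triangle in
  the target only through the equality of this object with the shift of
  \<open>on_ob F X\<close>.\<close>

fun map_triangle ::
  "('o, 'm) tricategory \<Rightarrow> ('o, 'm, 'p, 'n) cfunctor \<Rightarrow> ('o, 'm) triangle \<Rightarrow> ('p, 'n) triangle" where
  "map_triangle T F (X, Y, Z, u, v, w) = (on_ob F X, on_ob F Y, on_ob F Z,
     on_hom F X Y u, on_hom F Y Z v, on_hom F Z (ShO T X) w)"

lemma map_triangle_isomorphic:
  assumes T: "shift_category T" and T': "shift_category T'" and F: "shift_commuting T T' F"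
    and iso: "isomorphic_triangles T s t"
  shows "isomorphic_triangles T' (map_triangle T F s) (map_triangle T F t)"
proof -
  interpret T: shift_category T by (rule T)
  interpret T': shift_category T' by (rule T')
  note fn = is_functorD[OF shift_commutingD(1)[OF F]]
  note sh = shift_commutingD(2,3)[OF F]
  obtain X Y Z u v w X' Y' Z' u' v' w' where st: "s = (X, Y, Z, u, v, w)" "t = (X', Y', Z', u', v', w')"
    by (cases s, cases t) auto
  obtain a b c where tri: "is_triangle T (X, Y, Z, u, v, w)" "is_triangle T (X', Y', Z', u', v', w')"
    and abc: "is_iso T X X' a" "is_iso T Y Y' b" "is_iso T Z Z' c"
    and sq: "Cmp T X Y Y' b u = Cmp T X X' Y' u' a" "Cmp T Y Z Z' c v = Cmp T Y Y' Z' v' b"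
      "Cmp T Z (ShO T X) (ShO T X') (ShM T X X' a) w = Cmp T Z Z' (ShO T X') w' c"
    using iso unfolding st by auto
  have hom: "a \<in> Hom T X X'" "b \<in> Hom T Y Y'" "c \<in> Hom T Z Z'" using abc unfolding is_iso_def by auto
  have ob: "X \<in> Ob T" "Y \<in> Ob T" "Z \<in> Ob T" "X' \<in> Ob T" "Y' \<in> Ob T" "Z' \<in> Ob T"
    "u \<in> Hom T X Y" "v \<in> Hom T Y Z" "w \<in> Hom T Z (ShO T X)"
    "u' \<in> Hom T X' Y'" "v' \<in> Hom T Y' Z'" "w' \<in> Hom T Z' (ShO T X')"
    using tri by auto
  have w: "on_hom F Z (ShO T X) w \<in> Hom T' (on_ob F Z) (ShO T' (on_ob F X))"
    "on_hom F Z' (ShO T X') w' \<in> Hom T' (on_ob F Z') (ShO T' (on_ob F X'))"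
    using fn(2)[of Z "ShO T X" w] fn(2)[of Z' "ShO T X'" w'] ob sh by auto
  \<comment> \<open>The third square is first mapped with \<open>F\<close> of a shift at its
    corners; strict commutation then rewrites these corners as shifts in \<open>T'\<close>.\<close>
  have "Cmp T' (on_ob F Z) (on_ob F (ShO T X)) (on_ob F (ShO T X'))
      (on_hom F (ShO T X) (ShO T X') (ShM T X X' a)) (on_hom F Z (ShO T X) w) =
    Cmp T' (on_ob F Z) (on_ob F Z') (on_ob F (ShO T X')) (on_hom F Z' (ShO T X') w') (on_hom F Z Z' c)"
    using ob hom sq(3) by (simp flip: fn(4))
  then have sq3: "Cmp T' (on_ob F Z) (ShO T' (on_ob F X)) (ShO T' (on_ob F X'))
      (ShM T' (on_ob F X) (on_ob F X') (on_hom F X X' a)) (on_hom F Z (ShO T X) w) =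
    Cmp T' (on_ob F Z) (on_ob F Z') (ShO T' (on_ob F X')) (on_hom F Z' (ShO T X') w') (on_hom F Z Z' c)"
    using ob hom by (simp add: sh)
  have sq12: "Cmp T' (on_ob F X) (on_ob F Y) (on_ob F Y') (on_hom F Y Y' b) (on_hom F X Y u) =
      Cmp T' (on_ob F X) (on_ob F X') (on_ob F Y') (on_hom F X' Y' u') (on_hom F X X' a)"
    "Cmp T' (on_ob F Y) (on_ob F Z) (on_ob F Z') (on_hom F Z Z' c) (on_hom F Y Z v) =
      Cmp T' (on_ob F Y) (on_ob F Y') (on_ob F Z') (on_hom F Y' Z' v') (on_hom F Y Y' b)"
    using ob hom sq by (simp_all flip: fn(4))
  show ?thesis unfolding st map_triangle.simps isomorphic_triangles.simps
    by (rule conjI[OF _ conjI], simp add: fn(1,2) ob w, simp add: fn(1,2) ob w, rule exI[of _ "on_hom F X X' a"],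
        rule exI[of _ "on_hom F Y Y' b"], rule exI[of _ "on_hom F Z Z' c"])
       (simp add: sq12 sq3 ob abc is_functor_iso[OF shift_commutingD(1)[OF F]])
qed

definition strict_triangle_functor ::
  "('o, 'm) tricategory \<Rightarrow> ('p, 'n) tricategory \<Rightarrow> ('o, 'm, 'p, 'n) cfunctor \<Rightarrow> bool" where
  "strict_triangle_functor T T' F \<longleftrightarrow> shift_commuting T T' F \<and> (\<forall>t \<in> Tri T. map_triangle T F t \<in> Tri T')"

text \<open>Functors carry isomorphisms of triangles to isomorphisms of triangles, so it is enough
  to look at the generating triangles before closure.\<close>

lemma strict_triangle_functor_close:
  assumes T: "shift_category (close_triangles T)" and T': "shift_category (close_triangles T')"
    and F: "shift_commuting (close_triangles T) (close_triangles T') F"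
    and "\<And>t. t \<in> Tri T \<Longrightarrow> map_triangle T F t \<in> Tri T'"
  shows "strict_triangle_functor (close_triangles T) (close_triangles T') F"
proof -
  have "map_triangle (close_triangles T) F t = map_triangle T F t" for t
    by (cases t) (simp add: close_triangles_def)
  then have "map_triangle (close_triangles T) F t \<in> Tri (close_triangles T')"
    if "t \<in> Tri (close_triangles T)" for t
    using that assms(4) map_triangle_isomorphic[OF T T' F] by (fastforce simp only: Tri_close_triangles mem_Collect_eq)
  then show ?thesis unfolding strict_triangle_functor_def using F by blast
qed

text \<open>The comparison between the two composites with the shift can be the identity, and
  composing the third morphism with it changes nothing.\<close>

lemma strict_triangle_functor_imp:
  assumes T: "shift_category T" and T': "shift_category T'" and F: "strict_triangle_functor T T' F"
  shows "triangle_functor T T' F (\<lambda>X. Idm T' (on_ob F (ShO T X)))"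
proof -
  interpret T: shift_category T by (rule T)
  interpret T': shift_category T' by (rule T')
  have F': "shift_commuting T T' F" and tri: "\<And>t. t \<in> Tri T \<Longrightarrow> map_triangle T F t \<in> Tri T'"
    using F unfolding strict_triangle_functor_def by auto
  note fn = is_functorD[OF shift_commutingD(1)[OF F']]
  note sh = shift_commutingD(2,3)[OF F']
  have "(on_ob F X, on_ob F Y, on_ob F Z, on_hom F X Y u, on_hom F Y Z v,
         Cmp T' (on_ob F Z) (on_ob F (ShO T X)) (ShO T' (on_ob F X)) (Idm T' (on_ob F (ShO T X)))
           (on_hom F Z (ShO T X) w)) \<in> Tri T'" if t: "(X, Y, Z, u, v, w) \<in> Tri T" for X Y Z u v w
  proof -
    have ob: "X \<in> Ob T" "Z \<in> Ob T" "w \<in> Hom T Z (ShO T X)" using T.tri[OF t] by auto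
    then have "on_hom F Z (ShO T X) w \<in> Hom T' (on_ob F Z) (on_ob F (ShO T X))" by (auto intro: fn)
    then show ?thesis using tri[OF t] ob fn(1) sh(1) by simp
  qed
  moreover have "on_hom F (ShO T X) (ShO T Y) (ShM T X Y f) \<in> Hom T' (ShO T' (on_ob F X)) (ShO T' (on_ob F Y))"
    if "X \<in> Ob T" "Y \<in> Ob T" "f \<in> Hom T X Y" for X Y f
    using that fn by (simp add: sh)
  ultimately show ?thesis unfolding triangle_functor_def natural_isomorphism_def natural_transformation_def
    using shift_commutingD(1)[OF F'] fn(1,2)
    by (auto simp: comp_functor_def shift_functor_def sh T'.is_iso_idm)
qed

section \<open>The triangulated data of the homotopy category\<close>

definition cone_triangles :: "('o, 'm) preadditive \<Rightarrow> (('o, 'm) cochain, (int \<Rightarrow> 'm) set) triangle set" where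
  "cone_triangles A = {(X, Y, C, homotopy_class A X Y f, homotopy_class A Y C i,
      homotopy_class A C (shift_complex A X) p) | X Y C f i p. is_mapping_cone A X Y f C i p}"

text \<open>The stage before triangles are closed under isomorphism: here every triangle comes from
  an actual mapping cone, on which functors can be computed.\<close>

definition pre_homotopy_category ::
  "('o, 'm) preadditive \<Rightarrow> (('o, 'm) cochain, (int \<Rightarrow> 'm) set) tricategory" where
  "pre_homotopy_category A =
        \<lparr>Ob = complexes A,
         Hom = (\<lambda>X Y. chain_maps A X Y // homotopy_rel A X Y),
         Idm = (\<lambda>X. homotopy_class A X X (chain_id A X)),
         Cmp = (\<lambda>X Y Z G F. \<Union>g \<in> G. \<Union>f \<in> F. homotopy_class A X Z (chain_comp A X Y Z g f)),
         ShO = shift_complex A,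
         ShM = (\<lambda>X Y F. \<Union>f \<in> F. homotopy_class A (shift_complex A X) (shift_complex A Y) (\<lambda>n. f (n + 1))),
         Tri = cone_triangles A\<rparr>"

lemma homotopy_category_eq: "homotopy_category A = close_triangles (pre_homotopy_category A)"
  unfolding homotopy_category_def pre_homotopy_category_def Let_def homotopy_class_def
    cone_triangles_def chain_id_def chain_comp_def ..

lemma homotopy_category_simps [simp]:
  "Ob (homotopy_category A) = complexes A"
  "ShO (homotopy_category A) = shift_complex A"
  "Idm (homotopy_category A) X = homotopy_class A X X (chain_id A X)"
  unfolding homotopy_category_eq close_triangles_def pre_homotopy_category_def by simp_all

lemma Hom_homotopy_category:
  "Hom (homotopy_category A) X Y = chain_maps A X Y // homotopy_rel A X Y"
  unfolding homotopy_category_eq close_triangles_def pre_homotopy_category_def by simp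

lemma Tri_homotopy_category:
  "Tri (homotopy_category A) =
     {t. \<exists>s \<in> cone_triangles A. isomorphic_triangles (homotopy_category A) s t}"
  unfolding homotopy_category_eq Tri_close_triangles by (simp add: pre_homotopy_category_def)

lemma homotopy_class_closed [simp]:
  "f \<in> chain_maps A X Y \<Longrightarrow> homotopy_class A X Y f \<in> Hom (homotopy_category A) X Y"
  unfolding Hom_homotopy_category homotopy_class_def by (rule quotientI)

lemma homotopy_class_cases:
  assumes "F \<in> Hom (homotopy_category A) X Y"
  obtains f where "f \<in> chain_maps A X Y" "F = homotopy_class A X Y f"
  using assms unfolding Hom_homotopy_category homotopy_class_def by (auto elim: quotientE)

lemma cobj_shift_complex [simp]: "cobj (shift_complex A X) n = cobj X (n + 1)"
  by (simp add: shift_complex_def)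

lemma cdiff_shift_complex:
  "cdiff (shift_complex A X) n = Neg A (cobj X (n + 1)) (cobj X (n + 2)) (cdiff X (n + 1))"
  "cdiff (shift_complex A X) (n - 1) = Neg A (cobj X n) (cobj X (n + 1)) (cdiff X n)"
  by (simp_all add: shift_complex_def add.commute)

section \<open>Operations on homotopy classes computed on representatives\<close>

context preadditive_laws
begin

lemma homotopy_class_eq:
  assumes "X \<in> complexes A" "Y \<in> complexes A" "(f, g) \<in> homotopy_rel A X Y"
  shows "homotopy_class A X Y f = homotopy_class A X Y g"
  unfolding homotopy_class_def using assms homotopy_rel_equiv by (metis equiv_class_eq)

text \<open>Composition and shift of classes are defined as unions over all representatives. The
  union collapses to a single member as soon as its body respects homotopy.\<close>

lemma UN_homotopy_class:
  assumes "X \<in> complexes A" "Y \<in> complexes A" "f \<in> chain_maps A X Y"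
    and "\<And>g h. (g, h) \<in> homotopy_rel A X Y \<Longrightarrow> \<phi> g = \<phi> h"
  shows "(\<Union>g \<in> homotopy_class A X Y f. \<phi> g) = \<phi> f"
  unfolding homotopy_class_def
  by (rule UN_equiv_class[OF homotopy_rel_equiv]) (use assms in \<open>auto simp: congruent_def\<close>)

lemma Cmp_homotopy_class [simp]:
  assumes "X \<in> complexes A" "Y \<in> complexes A" "Z \<in> complexes A"
    and "f \<in> chain_maps A X Y" "g \<in> chain_maps A Y Z"
  shows "Cmp (homotopy_category A) X Y Z (homotopy_class A Y Z g) (homotopy_class A X Y f) =
    homotopy_class A X Z (chain_comp A X Y Z g f)"
proof -
  have "Cmp (homotopy_category A) X Y Z (homotopy_class A Y Z g) (homotopy_class A X Y f) =
    (\<Union>g \<in> homotopy_class A Y Z g. \<Union>f \<in> homotopy_class A X Y f. homotopy_class A X Z (chain_comp A X Y Z g f))"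
    unfolding homotopy_category_eq close_triangles_def pre_homotopy_category_def by simp
  also have "\<dots> = (\<Union>f \<in> homotopy_class A X Y f. homotopy_class A X Z (chain_comp A X Y Z g f))"
  proof (intro UN_homotopy_class[where \<phi> = "\<lambda>g. \<Union>f \<in> homotopy_class A X Y f. homotopy_class A X Z (chain_comp A X Y Z g f)"] assms)
    fix g h assume "(g, h) \<in> homotopy_rel A Y Z"
    then show "(\<Union>f \<in> homotopy_class A X Y f. homotopy_class A X Z (chain_comp A X Y Z g f)) =
        (\<Union>f \<in> homotopy_class A X Y f. homotopy_class A X Z (chain_comp A X Y Z h f))"
      by (intro SUP_cong refl homotopy_class_eq chain_comp_cong_left assms)
        (auto simp: homotopy_class_def homotopy_rel_iff)
  qed
  also have "\<dots> = homotopy_class A X Z (chain_comp A X Y Z g f)"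
    by (intro UN_homotopy_class[where \<phi> = "\<lambda>f. homotopy_class A X Z (chain_comp A X Y Z g f)"]
        assms homotopy_class_eq chain_comp_cong_right)
  finally show ?thesis .
qed

lemma chain_comp_idm:
  assumes "X \<in> complexes A" "Y \<in> complexes A" "f \<in> chain_maps A X Y"
  shows "chain_comp A X Y Y (chain_id A Y) f = f" "chain_comp A X X Y f (chain_id A X) = f"
  using assms unfolding chain_comp_def chain_id_def by auto

lemma homotopy_category_laws: "category_laws (homotopy_category A)"
proof
  fix W X Y Z f g h
  assume ob: "W \<in> Ob (homotopy_category A)" "X \<in> Ob (homotopy_category A)" "Y \<in> Ob (homotopy_category A)"
      "Z \<in> Ob (homotopy_category A)"
    and hom: "f \<in> Hom (homotopy_category A) W X" "g \<in> Hom (homotopy_category A) X Y" "h \<in> Hom (homotopy_category A) Y Z"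
  show "Cmp (homotopy_category A) W X Z (Cmp (homotopy_category A) X Y Z h g) f =
    Cmp (homotopy_category A) W Y Z h (Cmp (homotopy_category A) W X Y g f)"
    using ob hom
    by (elim homotopy_class_cases) (simp, simp add: chain_comp_def cmp_assoc)
qed (auto elim!: homotopy_class_cases simp: chain_comp_idm)

subsection \<open>The shift\<close>

lemma shift_complex_closed [simp]:
  assumes "X \<in> complexes A" shows "shift_complex A X \<in> complexes A"
proof -
  have "cdiff X (n + 2) \<in> Hom A (cobj X (n + 2)) (cobj X (n + 3))" for n
    using cdiff_closed(1)[OF assms, of "n + 2"] by (simp add: add.assoc)
  moreover have "Cmp A (cobj X (n + 1)) (cobj X (n + 2)) (cobj X (n + 3)) (cdiff X (n + 2)) (cdiff X (n + 1)) =
      Zero A (cobj X (n + 1)) (cobj X (n + 3))" for n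
    using cdiff_cdiff(1)[OF assms, of "n + 1"] by (simp add: add.assoc)
  ultimately show ?thesis
    by (subst complexes_def) (use assms in \<open>simp add: cdiff_shift_complex add.assoc\<close>)
qed

lemma shift_chain_map [simp]:
  assumes "X \<in> complexes A" "Y \<in> complexes A" and f: "f \<in> chain_maps A X Y"
  shows "(\<lambda>n. f (n + 1)) \<in> chain_maps A (shift_complex A X) (shift_complex A Y)"
proof -
  have "f (n + 2) \<in> Hom A (cobj X (n + 2)) (cobj Y (n + 2))" for n using f by simp
  then show ?thesis using assms chain_map_comm(3)[OF f]
    unfolding chain_maps_def[of A "shift_complex A X"]
    by (simp add: cdiff_shift_complex add.assoc)
qed

lemma shift_homotopy:
  assumes X: "X \<in> complexes A" "Y \<in> complexes A" and fg: "(f, g) \<in> homotopy_rel A X Y"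
  shows "(\<lambda>n. f (n + 1), \<lambda>n. g (n + 1)) \<in> homotopy_rel A (shift_complex A X) (shift_complex A Y)"
proof -
  obtain s where fg: "f \<in> chain_maps A X Y" "g \<in> chain_maps A X Y"
      and s: "\<And>n. s n \<in> Hom A (cobj X n) (cobj Y (n - 1))"
      and eq: "\<And>n. f n = Plus A (cobj X n) (cobj Y n) (g n) (homotopy_boundary A X Y s n)"
      using fg unfolding homotopy_rel_iff by blast
  have s1: "s (n + 1) \<in> Hom A (cobj X (n + 1)) (cobj Y n)"
    and s2: "s (n + 2) \<in> Hom A (cobj X (n + 2)) (cobj Y (n + 1))" for n
    using s[of "n + 1"] s[of "n + 2"] by (simp_all add: add.commute)
  \<comment> \<open>The shift negates the differentials, so the homotopy is negated too and the
    signs cancel in both summands.\<close>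
  have "homotopy_boundary A (shift_complex A X) (shift_complex A Y)
      (\<lambda>n. Neg A (cobj X (n + 1)) (cobj Y n) (s (n + 1))) n = homotopy_boundary A X Y s (n + 1)" for n
    using X s1[of n] s2[of n] unfolding homotopy_boundary_def
    by (simp add: cdiff_shift_complex(1)[of _ _ n] cdiff_shift_complex(2) add.assoc)
  then show ?thesis unfolding homotopy_rel_iff using fg X s1
    by (intro conjI exI[of _ "\<lambda>n. Neg A (cobj X (n + 1)) (cobj Y n) (s (n + 1))"]) (auto, rule eq)
qed

lemma ShM_homotopy_class [simp]:
  assumes X: "X \<in> complexes A" "Y \<in> complexes A" and "f \<in> chain_maps A X Y"
  shows "ShM (homotopy_category A) X Y (homotopy_class A X Y f) =
    homotopy_class A (shift_complex A X) (shift_complex A Y) (\<lambda>n. f (n + 1))"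
proof -
  have "ShM (homotopy_category A) X Y (homotopy_class A X Y f) = (\<Union>f \<in> homotopy_class A X Y f.
    homotopy_class A (shift_complex A X) (shift_complex A Y) (\<lambda>n. f (n + 1)))"
    unfolding homotopy_category_eq close_triangles_def pre_homotopy_category_def by simp
  also have "\<dots> = homotopy_class A (shift_complex A X) (shift_complex A Y) (\<lambda>n. f (n + 1))"
    by (intro UN_homotopy_class[where \<phi> = "\<lambda>f. homotopy_class A (shift_complex A X) (shift_complex A Y) (\<lambda>n. f (n + 1))"]
      assms homotopy_class_eq shift_homotopy shift_complex_closed)
  finally show ?thesis .
qed

lemma homotopy_shift_functor:
  "is_functor (homotopy_category A) (homotopy_category A) (shift_functor (homotopy_category A))"
  unfolding is_functor_def shift_functor_def
  by (auto elim!: homotopy_class_cases) (simp_all add: chain_id_def chain_comp_def)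

lemma cone_triangles_triangle: "t \<in> cone_triangles A \<Longrightarrow> is_triangle (homotopy_category A) t"
  unfolding cone_triangles_def is_mapping_cone_def by auto

lemma homotopy_shift_category: "shift_category (homotopy_category A)"
proof -
  interpret category_laws "homotopy_category A" by (rule homotopy_category_laws)
  have "is_triangle T t" if "isomorphic_triangles T s t" for T s and t :: "('c,'d) triangle"
    using that by (cases s; cases t) auto
  then show ?thesis
    by unfold_locales (auto simp: homotopy_shift_functor Tri_homotopy_category)
qed

end

section \<open>Additive functors on homotopy categories\<close>

definition complex_image ::
  "('o, 'm, 'p, 'n) cfunctor \<Rightarrow> ('o, 'm) cochain \<Rightarrow> ('p, 'n) cochain" where
  "complex_image \<Phi> X = \<lparr>cobj = (\<lambda>n. on_ob \<Phi> (cobj X n)),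
     cdiff = (\<lambda>n. on_hom \<Phi> (cobj X n) (cobj X (n + 1)) (cdiff X n))\<rparr>"

definition chain_image ::
  "('o, 'm, 'p, 'n) cfunctor \<Rightarrow> ('o, 'm) cochain \<Rightarrow> ('o, 'm) cochain \<Rightarrow> (int \<Rightarrow> 'm) \<Rightarrow> int \<Rightarrow> 'n" where
  "chain_image \<Phi> X Y f = (\<lambda>n. on_hom \<Phi> (cobj X n) (cobj Y n) (f n))"

definition homotopy_functor ::
  "('p, 'n) preadditive \<Rightarrow> ('o, 'm, 'p, 'n) cfunctor \<Rightarrow>
   (('o, 'm) cochain, (int \<Rightarrow> 'm) set, ('p, 'n) cochain, (int \<Rightarrow> 'n) set) cfunctor" where
  "homotopy_functor B \<Phi> = \<lparr>on_ob = complex_image \<Phi>,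
     on_hom = (\<lambda>X Y F. \<Union>f \<in> F. homotopy_class B (complex_image \<Phi> X) (complex_image \<Phi> Y) (chain_image \<Phi> X Y f))\<rparr>"

lemma complex_image_simps [simp]:
  "cobj (complex_image \<Phi> X) n = on_ob \<Phi> (cobj X n)"
  "cdiff (complex_image \<Phi> X) n = on_hom \<Phi> (cobj X n) (cobj X (n + 1)) (cdiff X n)"
  by (simp_all add: complex_image_def)

lemma on_ob_homotopy_functor [simp]: "on_ob (homotopy_functor B \<Phi>) X = complex_image \<Phi> X"
  by (simp add: homotopy_functor_def)

locale additive_functor_laws = A: preadditive_laws A + B: preadditive_laws B
  for A :: "('o, 'm) preadditive" and B :: "('p, 'n) preadditive" +
  fixes \<Phi> :: "('o, 'm, 'p, 'n) cfunctor"
  assumes additive: "additive_functor A B \<Phi>"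
begin

lemma functor_laws: "is_functor A B \<Phi>"
  using additive unfolding additive_functor_def by blast

lemmas fun_ob [simp] = is_functorD(1)[OF functor_laws]
  and fun_hom [simp] = is_functorD(2)[OF functor_laws]
  and fun_idm [simp] = is_functorD(3)[OF functor_laws]
  and fun_cmp = is_functorD(4)[OF functor_laws]

lemma fun_plus:
  "\<lbrakk>X \<in> Ob A; Y \<in> Ob A; f \<in> Hom A X Y; g \<in> Hom A X Y\<rbrakk> \<Longrightarrow> on_hom \<Phi> X Y (Plus A X Y f g) =
     Plus B (on_ob \<Phi> X) (on_ob \<Phi> Y) (on_hom \<Phi> X Y f) (on_hom \<Phi> X Y g)"
  using additive unfolding additive_functor_def by blast

lemma fun_zero [simp]:
  assumes "X \<in> Ob A" "Y \<in> Ob A"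
  shows "on_hom \<Phi> X Y (Zero A X Y) = Zero B (on_ob \<Phi> X) (on_ob \<Phi> Y)"
  by (rule B.plus_idem_zero) (use assms in \<open>simp_all flip: fun_plus\<close>)

lemma fun_neg:
  assumes "X \<in> Ob A" "Y \<in> Ob A" "f \<in> Hom A X Y"
  shows "on_hom \<Phi> X Y (Neg A X Y f) = Neg B (on_ob \<Phi> X) (on_ob \<Phi> Y) (on_hom \<Phi> X Y f)"
  by (rule B.neg_unique) (use assms in \<open>simp_all flip: fun_plus\<close>)

lemma complex_image_closed [simp]: "X \<in> complexes A \<Longrightarrow> complex_image \<Phi> X \<in> complexes B"
  by (subst complexes_def) (simp add: add.assoc flip: fun_cmp)

lemma chain_image_closed [simp]:
  assumes "X \<in> complexes A" "Y \<in> complexes A" and f: "f \<in> chain_maps A X Y"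
  shows "chain_image \<Phi> X Y f \<in> chain_maps B (complex_image \<Phi> X) (complex_image \<Phi> Y)"
  by (subst chain_maps_def)
     (use assms in \<open>simp add: chain_image_def chain_map_comm(1)[OF f] flip: fun_cmp\<close>)

text \<open>Preserving sums and composites, an additive functor sends the boundary of
  \<open>s\<close> to the boundary of the image of \<open>s\<close>.\<close>

lemma chain_image_homotopy:
  assumes X: "X \<in> complexes A" "Y \<in> complexes A" and fg: "(f, g) \<in> homotopy_rel A X Y"
  shows "(chain_image \<Phi> X Y f, chain_image \<Phi> X Y g) \<in> homotopy_rel B (complex_image \<Phi> X) (complex_image \<Phi> Y)"
proof -
  obtain s where fg: "f \<in> chain_maps A X Y" "g \<in> chain_maps A X Y"
      and s: "\<And>n. s n \<in> Hom A (cobj X n) (cobj Y (n - 1))"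
      and eq: "\<And>n. f n = Plus A (cobj X n) (cobj Y n) (g n) (homotopy_boundary A X Y s n)"
      using fg unfolding homotopy_rel_iff by blast
  have s1: "s (n + 1) \<in> Hom A (cobj X (n + 1)) (cobj Y n)" for n using s[of "n + 1"] by simp
  have "homotopy_boundary B (complex_image \<Phi> X) (complex_image \<Phi> Y)
      (\<lambda>n. on_hom \<Phi> (cobj X n) (cobj Y (n - 1)) (s n)) n =
    on_hom \<Phi> (cobj X n) (cobj Y n) (homotopy_boundary A X Y s n)" for n
    using X s[of n] s1[of n] unfolding homotopy_boundary_def by (simp add: fun_plus fun_cmp)
  then show ?thesis unfolding homotopy_rel_iff using fg X s
    by (intro conjI exI[of _ "\<lambda>n. on_hom \<Phi> (cobj X n) (cobj Y (n - 1)) (s n)"])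
       (simp_all, simp add: chain_image_def eq fun_plus)
qed

lemma on_hom_homotopy_functor [simp]:
  assumes X: "X \<in> complexes A" "Y \<in> complexes A" and "f \<in> chain_maps A X Y"
  shows "on_hom (homotopy_functor B \<Phi>) X Y (homotopy_class A X Y f) =
    homotopy_class B (complex_image \<Phi> X) (complex_image \<Phi> Y) (chain_image \<Phi> X Y f)"
  unfolding homotopy_functor_def cfunctor.simps
  by (intro A.UN_homotopy_class[where \<phi> = "\<lambda>f. homotopy_class B (complex_image \<Phi> X) (complex_image \<Phi> Y) (chain_image \<Phi> X Y f)"]
      B.homotopy_class_eq chain_image_homotopy assms complex_image_closed)

text \<open>The shift reindexes and negates differentials, and additive functors preserve negatives.
  This equality of complexes, not a mere isomorphism, is the source of all strict commutation with
  shifts.\<close>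

lemma complex_image_shift:
  "X \<in> complexes A \<Longrightarrow> complex_image \<Phi> (shift_complex A X) = shift_complex B (complex_image \<Phi> X)"
  unfolding complex_image_def shift_complex_def by (simp add: fun_neg add.assoc)

lemma homotopy_functor_shift_commuting:
  "shift_commuting (homotopy_category A) (homotopy_category B) (homotopy_functor B \<Phi>)"
  unfolding shift_commuting_def is_functor_def
proof (intro conjI ballI, goal_cases)
  case (3 X)
  then have "chain_image \<Phi> X X (chain_id A X) = chain_id B (complex_image \<Phi> X)"
    by (simp add: chain_image_def chain_id_def)
  then show ?case using 3 by simp
next
  case (4 X Y Z f g)
  from 4(4,5) show ?case
  proof (elim homotopy_class_cases)
    fix f' g' assume f': "f' \<in> chain_maps A X Y" "f = homotopy_class A X Y f'"
      and g': "g' \<in> chain_maps A Y Z" "g = homotopy_class A Y Z g'"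
    then have "chain_image \<Phi> X Z (chain_comp A X Y Z g' f') = chain_comp B (complex_image \<Phi> X)
        (complex_image \<Phi> Y) (complex_image \<Phi> Z) (chain_image \<Phi> Y Z g') (chain_image \<Phi> X Y f')"
      using 4 by (simp add: chain_comp_def chain_image_def fun_cmp)
    then show ?case using 4 f' g' by simp
  qed
next
  case (6 X Y f)
  then obtain f' where f: "f' \<in> chain_maps A X Y" "f = homotopy_class A X Y f'"
    by (elim homotopy_class_cases)
  have "chain_image \<Phi> (shift_complex A X) (shift_complex A Y) (\<lambda>n. f' (n + 1)) =
    (\<lambda>n. chain_image \<Phi> X Y f' (n + 1))"
    by (simp add: chain_image_def)
  then show ?case using 6 f by (simp add: complex_image_shift)
qed (auto elim!: homotopy_class_cases simp: complex_image_shift)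

end

section \<open>Mapping cones\<close>

text \<open>The matrix of the cone differential with the degreewise biproducts \<open>W\<close> as
  free data: the formula has to be available before the cone exists as a complex.\<close>

definition cone_diff :: "('o, 'm) preadditive \<Rightarrow> ('o, 'm) cochain \<Rightarrow> ('o, 'm) cochain \<Rightarrow> (int \<Rightarrow> 'm) \<Rightarrow>
    (int \<Rightarrow> 'o) \<Rightarrow> (int \<Rightarrow> 'm) \<Rightarrow> (int \<Rightarrow> 'm) \<Rightarrow> (int \<Rightarrow> 'm) \<Rightarrow> (int \<Rightarrow> 'm) \<Rightarrow> int \<Rightarrow> 'm" where
  "cone_diff A X Y f W i p j q n =
     Plus A (W n) (W (n + 1))
       (Cmp A (W n) (cobj Y (n + 1)) (W (n + 1)) (i (n + 1))
         (Cmp A (W n) (cobj Y n) (cobj Y (n + 1)) (cdiff Y n) (q n)))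
       (Plus A (W n) (W (n + 1))
         (Cmp A (W n) (cobj Y (n + 1)) (W (n + 1)) (i (n + 1))
           (Cmp A (W n) (cobj X (n + 1)) (cobj Y (n + 1)) (f (n + 1)) (p n)))
         (Cmp A (W n) (cobj X (n + 2)) (W (n + 1)) (j (n + 1))
           (Cmp A (W n) (cobj X (n + 1)) (cobj X (n + 2))
             (Neg A (cobj X (n + 1)) (cobj X (n + 2)) (cdiff X (n + 1))) (p n))))"

text \<open>Fixes the splitting maps \<open>j\<close> and \<open>q\<close> that
  \<open>is_mapping_cone\<close> hides behind an existential quantifier.\<close>

locale mapping_cone = preadditive_laws A for A :: "('o, 'm) preadditive" +
  fixes X Y f C i p j q
  assumes cone_complexes [simp]: "X \<in> complexes A" "Y \<in> complexes A" "C \<in> complexes A"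
    and cone_maps [simp]: "f \<in> chain_maps A X Y" "i \<in> chain_maps A Y C" "p \<in> chain_maps A C (shift_complex A X)"
    and cone_biproduct: "is_biproduct A (cobj X (n + 1)) (cobj Y n) (cobj C n) (j n) (i n) (p n) (q n)"
    and cone_cdiff: "cdiff C n = cone_diff A X Y f (cobj C) i p j q n"
begin

lemma cone_homs [simp]:
  "j n \<in> Hom A (cobj X (n + 1)) (cobj C n)" "p n \<in> Hom A (cobj C n) (cobj X (n + 1))" "q n \<in> Hom A (cobj C n) (cobj Y n)"
  using cone_biproduct[of n] unfolding is_biproduct_def by auto

lemma cone_homs_shift [simp]:
  "j (n - 1) \<in> Hom A (cobj X n) (cobj C (n - 1))" "p (n - 1) \<in> Hom A (cobj C (n - 1)) (cobj X n)"
  "j (n + 1) \<in> Hom A (cobj X (n + 2)) (cobj C (n + 1))" "p (n + 1) \<in> Hom A (cobj C (n + 1)) (cobj X (n + 2))"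
  using cone_homs(1,2)[of "n - 1"] cone_homs(1,2)[of "n + 1"] by (simp_all add: add.assoc)

end

lemma (in preadditive_laws) is_mapping_cone_iff:
  "is_mapping_cone A X Y f C i p \<longleftrightarrow> (\<exists>j q. mapping_cone A X Y f C i p j q)"
  unfolding is_mapping_cone_def mapping_cone_def mapping_cone_axioms_def cone_diff_def cdiff_shift_complex(1)
  using preadditive_laws_axioms by auto

context additive_functor_laws
begin

text \<open>Biproducts are described by equations between sums and composites, which every additive
  functor preserves. Since cones are described in the same way, their images are again cones,
  whatever direct sums were chosen.\<close>

lemma is_biproduct_image:
  assumes "is_biproduct A U V W iU iV pU pV" "U \<in> Ob A" "V \<in> Ob A" "W \<in> Ob A"
  shows "is_biproduct B (on_ob \<Phi> U) (on_ob \<Phi> V) (on_ob \<Phi> W)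
    (on_hom \<Phi> U W iU) (on_hom \<Phi> V W iV) (on_hom \<Phi> W U pU) (on_hom \<Phi> W V pV)"
  using assms unfolding is_biproduct_def by (simp flip: fun_cmp fun_plus)

lemma is_mapping_cone_image:
  assumes "is_mapping_cone A X Y f C i p"
  shows "is_mapping_cone B (complex_image \<Phi> X) (complex_image \<Phi> Y) (chain_image \<Phi> X Y f)
    (complex_image \<Phi> C) (chain_image \<Phi> Y C i) (chain_image \<Phi> C (shift_complex A X) p)"
proof -
  obtain j q where "mapping_cone A X Y f C i p j q" using assms unfolding A.is_mapping_cone_iff by blast
  then interpret mapping_cone A X Y f C i p j q .
  have "mapping_cone B (complex_image \<Phi> X) (complex_image \<Phi> Y) (chain_image \<Phi> X Y f) (complex_image \<Phi> C)
    (chain_image \<Phi> Y C i) (chain_image \<Phi> C (shift_complex A X) p)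
    (\<lambda>n. on_hom \<Phi> (cobj X (n + 1)) (cobj C n) (j n)) (\<lambda>n. on_hom \<Phi> (cobj C n) (cobj Y n) (q n))"
  proof
    show "chain_image \<Phi> C (shift_complex A X) p \<in>
        chain_maps B (complex_image \<Phi> C) (shift_complex B (complex_image \<Phi> X))"
      using chain_image_closed[of C "shift_complex A X" p] by (simp add: complex_image_shift)
    fix n
    show "is_biproduct B (cobj (complex_image \<Phi> X) (n + 1)) (cobj (complex_image \<Phi> Y) n) (cobj (complex_image \<Phi> C) n)
      (on_hom \<Phi> (cobj X (n + 1)) (cobj C n) (j n)) (chain_image \<Phi> Y C i n)
      (chain_image \<Phi> C (shift_complex A X) p n) (on_hom \<Phi> (cobj C n) (cobj Y n) (q n))"
      using is_biproduct_image[OF cone_biproduct[of n]] by (simp add: chain_image_def)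
    show "cdiff (complex_image \<Phi> C) n = cone_diff B (complex_image \<Phi> X) (complex_image \<Phi> Y)
      (chain_image \<Phi> X Y f) (cobj (complex_image \<Phi> C)) (chain_image \<Phi> Y C i)
      (chain_image \<Phi> C (shift_complex A X) p) (\<lambda>n. on_hom \<Phi> (cobj X (n + 1)) (cobj C n) (j n))
      (\<lambda>n. on_hom \<Phi> (cobj C n) (cobj Y n) (q n)) n"
      by (simp add: cone_cdiff cone_diff_def chain_image_def add.assoc fun_cmp fun_plus fun_neg)
  qed simp_all
  then show ?thesis unfolding B.is_mapping_cone_iff by blast
qed

end

section \<open>Contractibility, existence and shifts of mapping cones\<close>

context preadditive_laws
begin

lemma biproduct_cmp:
  assumes "is_biproduct A U V W iU iV pU pV" "U \<in> Ob A" "V \<in> Ob A" "W \<in> Ob A" "T \<in> Ob A"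
  shows "x \<in> Hom A T U \<Longrightarrow> Cmp A T W U pU (Cmp A T U W iU x) = x"
    and "y \<in> Hom A T V \<Longrightarrow> Cmp A T W V pV (Cmp A T V W iV y) = y"
    and "x \<in> Hom A T U \<Longrightarrow> Cmp A T W V pV (Cmp A T U W iU x) = Zero A T V"
    and "y \<in> Hom A T V \<Longrightarrow> Cmp A T W U pU (Cmp A T V W iV y) = Zero A T U"
  using assms unfolding is_biproduct_def by (simp_all flip: cmp_assoc)

lemma biproductD:
  assumes "is_biproduct A U V W iU iV pU pV"
  shows "iU \<in> Hom A U W" "iV \<in> Hom A V W" "pU \<in> Hom A W U" "pV \<in> Hom A W V"
    "Cmp A U W U pU iU = Idm A U" "Cmp A V W V pV iV = Idm A V"
    "Cmp A U W V pV iU = Zero A U V" "Cmp A V W U pU iV = Zero A V U"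
    "Plus A W W (Cmp A W U W iU pU) (Cmp A W V W iV pV) = Idm A W"
  using assms unfolding is_biproduct_def by auto

text \<open>Degreewise inverses commute with the differentials automatically: insert
  \<open>f g = id\<close> in front of the differential, move \<open>f\<close> across it, and cancel
  \<open>g f\<close>.\<close>

lemma chain_map_inverse:
  assumes X: "X \<in> complexes A" "Y \<in> complexes A" and f: "f \<in> chain_maps A X Y"
    and iso: "\<And>n. is_iso A (cobj X n) (cobj Y n) (f n)"
  obtains g where "g \<in> chain_maps A Y X"
    "\<And>n. Cmp A (cobj X n) (cobj Y n) (cobj X n) (g n) (f n) = Idm A (cobj X n)"
    "\<And>n. Cmp A (cobj Y n) (cobj X n) (cobj Y n) (f n) (g n) = Idm A (cobj Y n)"
proof -
  have "\<exists>g. \<forall>n. g n \<in> Hom A (cobj Y n) (cobj X n) \<and>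
    Cmp A (cobj X n) (cobj Y n) (cobj X n) (g n) (f n) = Idm A (cobj X n) \<and>
    Cmp A (cobj Y n) (cobj X n) (cobj Y n) (f n) (g n) = Idm A (cobj Y n)"
    using iso unfolding is_iso_def by metis
  then obtain g where g: "\<And>n. g n \<in> Hom A (cobj Y n) (cobj X n)"
    and gf: "\<And>n. Cmp A (cobj X n) (cobj Y n) (cobj X n) (g n) (f n) = Idm A (cobj X n)"
    and fg: "\<And>n. Cmp A (cobj Y n) (cobj X n) (cobj Y n) (f n) (g n) = Idm A (cobj Y n)" by blast
  have gd: "Cmp A (cobj Y n) (cobj Y (n + 1)) (cobj X (n + 1)) (g (n + 1)) (cdiff Y n) =
    Cmp A (cobj Y n) (cobj X n) (cobj X (n + 1)) (cdiff X n) (g n)" for n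
  proof -
    have "Cmp A (cobj Y n) (cobj Y (n + 1)) (cobj X (n + 1)) (g (n + 1)) (cdiff Y n) =
     Cmp A (cobj Y n) (cobj Y (n + 1)) (cobj X (n + 1)) (g (n + 1))
      (Cmp A (cobj Y n) (cobj Y n) (cobj Y (n + 1)) (cdiff Y n)
        (Cmp A (cobj Y n) (cobj X n) (cobj Y n) (f n) (g n)))" using X f g by (simp add: fg)
    also have "\<dots> = Cmp A (cobj Y n) (cobj X (n + 1)) (cobj X (n + 1))
      (Cmp A (cobj X (n + 1)) (cobj Y (n + 1)) (cobj X (n + 1)) (g (n + 1)) (f (n + 1)))
      (Cmp A (cobj Y n) (cobj X n) (cobj X (n + 1)) (cdiff X n) (g n))"
      using X f g by (simp add: cmp_assoc cmp_eq_left[OF _ _ _ _ _ _ _ chain_map_comm(1)[OF f]])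
    finally show ?thesis using X f g by (simp add: gf)
  qed
  have "g \<in> chain_maps A Y X" unfolding chain_maps_def using g gd by simp
  then show thesis using that gf fg by blast
qed

text \<open>With \<open>g\<close> inverse to \<open>f\<close>, the contraction is
  \<open>(x, y) \<mapsto> (g y, 0)\<close>. Its boundary is the sum of
  \<open>d s (x, y) = (- d g y, y)\<close> and \<open>s d (x, y) = (x + d g y, 0)\<close>.\<close>

lemma cone_of_iso_contractible:
  assumes cone: "is_mapping_cone A X Y f C i p" and iso: "\<And>n. is_iso A (cobj X n) (cobj Y n) (f n)"
  obtains s where "\<And>n. s n \<in> Hom A (cobj C n) (cobj C (n - 1))"
    "\<And>n. homotopy_boundary A C C s n = Idm A (cobj C n)"
proof -
  obtain j q where "mapping_cone A X Y f C i p j q" using cone unfolding is_mapping_cone_iff by blast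
  then interpret mapping_cone A X Y f C i p j q .
  obtain g where g': "g \<in> chain_maps A Y X"
    and gf: "\<And>n. Cmp A (cobj X n) (cobj Y n) (cobj X n) (g n) (f n) = Idm A (cobj X n)"
    and fg: "\<And>n. Cmp A (cobj Y n) (cobj X n) (cobj Y n) (f n) (g n) = Idm A (cobj Y n)"
    using chain_map_inverse[OF cone_complexes(1,2) cone_maps(1) iso] by metis
  have g: "g n \<in> Hom A (cobj Y n) (cobj X n)" for n using g' by simp
  note gd = chain_map_comm(1)[OF g', symmetric]
  \<comment> \<open>Project to \<open>Y\<close> in degree \<open>n\<close>, apply the inverse of
    \<open>f\<close>, and include into the \<open>X\<close> summand of the cone, which sits one
    degree lower.\<close>
  define s where "s n = Cmp A (cobj C n) (cobj X n) (cobj C (n - 1)) (j (n - 1))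
    (Cmp A (cobj C n) (cobj Y n) (cobj X n) (g n) (q n))" for n
  have s: "s n \<in> Hom A (cobj C n) (cobj C (n - 1))" for n
    unfolding s_def using g by simp
  have bi': "is_biproduct A (cobj X n) (cobj Y (n - 1)) (cobj C (n - 1)) (j (n - 1)) (i (n - 1)) (p (n - 1)) (q (n - 1))"
    and bi1: "is_biproduct A (cobj X (n + 2)) (cobj Y (n + 1)) (cobj C (n + 1)) (j (n + 1)) (i (n + 1)) (p (n + 1)) (q (n + 1))" for n
    using cone_biproduct[of "n - 1"] cone_biproduct[of "n + 1"] by (simp_all add: add.assoc)
  have "homotopy_boundary A C C s n = Idm A (cobj C n)" for n
  proof -
    have n: "n - 1 + 1 = n" "n - 1 + 2 = n + 1" by simp_all
    note d = cone_cdiff[unfolded cone_diff_def] and d' = cone_cdiff[of "n - 1", unfolded cone_diff_def n]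
    have q: "q (n - 1) \<in> Hom A (cobj C (n - 1)) (cobj Y (n - 1))" by simp
    have 1: "Cmp A (cobj C n) (cobj C (n - 1)) (cobj C n) (cdiff C (n - 1)) (s n) =
      Plus A (cobj C n) (cobj C n) (Cmp A (cobj C n) (cobj Y n) (cobj C n) (i n) (q n))
       (Neg A (cobj C n) (cobj C n) (Cmp A (cobj C n) (cobj X (n + 1)) (cobj C n) (j n)
        (Cmp A (cobj C n) (cobj X n) (cobj X (n + 1)) (cdiff X n) (Cmp A (cobj C n) (cobj Y n) (cobj X n) (g n) (q n)))))"
      unfolding s_def d' using g q
      by (simp add: cmp_plus_left cmp_plus_right cmp_assoc biproduct_cmp[OF bi'] cmp_eq_left[OF _ _ _ _ _ _ _ fg])
    have 2: "Cmp A (cobj C n) (cobj C (n + 1)) (cobj C n) (s (n + 1)) (cdiff C n) =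
      Plus A (cobj C n) (cobj C n) (Cmp A (cobj C n) (cobj X (n + 1)) (cobj C n) (j n)
        (Cmp A (cobj C n) (cobj X n) (cobj X (n + 1)) (cdiff X n) (Cmp A (cobj C n) (cobj Y n) (cobj X n) (g n) (q n))))
        (Cmp A (cobj C n) (cobj X (n + 1)) (cobj C n) (j n) (p n))"
      unfolding s_def d using g
      by (simp add: cmp_plus_left cmp_plus_right cmp_assoc biproduct_cmp[OF bi1] cmp_eq_left[OF _ _ _ _ _ _ _ gf]
         cmp_eq_left[OF _ _ _ _ _ _ _ gd])
    have "Plus A (cobj C n) (cobj C n) (Cmp A (cobj C n) (cobj Y n) (cobj C n) (i n) (q n))
       (Cmp A (cobj C n) (cobj X (n + 1)) (cobj C n) (j n) (p n)) = Idm A (cobj C n)"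
      using biproductD(9)[OF cone_biproduct[of n]] by (simp add: plus_comm)
    \<comment> \<open>Here \<open>b\<close> stands for \<open>j d g q\<close>, which the two halves
      of the boundary contain with opposite signs.\<close>
    moreover have "Plus A U U (Plus A U U a (Neg A U U b)) (Plus A U U b c) = Plus A U U a c"
      if "U \<in> Ob A" "a \<in> Hom A U U" "b \<in> Hom A U U" "c \<in> Hom A U U" for U a b c
      using that plus_assoc[of U U "Neg A U U b" b c] by (simp add: plus_assoc)
    ultimately show ?thesis unfolding homotopy_boundary_def 1 2 using g by simp
  qed
  with s show thesis by (rule that)
qed

text \<open>Biproducts are chosen independently in each degree; the matrix formula for the
  differential links them into a complex.\<close>

lemma mapping_cone_exists:
  assumes X: "X \<in> complexes A" "Y \<in> complexes A" and f: "f \<in> chain_maps A X Y"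
    and bip: "\<And>U V. \<lbrakk>U \<in> Ob A; V \<in> Ob A\<rbrakk> \<Longrightarrow> \<exists>W iU iV pU pV. W \<in> Ob A \<and> is_biproduct A U V W iU iV pU pV"
  shows "\<exists>C i p. is_mapping_cone A X Y f C i p"
proof -
  have "\<forall>n. \<exists>W iU iV pU pV. W \<in> Ob A \<and> is_biproduct A (cobj X (n + 1)) (cobj Y n) W iU iV pU pV"
    using bip X by simp
  then obtain W j i p q where W: "\<And>n. W n \<in> Ob A"
    and bi: "\<And>n. is_biproduct A (cobj X (n + 1)) (cobj Y n) (W n) (j n) (i n) (p n) (q n)"
    by metis
  have jipq: "j n \<in> Hom A (cobj X (n + 1)) (W n)" "i n \<in> Hom A (cobj Y n) (W n)"
    "p n \<in> Hom A (W n) (cobj X (n + 1))" "q n \<in> Hom A (W n) (cobj Y n)" for n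
    using biproductD[OF bi[of n]] by auto
  have jp1: "j (n + 1) \<in> Hom A (cobj X (n + 2)) (W (n + 1))" "p (n + 1) \<in> Hom A (W (n + 1)) (cobj X (n + 2))"
    "j (n + 2) \<in> Hom A (cobj X (n + 3)) (W (n + 2))" "p (n + 2) \<in> Hom A (W (n + 2)) (cobj X (n + 3))" for n
    using jipq(1,3)[of "n + 1"] jipq(1,3)[of "n + 2"] by (simp_all add: add.assoc)
  have bi1: "is_biproduct A (cobj X (n + 2)) (cobj Y (n + 1)) (W (n + 1)) (j (n + 1)) (i (n + 1)) (p (n + 1)) (q (n + 1))" for n
    using bi[of "n + 1"] by (simp add: add.assoc)
  define C where "C = \<lparr>cobj = W, cdiff = cone_diff A X Y f W i p j q\<rparr>"
  have C: "cobj C = W" and cd: "cdiff C n = cone_diff A X Y f W i p j q n" for n by (simp_all add: C_def)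
  note d = cd[unfolded cone_diff_def]
  have X2: "cdiff X (n + 2) \<in> Hom A (cobj X (n + 2)) (cobj X (n + 3))"
    "cdiff Y (n + 1) \<in> Hom A (cobj Y (n + 1)) (cobj Y (n + 2))"
    "Cmp A (cobj X (n + 1)) (cobj X (n + 2)) (cobj X (n + 3)) (cdiff X (n + 2)) (cdiff X (n + 1)) =
      Zero A (cobj X (n + 1)) (cobj X (n + 3))" for n
    using cdiff_closed(1)[OF X(1), of "n + 2"] cdiff_closed(3)[OF X(2), of n]
      cdiff_cdiff(1)[OF X(1), of "n + 1"] by (simp_all add: add.assoc)
  have dC: "cdiff C n \<in> Hom A (W n) (W (n + 1))" for n
    unfolding d using X W f jipq jp1 by simp
  \<comment> \<open>The diagonal entries of the squared matrix vanish because the differentials of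
    \<open>X\<close> and \<open>Y\<close> square to zero; the remaining entry is
    \<open>d f - f d\<close>, zero because \<open>f\<close> is a chain map.\<close>
  have "Cmp A (W n) (W (n + 1)) (W (n + 2)) (cdiff C (n + 1)) (cdiff C n) = Zero A (W n) (W (n + 2))" for n
  proof -
    have n: "n + 1 + 1 = n + 2" "n + 1 + 2 = n + 3" by simp_all
    show ?thesis unfolding d n using X X2 W f jipq jp1 chain_map_closed[OF f, of "n + 2"]
      by (simp add: cmp_plus_left cmp_plus_right cmp_assoc biproduct_cmp[OF bi1]
        cmp_eq_left[OF _ _ _ _ _ _ _ cdiff_cdiff(1)] cmp_eq_left[OF _ _ _ _ _ _ _ X2(3)]
        cmp_eq_left[OF _ _ _ _ _ _ _ chain_map_comm(3)[OF f]])
  qed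
  then have CC: "C \<in> complexes A" using W dC unfolding complexes_def by (simp add: C)
  have iC: "i \<in> chain_maps A Y C" unfolding chain_maps_def C d using X W f jipq jp1
    by (simp add: cmp_plus_left cmp_plus_right cmp_assoc biproductD[OF bi])
  have pC: "p \<in> chain_maps A C (shift_complex A X)" unfolding chain_maps_def C d using X W f jipq jp1
    by (simp add: cdiff_shift_complex(1) cmp_plus_left cmp_plus_right cmp_assoc biproduct_cmp[OF bi1] add.assoc)
  have "mapping_cone A X Y f C i p j q" by unfold_locales (simp_all add: X f CC iC pC bi C cd)
  then show ?thesis unfolding is_mapping_cone_iff by blast
qed

text \<open>Both sign changes, of the differentials under the shift and of \<open>p\<close>, cancel in the formula for the
  differential of the cone.\<close>

lemma shift_mapping_cone:
  assumes cone: "is_mapping_cone A X Y f C i p"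
  shows "is_mapping_cone A (shift_complex A X) (shift_complex A Y) (\<lambda>n. f (n + 1)) (shift_complex A C)
    (\<lambda>n. i (n + 1)) (\<lambda>n. Neg A (cobj C (n + 1)) (cobj X (n + 2)) (p (n + 1)))"
proof -
  obtain j q where "mapping_cone A X Y f C i p j q" using cone unfolding is_mapping_cone_iff by blast
  then interpret mapping_cone A X Y f C i p j q .
  note X = cone_complexes and f = cone_maps(1) and i = cone_maps(2) and p = cone_maps(3)
  have X2: "cdiff X (n + 2) \<in> Hom A (cobj X (n + 2)) (cobj X (n + 3))" for n
    using cdiff_closed(1)[OF X(1), of "n + 2"] by (simp_all add: add.assoc)
  have jp2: "j (n + 2) \<in> Hom A (cobj X (n + 3)) (cobj C (n + 2))" "p (n + 2) \<in> Hom A (cobj C (n + 2)) (cobj X (n + 3))" for n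
    using cone_homs(1,2)[of "n + 2"] by (simp_all add: add.assoc)
  have pcomm: "Cmp A (cobj C (n + 1)) (cobj X (n + 2)) (cobj X (n + 3))
     (Neg A (cobj X (n + 2)) (cobj X (n + 3)) (cdiff X (n + 2))) (p (n + 1)) =
    Cmp A (cobj C (n + 1)) (cobj C (n + 2)) (cobj X (n + 3)) (p (n + 2)) (cdiff C (n + 1))" for n
    using chain_map_comm(1)[OF p, of "n + 1"] by (simp add: cdiff_shift_complex(1) add.assoc)
  have pC: "(\<lambda>n. Neg A (cobj C (n + 1)) (cobj X (n + 2)) (p (n + 1))) \<in>
     chain_maps A (shift_complex A C) (shift_complex A (shift_complex A X))"
    unfolding chain_maps_def using X2 jp2 pcomm by (simp add: cdiff_shift_complex(1) add.assoc)
  \<comment> \<open>The inclusion \<open>j\<close> changes sign along with \<open>p\<close>, so that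
    \<open>p j\<close> remains the identity.\<close>
  have "mapping_cone A (shift_complex A X) (shift_complex A Y) (\<lambda>n. f (n + 1)) (shift_complex A C) (\<lambda>n. i (n + 1))
    (\<lambda>n. Neg A (cobj C (n + 1)) (cobj X (n + 2)) (p (n + 1)))
    (\<lambda>n. Neg A (cobj X (n + 2)) (cobj C (n + 1)) (j (n + 1))) (\<lambda>n. q (n + 1))"
  proof
    fix n
    show "is_biproduct A (cobj (shift_complex A X) (n + 1)) (cobj (shift_complex A Y) n) (cobj (shift_complex A C) n)
       (Neg A (cobj X (n + 2)) (cobj C (n + 1)) (j (n + 1))) (i (n + 1))
       (Neg A (cobj C (n + 1)) (cobj X (n + 2)) (p (n + 1))) (q (n + 1))"
      using cone_biproduct[of "n + 1"] unfolding is_biproduct_def by (simp add: add.assoc)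
    have n: "n + 1 + 1 = n + 2" "n + 1 + 2 = n + 3" "n + 2 + 1 = n + 3" by simp_all
    have "q (n + 1) \<in> Hom A (cobj C (n + 1)) (cobj Y (n + 1))" "f (n + 2) \<in> Hom A (cobj X (n + 2)) (cobj Y (n + 2))"
      "i (n + 2) \<in> Hom A (cobj Y (n + 2)) (cobj C (n + 2))" by simp_all
    then show "cdiff (shift_complex A C) n = cone_diff A (shift_complex A X) (shift_complex A Y) (\<lambda>n. f (n + 1))
      (cobj (shift_complex A C)) (\<lambda>n. i (n + 1)) (\<lambda>n. Neg A (cobj C (n + 1)) (cobj X (n + 2)) (p (n + 1)))
      (\<lambda>n. Neg A (cobj X (n + 2)) (cobj C (n + 1)) (j (n + 1))) (\<lambda>n. q (n + 1)) n"
      using X2 jp2 unfolding cone_diff_def cdiff_shift_complex(1)[of _ C] cone_cdiff[of "n + 1"]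
      by (simp add: n cdiff_shift_complex(1) cmp_assoc)
  qed (simp_all add: pC)
  then show ?thesis unfolding is_mapping_cone_iff by blast
qed

end

text \<open>Transport of structure: when only the first square is prescribed, the other two
  morphisms are forced to be \<open>c v b'\<close> and \<open>ShM a w c'\<close>, with
  \<open>b'\<close> and \<open>c'\<close> inverse to \<open>b\<close> and \<open>c\<close>.\<close>

lemma (in shift_category) isomorphic_triangle_exists:
  assumes tri: "is_triangle T (X, Y, Z, u, v, w)" and ob: "X' \<in> Ob T" "Y' \<in> Ob T" "Z' \<in> Ob T"
    and u': "u' \<in> Hom T X' Y'"
    and a: "is_iso T X X' a" and b: "is_iso T Y Y' b" and c: "is_iso T Z Z' c"
    and sq: "Cmp T X Y Y' b u = Cmp T X X' Y' u' a"
  shows "\<exists>v' w'. isomorphic_triangles T (X, Y, Z, u, v, w) (X', Y', Z', u', v', w')"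
proof -
  obtain b' where b': "b' \<in> Hom T Y' Y" "Cmp T Y Y' Y b' b = Idm T Y" using b unfolding is_iso_def by blast
  obtain c' where c': "c' \<in> Hom T Z' Z" "Cmp T Z Z' Z c' c = Idm T Z" using c unfolding is_iso_def by blast
  have abc: "a \<in> Hom T X X'" "b \<in> Hom T Y Y'" "c \<in> Hom T Z Z'" using a b c unfolding is_iso_def by auto
  define v' where "v' = Cmp T Y' Z Z' c (Cmp T Y' Y Z v b')"
  define w' where "w' = Cmp T Z' (ShO T X) (ShO T X') (ShM T X X' a) (Cmp T Z' Z (ShO T X) w c')"
  have t: "is_triangle T (X', Y', Z', u', v', w')"
    unfolding v'_def w'_def using assms abc b' c' by simp
  have "Cmp T Y Z Z' c v = Cmp T Y Y' Z' v' b" unfolding v'_def using assms abc b'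
    by (simp add: cmp_assoc)
  moreover have "Cmp T Z (ShO T X) (ShO T X') (ShM T X X' a) w = Cmp T Z Z' (ShO T X') w' c"
    unfolding w'_def using assms abc c' by (simp add: cmp_assoc)
  ultimately show ?thesis using tri t a b c sq
    by (intro exI[of _ v', OF exI[of _ w']]) auto
qed

section \<open>Stability under the shift of the morphisms to be inverted\<close>

context preadditive_laws
begin

lemma chain_iso:
  assumes X: "X \<in> complexes A" "Y \<in> complexes A" and f: "f \<in> chain_maps A X Y"
    and iso: "\<And>n. is_iso A (cobj X n) (cobj Y n) (f n)"
  shows "is_iso (homotopy_category A) X Y (homotopy_class A X Y f)"
proof -
  obtain g where g': "g \<in> chain_maps A Y X"
    and gf: "\<And>n. Cmp A (cobj X n) (cobj Y n) (cobj X n) (g n) (f n) = Idm A (cobj X n)"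
    and fg: "\<And>n. Cmp A (cobj Y n) (cobj X n) (cobj Y n) (f n) (g n) = Idm A (cobj Y n)"
    using chain_map_inverse[OF X f iso] by metis
  have "chain_comp A X Y X g f = chain_id A X" "chain_comp A Y X Y f g = chain_id A Y"
    by (simp_all add: chain_comp_def chain_id_def gf fg)
  then show ?thesis unfolding is_iso_def using X f g'
    by (intro conjI bexI[of _ "homotopy_class A Y X g"]) simp_all
qed

lemma homotopy_category_triangle:
  "is_mapping_cone A X Y f C i p \<Longrightarrow> (X, Y, C, homotopy_class A X Y f, homotopy_class A Y C i,
      homotopy_class A C (shift_complex A X) p) \<in> Tri (homotopy_category A)"
  using shift_category.isomorphic_triangles_refl[OF homotopy_shift_category cone_triangles_triangle]
  unfolding Tri_homotopy_category cone_triangles_def by blast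

text \<open>The shift descends to the quotient only if it preserves the morphisms that become
  invertible. A shifted cone is a cone of the shifted map up to the sign of its last morphism, and
  \<open>cone_in\<close> leaves that morphism free.\<close>

lemma cone_in_shift:
  assumes N: "N \<subseteq> complexes A" "\<And>X. X \<in> N \<Longrightarrow> shift_complex A X \<in> N"
    and s: "(X, Y, s) \<in> cone_in (homotopy_category A) N"
  shows "(shift_complex A X, shift_complex A Y, ShM (homotopy_category A) X Y s) \<in> cone_in (homotopy_category A) N"
proof -
  let ?K = "homotopy_category A"
  interpret K: shift_category ?K by (rule homotopy_shift_category)
  obtain Z v w where Z: "Z \<in> N" and t: "(X, Y, Z, s, v, w) \<in> Tri ?K"
    using s unfolding cone_in_def by auto
  then obtain X0 Y0 C f i p where cone: "is_mapping_cone A X0 Y0 f C i p"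
    and iso: "isomorphic_triangles ?K (X0, Y0, C, homotopy_class A X0 Y0 f, homotopy_class A Y0 C i,
      homotopy_class A C (shift_complex A X0) p) (X, Y, Z, s, v, w)"
    unfolding Tri_homotopy_category cone_triangles_def by blast
  from iso obtain a b c where abc: "is_iso ?K X0 X a" "is_iso ?K Y0 Y b" "is_iso ?K C Z c"
    and sq: "Cmp ?K X0 Y0 Y b (homotopy_class A X0 Y0 f) = Cmp ?K X0 X Y s a"
    and ob: "X \<in> Ob ?K" "Y \<in> Ob ?K" "Z \<in> Ob ?K" "s \<in> Hom ?K X Y"
    by auto
  have ob0: "X0 \<in> Ob ?K" "Y0 \<in> Ob ?K" "C \<in> Ob ?K" "f \<in> chain_maps A X0 Y0" using cone unfolding is_mapping_cone_def by auto
  note sh = is_functorD[OF K.shift, unfolded shift_functor_def cfunctor.simps]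
  note shi = is_functor_iso[OF K.shift, unfolded shift_functor_def cfunctor.simps]
  note t = homotopy_category_triangle[OF shift_mapping_cone[OF cone]]
  have hom: "a \<in> Hom ?K X0 X" "b \<in> Hom ?K Y0 Y" using abc unfolding is_iso_def by auto
  have fc: "homotopy_class A X0 Y0 f \<in> Hom ?K X0 Y0" using ob0 by simp
  have "Cmp ?K (ShO ?K X0) (ShO ?K Y0) (ShO ?K Y) (ShM ?K Y0 Y b) (ShM ?K X0 Y0 (homotopy_class A X0 Y0 f)) =
    Cmp ?K (ShO ?K X0) (ShO ?K X) (ShO ?K Y) (ShM ?K X Y s) (ShM ?K X0 X a)"
    using sq ob ob0 hom fc by (metis sh(4))
  then have "Cmp ?K (ShO ?K X0) (ShO ?K Y0) (ShO ?K Y) (ShM ?K Y0 Y b) (homotopy_class A (ShO ?K X0) (ShO ?K Y0) (\<lambda>n. f (n + 1))) =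
    Cmp ?K (ShO ?K X0) (ShO ?K X) (ShO ?K Y) (ShM ?K X Y s) (ShM ?K X0 X a)"
    using ob0 by simp
  \<comment> \<open>The morphism \<open>s\<close> is only isomorphic to the base of a cone, so the
    shifted cone triangle is transported to one that begins with the shift of \<open>s\<close>
    itself.\<close>
  from K.isomorphic_triangle_exists[OF K.tri[OF t[folded homotopy_category_simps(2)]] _ _ _ _ _ _ _ this] obtain v' w' where
    "isomorphic_triangles ?K (ShO ?K X0, ShO ?K Y0, ShO ?K C, homotopy_class A (ShO ?K X0) (ShO ?K Y0) (\<lambda>n. f (n + 1)),
      homotopy_class A (ShO ?K Y0) (ShO ?K C) (\<lambda>n. i (n + 1)), homotopy_class A (ShO ?K C) (ShO ?K (ShO ?K X0))
       (\<lambda>n. Neg A (cobj C (n + 1)) (cobj X0 (n + 2)) (p (n + 1)))) (ShO ?K X, ShO ?K Y, ShO ?K Z, ShM ?K X Y s, v', w')"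
    using shi abc ob ob0 K.ShO_closed K.ShM_closed by meson
  moreover have "(ShO ?K X0, ShO ?K Y0, ShO ?K C, homotopy_class A (ShO ?K X0) (ShO ?K Y0) (\<lambda>n. f (n + 1)),
      homotopy_class A (ShO ?K Y0) (ShO ?K C) (\<lambda>n. i (n + 1)), homotopy_class A (ShO ?K C) (ShO ?K (ShO ?K X0))
       (\<lambda>n. Neg A (cobj C (n + 1)) (cobj X0 (n + 2)) (p (n + 1)))) \<in> cone_triangles A"
    using shift_mapping_cone[OF cone] unfolding cone_triangles_def homotopy_category_simps(2) by blast
  ultimately have "(ShO ?K X, ShO ?K Y, ShO ?K Z, ShM ?K X Y s, v', w') \<in> Tri ?K"
    unfolding Tri_homotopy_category by blast
  then show ?thesis using N(2)[OF Z] unfolding cone_in_def by auto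
qed

end

context additive_functor_laws
begin

lemma homotopy_functor_strict:
  "strict_triangle_functor (homotopy_category A) (homotopy_category B) (homotopy_functor B \<Phi>)"
  unfolding homotopy_category_eq
proof (rule strict_triangle_functor_close)
  fix t assume "t \<in> Tri (pre_homotopy_category A)"
  then obtain X Y C f i p where t: "t = (X, Y, C, homotopy_class A X Y f, homotopy_class A Y C i,
      homotopy_class A C (shift_complex A X) p)" and cone: "is_mapping_cone A X Y f C i p"
    unfolding pre_homotopy_category_def cone_triangles_def by auto
  then have X: "X \<in> complexes A" "Y \<in> complexes A" "C \<in> complexes A"
     "f \<in> chain_maps A X Y" "i \<in> chain_maps A Y C" "p \<in> chain_maps A C (shift_complex A X)"
    unfolding is_mapping_cone_def by auto
  have "map_triangle (pre_homotopy_category A) (homotopy_functor B \<Phi>) t =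
    (complex_image \<Phi> X, complex_image \<Phi> Y, complex_image \<Phi> C,
     homotopy_class B (complex_image \<Phi> X) (complex_image \<Phi> Y) (chain_image \<Phi> X Y f),
     homotopy_class B (complex_image \<Phi> Y) (complex_image \<Phi> C) (chain_image \<Phi> Y C i),
     homotopy_class B (complex_image \<Phi> C) (shift_complex B (complex_image \<Phi> X)) (chain_image \<Phi> C (shift_complex A X) p))"
    using X by (simp add: t pre_homotopy_category_def complex_image_shift)
  then show "map_triangle (pre_homotopy_category A) (homotopy_functor B \<Phi>) t \<in> Tri (pre_homotopy_category B)"
    using is_mapping_cone_image[OF cone] unfolding pre_homotopy_category_def cone_triangles_def by auto
qed (fold homotopy_category_eq, fact A.homotopy_shift_category, fact B.homotopy_shift_category,
      fact homotopy_functor_shift_commuting)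

end

text \<open>Naturality of \<open>\<eta>\<close> at the differentials makes the degreewise family a
  chain map; naturality at the components of a chain map gives the square on the nose, before
  passing to homotopy classes.\<close>

lemma (in preadditive_laws) homotopy_natural_transformation:
  assumes \<Phi>: "additive_functor_laws A B \<Phi>" and \<Psi>: "additive_functor_laws B A \<Psi>"
    and \<eta>: "natural_transformation A A id_functor (comp_functor \<Psi> \<Phi>) \<eta>"
  shows "natural_transformation (homotopy_category A) (homotopy_category A) id_functor
    (comp_functor (homotopy_functor A \<Psi>) (homotopy_functor B \<Phi>))
    (\<lambda>X. homotopy_class A X (complex_image \<Psi> (complex_image \<Phi> X)) (\<lambda>n. \<eta> (cobj X n)))"
    and "X \<in> complexes A \<Longrightarrow> (\<lambda>n. \<eta> (cobj X n)) \<in> chain_maps A X (complex_image \<Psi> (complex_image \<Phi> X))"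
proof -
  interpret \<Phi>: additive_functor_laws A B \<Phi> by (rule \<Phi>)
  interpret \<Psi>: additive_functor_laws B A \<Psi> by (rule \<Psi>)
  have \<eta>hom: "\<eta> X \<in> Hom A X (on_ob \<Psi> (on_ob \<Phi> X))" if "X \<in> Ob A" for X
    using \<eta> that unfolding natural_transformation_def by (simp add: id_functor_def comp_functor_def)
  have nat: "Cmp A X Y (on_ob \<Psi> (on_ob \<Phi> Y)) (\<eta> Y) f =
     Cmp A X (on_ob \<Psi> (on_ob \<Phi> X)) (on_ob \<Psi> (on_ob \<Phi> Y))
       (on_hom \<Psi> (on_ob \<Phi> X) (on_ob \<Phi> Y) (on_hom \<Phi> X Y f)) (\<eta> X)"
    if "X \<in> Ob A" "Y \<in> Ob A" "f \<in> Hom A X Y" for X Y f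
    using \<eta> that unfolding natural_transformation_def by (simp add: id_functor_def comp_functor_def)
  show cm: "(\<lambda>n. \<eta> (cobj X n)) \<in> chain_maps A X (complex_image \<Psi> (complex_image \<Phi> X))"
    if "X \<in> complexes A" for X
    unfolding chain_maps_def using that by (simp add: \<eta>hom nat)
  have "chain_comp A X Y (complex_image \<Psi> (complex_image \<Phi> Y)) (\<lambda>n. \<eta> (cobj Y n)) f =
    chain_comp A X (complex_image \<Psi> (complex_image \<Phi> X)) (complex_image \<Psi> (complex_image \<Phi> Y))
      (chain_image \<Psi> (complex_image \<Phi> X) (complex_image \<Phi> Y) (chain_image \<Phi> X Y f)) (\<lambda>n. \<eta> (cobj X n))"
    if "X \<in> complexes A" "Y \<in> complexes A" "f \<in> chain_maps A X Y" for X Y f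
    using that by (simp add: chain_comp_def chain_image_def nat)
  then show "natural_transformation (homotopy_category A) (homotopy_category A) id_functor
    (comp_functor (homotopy_functor A \<Psi>) (homotopy_functor B \<Phi>))
    (\<lambda>X. homotopy_class A X (complex_image \<Psi> (complex_image \<Phi> X)) (\<lambda>n. \<eta> (cobj X n)))"
    unfolding natural_transformation_def id_functor_def comp_functor_def
    by (auto elim!: homotopy_class_cases simp: cm)
qed

section \<open>Functors on Verdier quotients\<close>

definition zz_class ::
  "('o, 'm, 'x) category_scheme \<Rightarrow> ('o \<times> 'o \<times> 'm) set \<Rightarrow> 'o \<Rightarrow> 'o \<Rightarrow> ('o, 'm) zstep list \<Rightarrow>
   ('o, 'm) zstep list set" where
  "zz_class T S X Y p = zz_rel T S X Y `` {p}"

abbreviation "vzigzag T N \<equiv> zigzag T (cone_in T N)"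
abbreviation "vclass T N \<equiv> zz_class T (cone_in T N)"

fun zstep_map :: "('o, 'm, 'p, 'n) cfunctor \<Rightarrow> ('o, 'm) zstep \<Rightarrow> ('p, 'n) zstep" where
  "zstep_map F (Fwd X Y f) = Fwd (on_ob F X) (on_ob F Y) (on_hom F X Y f)"
| "zstep_map F (Bwd X Y s) = Bwd (on_ob F X) (on_ob F Y) (on_hom F X Y s)"

lemma shift_step_eq: "shift_step T = zstep_map (shift_functor T)"
proof
  show "shift_step T x = zstep_map (shift_functor T) x" for x by (cases x) (simp_all add: shift_functor_def)
qed

lemma zigzag_append: "zigzag T S X Y p \<Longrightarrow> zigzag T S Y Z q \<Longrightarrow> zigzag T S X Z (p @ q)"
  by (induction rule: zigzag.induct) (auto intro: zigzag.intros)

lemma zigzag_Fwd: "X \<in> Ob T \<Longrightarrow> Y \<in> Ob T \<Longrightarrow> f \<in> Hom T X Y \<Longrightarrow> zigzag T S X Y [Fwd X Y f]"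
  by (intro zigzag.intros)

lemma zigzag_Bwd:
  "X \<in> Ob T \<Longrightarrow> Y \<in> Ob T \<Longrightarrow> f \<in> Hom T X Y \<Longrightarrow> (X, Y, f) \<in> S \<Longrightarrow> zigzag T S Y X [Bwd X Y f]"
  by (intro zigzag.intros)

lemma (in category_laws) zz_eq_zigzag:
  "zz_eq C S X Y p q \<Longrightarrow> zigzag C S X Y p \<and> zigzag C S X Y q"
  by (induction rule: zz_eq.induct) (auto intro: zigzag.intros zigzag_append)

lemma (in category_laws) zz_rel_equiv: "equiv {p. zigzag C S X Y p} (zz_rel C S X Y)"
  unfolding zz_rel_def
  by (rule equivI) (auto intro!: refl_onI symI transI intro: zz_eq.intros(1-3) dest: zz_eq_zigzag)

lemma (in category_laws) zz_class_eq:
  "zz_eq C S X Y p q \<Longrightarrow> zz_class C S X Y p = zz_class C S X Y q"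
  unfolding zz_class_def by (rule equiv_class_eq[OF zz_rel_equiv]) (simp add: zz_rel_def)

lemma (in category_laws) UN_zz_class:
  assumes "zigzag C S X Y p" and "\<And>q r. zz_eq C S X Y q r \<Longrightarrow> \<phi> q = \<phi> r"
  shows "(\<Union>q \<in> zz_class C S X Y p. \<phi> q) = \<phi> p"
  unfolding zz_class_def
  by (rule UN_equiv_class[OF zz_rel_equiv]) (use assms in \<open>auto simp: congruent_def zz_rel_def\<close>)

lemma verdier_quotient_simps [simp]:
  "Ob (verdier_quotient T N) = Ob T"
  "ShO (verdier_quotient T N) = ShO T"
  "Idm (verdier_quotient T N) X = vclass T N X X []"
  unfolding verdier_quotient_def Let_def close_triangles_def zz_class_def by simp_all

lemma Hom_verdier_quotient:
  "Hom (verdier_quotient T N) X Y = {p. vzigzag T N X Y p} // zz_rel T (cone_in T N) X Y"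
  unfolding verdier_quotient_def Let_def close_triangles_def by simp

lemma zz_class_closed [simp]:
  "vzigzag T N X Y p \<Longrightarrow> vclass T N X Y p \<in> Hom (verdier_quotient T N) X Y"
  unfolding Hom_verdier_quotient zz_class_def by (simp add: quotientI)

lemma zz_class_cases:
  assumes "F \<in> Hom (verdier_quotient T N) X Y"
  obtains p where "vzigzag T N X Y p" "F = vclass T N X Y p"
  using assms unfolding Hom_verdier_quotient zz_class_def by (auto elim: quotientE)

lemma (in category_laws) zz_eq_append:
  "zz_eq C S X Y p p' \<Longrightarrow> zigzag C S Y Z q \<Longrightarrow> zz_eq C S X Z (p @ q) (p' @ q)"
  "zigzag C S X Y q \<Longrightarrow> zz_eq C S Y Z p p' \<Longrightarrow> zz_eq C S X Z (q @ p) (q @ p')"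
  by (auto intro: zz_eq.intros)

lemma Cmp_zz_class [simp]:
  fixes T :: "('o, 'm) tricategory"
  assumes T: "category_laws T" and pq: "vzigzag T N X Y p" "vzigzag T N Y Z q"
  shows "Cmp (verdier_quotient T N) X Y Z (vclass T N Y Z q) (vclass T N X Y p) =
    vclass T N X Z (p @ q)"
proof -
  interpret category_laws T by (rule T)
  let ?c = "vclass T N"
  have "Cmp (verdier_quotient T N) X Y Z (?c Y Z q) (?c X Y p) = (\<Union>q \<in> ?c Y Z q. \<Union>p \<in> ?c X Y p. ?c X Z (p @ q))"
    unfolding verdier_quotient_def Let_def close_triangles_def zz_class_def by simp
  also have "\<dots> = (\<Union>p \<in> ?c X Y p. ?c X Z (p @ q))"
  proof (rule UN_zz_class[OF pq(2)])
    fix q r assume "zz_eq T (cone_in T N) Y Z q r"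
    then show "(\<Union>p \<in> ?c X Y p. ?c X Z (p @ q)) = (\<Union>p \<in> ?c X Y p. ?c X Z (p @ r))"
      by (intro SUP_cong refl zz_class_eq zz_eq_append(2))
         (auto simp: zz_class_def zz_rel_def dest: zz_eq_zigzag)
  qed
  also have "\<dots> = ?c X Z (p @ q)"
    by (rule UN_zz_class[OF pq(1)]) (rule zz_class_eq, rule zz_eq_append(1)[OF _ pq(2)])
  finally show ?thesis .
qed

lemma verdier_quotient_laws:
  fixes T :: "('o, 'm) tricategory"
  assumes "category_laws T"
  shows "category_laws (verdier_quotient T N)"
  by unfold_locales ((elim zz_class_cases)?; simp add: assms zigzag.intros zigzag_append)+

definition verdier_functor ::
  "('p, 'n) tricategory \<Rightarrow> 'p set \<Rightarrow> ('o, 'm, 'p, 'n) cfunctor \<Rightarrow>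
   ('o, ('o, 'm) zstep list set, 'p, ('p, 'n) zstep list set) cfunctor" where
  "verdier_functor T' N' F = \<lparr>on_ob = on_ob F,
     on_hom = (\<lambda>X Y G. \<Union>p \<in> G. vclass T' N' (on_ob F X) (on_ob F Y) (map (zstep_map F) p))\<rparr>"

lemma on_ob_verdier_functor [simp]: "on_ob (verdier_functor T' N' F) X = on_ob F X"
  by (simp add: verdier_functor_def)

text \<open>The hypothesis of the universal property of localization: morphisms to be inverted go to
  morphisms to be inverted, so formal inverses have somewhere to go.\<close>

locale localizable_functor = T: category_laws T + T': category_laws T'
  for T :: "('o, 'm) tricategory" and T' :: "('p, 'n) tricategory" +
  fixes F :: "('o, 'm, 'p, 'n) cfunctor" and N N'
  assumes functor_laws: "is_functor T T' F"
    and cone: "(X, Y, s) \<in> cone_in T N \<Longrightarrow> (on_ob F X, on_ob F Y, on_hom F X Y s) \<in> cone_in T' N'"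
begin

lemma zigzag_map:
  "vzigzag T N X Y p \<Longrightarrow>
   vzigzag T' N' (on_ob F X) (on_ob F Y) (map (zstep_map F) p)"
  by (induction rule: zigzag.induct) (auto intro: zigzag.intros is_functorD[OF functor_laws] cone)

text \<open>The congruence is the least one, so it suffices to treat its generators: functoriality
  handles identities and composites, the condition on cones handles formal inverses.\<close>

lemma zz_eq_map:
  "zz_eq T (cone_in T N) X Y p q \<Longrightarrow>
   zz_eq T' (cone_in T' N') (on_ob F X) (on_ob F Y) (map (zstep_map F) p) (map (zstep_map F) q)"
proof (induction rule: zz_eq.induct)
  case (zeq_sym X Y p q)
  show ?case by (rule zz_eq.intros(2)[OF zeq_sym.IH])
next
  case (zeq_trans X Y p q r)
  show ?case by (rule zz_eq.intros(3)[OF zeq_trans.IH])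
qed (auto simp: is_functorD[OF functor_laws] intro: zz_eq.intros is_functorD[OF functor_laws] cone zigzag_map)

lemma on_hom_verdier_functor [simp]:
  "vzigzag T N X Y p \<Longrightarrow> on_hom (verdier_functor T' N' F) X Y (vclass T N X Y p) =
    vclass T' N' (on_ob F X) (on_ob F Y) (map (zstep_map F) p)"
  unfolding verdier_functor_def cfunctor.simps
  by (rule T.UN_zz_class) (auto dest: T'.zz_class_eq[OF zz_eq_map])

lemma is_functor_verdier:
  "is_functor (verdier_quotient T N) (verdier_quotient T' N') (verdier_functor T' N' F)"
  unfolding is_functor_def
  by (auto elim!: zz_class_cases intro: is_functorD[OF functor_laws] zigzag_map
       simp: zigzag.intros zigzag_append zigzag_map T.category_laws_axioms T'.category_laws_axioms)

end

text \<open>The shift of the quotient is the functor induced by the shift of \<open>T\<close>; thus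
  its laws are instances of those for localizable functors.\<close>

lemma shift_functor_verdier_quotient:
  "shift_functor (verdier_quotient T N) = verdier_functor T N (shift_functor T)"
  unfolding verdier_quotient_def Let_def close_triangles_def shift_functor_def verdier_functor_def
    zz_class_def shift_step_eq by simp

section \<open>Shift and distinguished triangles of the quotient\<close>

definition pre_verdier_quotient ::
  "('o, 'm) tricategory \<Rightarrow> 'o set \<Rightarrow> ('o, ('o, 'm) zstep list set) tricategory" where
  "pre_verdier_quotient T N =
        \<lparr>Ob = Ob T,
         Hom = (\<lambda>X Y. {p. vzigzag T N X Y p} // zz_rel T (cone_in T N) X Y),
         Idm = (\<lambda>X. vclass T N X X []),
         Cmp = (\<lambda>X Y Z G F. \<Union>q \<in> G. \<Union>p \<in> F. vclass T N X Z (p @ q)),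
         ShO = ShO T,
         ShM = (\<lambda>X Y F. \<Union>p \<in> F. vclass T N (ShO T X) (ShO T Y) (map (shift_step T) p)),
         Tri = {(X, Y, Z, vclass T N X Y [Fwd X Y u], vclass T N Y Z [Fwd Y Z v],
              vclass T N Z (ShO T X) [Fwd Z (ShO T X) w]) | X Y Z u v w.
                  (X, Y, Z, u, v, w) \<in> Tri T}\<rparr>"

lemma verdier_quotient_eq: "verdier_quotient T N = close_triangles (pre_verdier_quotient T N)"
  unfolding verdier_quotient_def pre_verdier_quotient_def Let_def zz_class_def ..

lemma isomorphic_triangles_is_triangle: "isomorphic_triangles T s t \<Longrightarrow> is_triangle T s \<and> is_triangle T t"
  by (cases s; cases t) auto

locale verdier_pair = shift_category T for T :: "('o, 'm) tricategory" +
  fixes N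
  assumes shift_cone: "(X, Y, s) \<in> cone_in T N \<Longrightarrow> (ShO T X, ShO T Y, ShM T X Y s) \<in> cone_in T N"
begin

lemma shift_localizable: "localizable_functor T T (shift_functor T) N N"
  by unfold_locales (use shift in \<open>auto simp: shift_functor_def intro: shift_cone\<close>)

lemma verdier_shift_category: "shift_category (verdier_quotient T N)"
proof -
  interpret Q: category_laws "verdier_quotient T N" by (intro verdier_quotient_laws category_laws_axioms)
  show ?thesis
  proof
    show "is_functor (verdier_quotient T N) (verdier_quotient T N) (shift_functor (verdier_quotient T N))"
      unfolding shift_functor_verdier_quotient
      by (rule localizable_functor.is_functor_verdier[OF shift_localizable])
    fix t assume "t \<in> Tri (verdier_quotient T N)"
    then show "is_triangle (verdier_quotient T N) t"
      unfolding verdier_quotient_eq Tri_close_triangles using isomorphic_triangles_is_triangle by blast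
  qed
qed

lemma ShM_zz_class:
  assumes "vzigzag T N X Y p"
  shows "ShM (verdier_quotient T N) X Y (vclass T N X Y p) =
    vclass T N (ShO T X) (ShO T Y) (map (shift_step T) p)"
  using localizable_functor.on_hom_verdier_functor[OF shift_localizable assms]
  unfolding shift_functor_verdier_quotient[symmetric] by (simp add: shift_functor_def shift_step_eq)

end

text \<open>Having a cone in \<open>N\<close> means being the start of a distinguished triangle with
  third object in \<open>N\<close>, and \<open>F\<close> respects both ingredients.\<close>

lemma strict_localizable:
  assumes "shift_category T" "shift_category T'" and F: "strict_triangle_functor T T' F"
    and N: "\<And>X. X \<in> N \<Longrightarrow> on_ob F X \<in> N'"
  shows "localizable_functor T T' F N N'"
proof -
  interpret T: shift_category T by fact
  interpret T': shift_category T' by fact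
  show ?thesis
  proof
    show "is_functor T T' F" using F unfolding strict_triangle_functor_def shift_commuting_def by blast
    fix X Y s assume "(X, Y, s) \<in> cone_in T N"
    then obtain Z v w where "(X, Y, Z, s, v, w) \<in> Tri T" "Z \<in> N" unfolding cone_in_def by auto
    then have "map_triangle T F (X, Y, Z, s, v, w) \<in> Tri T'" "on_ob F Z \<in> N'"
      using F N unfolding strict_triangle_functor_def by blast+
    then show "(on_ob F X, on_ob F Y, on_hom F X Y s) \<in> cone_in T' N'"
      unfolding cone_in_def by auto
  qed
qed

lemma verdier_functor_strict:
  assumes T: "verdier_pair T N" and T': "verdier_pair T' N'" and F: "strict_triangle_functor T T' F"
    and N: "\<And>X. X \<in> N \<Longrightarrow> on_ob F X \<in> N'"
  shows "strict_triangle_functor (verdier_quotient T N) (verdier_quotient T' N') (verdier_functor T' N' F)"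
proof -
  interpret T: verdier_pair T N by (rule T)
  interpret T': verdier_pair T' N' by (rule T')
  interpret F: localizable_functor T T' F N N'
    by (rule strict_localizable[OF T.shift_category_axioms T'.shift_category_axioms F N])
  have F': "shift_commuting T T' F" and tri: "\<And>t. t \<in> Tri T \<Longrightarrow> map_triangle T F t \<in> Tri T'"
    using F unfolding strict_triangle_functor_def by auto
  note sh = shift_commutingD(2,3)[OF F']
  \<comment> \<open>Strict commutation is known only for objects and morphisms of \<open>T\<close>,
    so the steps must be known to form a zigzag.\<close>
  have step: "map (zstep_map F) (map (shift_step T) p) = map (shift_step T') (map (zstep_map F) p)"
    if "vzigzag T N X Y p" for X Y p
    using that by (induction rule: zigzag.induct) (simp_all add: sh)
  have commuting: "shift_commuting (verdier_quotient T N) (verdier_quotient T' N') (verdier_functor T' N' F)"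
    unfolding shift_commuting_def
  proof (intro conjI ballI, goal_cases)
    case 1
    show ?case by (rule F.is_functor_verdier)
  next
    case (2 X)
    then show ?case by (simp add: sh)
  next
    case (3 X Y f)
    from 3(3) obtain p where p: "vzigzag T N X Y p" "f = vclass T N X Y p"
      by (rule zz_class_cases)
    have "vzigzag T N (ShO T X) (ShO T Y) (map (shift_step T) p)"
      using localizable_functor.zigzag_map[OF T.shift_localizable p(1)]
      by (simp add: shift_functor_def shift_step_eq)
    then show ?case
      using 3 p step[OF p(1)] by (simp add: T.ShM_zz_class T'.ShM_zz_class F.zigzag_map sh del: map_map)
  qed
  show ?thesis unfolding verdier_quotient_eq
  proof (rule strict_triangle_functor_close; (fold verdier_quotient_eq)?)
    fix t assume "t \<in> Tri (pre_verdier_quotient T N)"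
    then obtain X Y Z u v w where xyz: "(X, Y, Z, u, v, w) \<in> Tri T"
      and t: "t = (X, Y, Z, vclass T N X Y [Fwd X Y u], vclass T N Y Z [Fwd Y Z v],
              vclass T N Z (ShO T X) [Fwd Z (ShO T X) w])"
      unfolding pre_verdier_quotient_def by auto
    have ob: "X \<in> Ob T" "Y \<in> Ob T" "Z \<in> Ob T" "u \<in> Hom T X Y" "v \<in> Hom T Y Z" "w \<in> Hom T Z (ShO T X)"
      using T.tri[OF xyz] by auto
    have "ShO (pre_verdier_quotient T N) = ShO T" by (simp add: pre_verdier_quotient_def)
    then have "map_triangle (pre_verdier_quotient T N) (verdier_functor T' N' F) t =
      (on_ob F X, on_ob F Y, on_ob F Z,
        vclass T' N' (on_ob F X) (on_ob F Y) [Fwd (on_ob F X) (on_ob F Y) (on_hom F X Y u)],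
        vclass T' N' (on_ob F Y) (on_ob F Z) [Fwd (on_ob F Y) (on_ob F Z) (on_hom F Y Z v)],
        vclass T' N' (on_ob F Z) (ShO T' (on_ob F X))
          [Fwd (on_ob F Z) (ShO T' (on_ob F X)) (on_hom F Z (ShO T X) w)])"
      unfolding t using ob by (simp add: zigzag_Fwd sh)
    then show "map_triangle (pre_verdier_quotient T N) (verdier_functor T' N' F) t \<in> Tri (pre_verdier_quotient T' N')"
      using tri[OF xyz] unfolding pre_verdier_quotient_def by auto
  qed (fact T.verdier_shift_category T'.verdier_shift_category commuting)+
qed

subsection \<open>Natural transformations\<close>

text \<open>Both units below point away from the identity functor, whereas an equivalence asks for
  the second one in the opposite direction. Pointwise inverses are natural by conjugating the
  naturality square.\<close>

lemma natural_isomorphism_inverse: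
  assumes C: "category_laws C" and D: "category_laws D" and FG: "is_functor C D F" "is_functor C D G"
    and \<eta>: "natural_isomorphism C D F G \<eta>"
  shows "\<exists>\<epsilon>. natural_isomorphism C D G F \<epsilon>"
proof -
  interpret C: category_laws C by (rule C)
  interpret D: category_laws D by (rule D)
  note F = is_functorD[OF FG(1)] and G = is_functorD[OF FG(2)]
  have hom: "\<eta> X \<in> Hom D (on_ob F X) (on_ob G X)" and iso: "is_iso D (on_ob F X) (on_ob G X) (\<eta> X)"
    if "X \<in> Ob C" for X
    using that \<eta> unfolding natural_isomorphism_def natural_transformation_def by auto
  have nat: "Cmp D (on_ob F X) (on_ob F Y) (on_ob G Y) (\<eta> Y) (on_hom F X Y f) =
        Cmp D (on_ob F X) (on_ob G X) (on_ob G Y) (on_hom G X Y f) (\<eta> X)"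
    if "X \<in> Ob C" "Y \<in> Ob C" "f \<in> Hom C X Y" for X Y f
    using that \<eta> unfolding natural_isomorphism_def natural_transformation_def by auto
  define \<epsilon> where "\<epsilon> X = (SOME g. g \<in> Hom D (on_ob G X) (on_ob F X) \<and>
    Cmp D (on_ob F X) (on_ob G X) (on_ob F X) g (\<eta> X) = Idm D (on_ob F X) \<and>
    Cmp D (on_ob G X) (on_ob F X) (on_ob G X) (\<eta> X) g = Idm D (on_ob G X))" for X
  have \<epsilon>: "\<epsilon> X \<in> Hom D (on_ob G X) (on_ob F X) \<and>
    Cmp D (on_ob F X) (on_ob G X) (on_ob F X) (\<epsilon> X) (\<eta> X) = Idm D (on_ob F X) \<and>
    Cmp D (on_ob G X) (on_ob F X) (on_ob G X) (\<eta> X) (\<epsilon> X) = Idm D (on_ob G X)" if "X \<in> Ob C" for X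
    unfolding \<epsilon>_def by (rule someI_ex) (use iso[OF that] in \<open>auto simp: is_iso_def\<close>)
  have "Cmp D (on_ob G X) (on_ob G Y) (on_ob F Y) (\<epsilon> Y) (on_hom G X Y f) =
        Cmp D (on_ob G X) (on_ob F X) (on_ob F Y) (on_hom F X Y f) (\<epsilon> X)"
    if X: "X \<in> Ob C" "Y \<in> Ob C" "f \<in> Hom C X Y" for X Y f
  proof -
    have "Cmp D (on_ob G X) (on_ob G Y) (on_ob F Y) (\<epsilon> Y) (on_hom G X Y f) =
      Cmp D (on_ob G X) (on_ob G Y) (on_ob F Y) (\<epsilon> Y) (Cmp D (on_ob G X) (on_ob G X) (on_ob G Y) (on_hom G X Y f)
        (Cmp D (on_ob G X) (on_ob F X) (on_ob G X) (\<eta> X) (\<epsilon> X)))"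
      using X F G \<epsilon> by simp
    also have "\<dots> = Cmp D (on_ob G X) (on_ob G Y) (on_ob F Y) (\<epsilon> Y) (Cmp D (on_ob G X) (on_ob F X) (on_ob G Y)
        (Cmp D (on_ob F X) (on_ob F Y) (on_ob G Y) (\<eta> Y) (on_hom F X Y f)) (\<epsilon> X))"
      using X F(1,2) G(1,2) \<epsilon> hom by (simp add: nat D.cmp_assoc)
    also have "\<dots> = Cmp D (on_ob G X) (on_ob F Y) (on_ob F Y) (Cmp D (on_ob F Y) (on_ob G Y) (on_ob F Y) (\<epsilon> Y) (\<eta> Y))
       (Cmp D (on_ob G X) (on_ob F X) (on_ob F Y) (on_hom F X Y f) (\<epsilon> X))"
      using X F(1,2) G(1,2) \<epsilon>[THEN conjunct1] hom by (simp add: D.cmp_assoc)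
    finally show ?thesis using X F(1,2) G(1,2) \<epsilon> by simp
  qed
  moreover have "is_iso D (on_ob G X) (on_ob F X) (\<epsilon> X)" if "X \<in> Ob C" for X
    unfolding is_iso_def using \<epsilon>[OF that] hom[OF that] by blast
  ultimately show ?thesis unfolding natural_isomorphism_def natural_transformation_def using \<epsilon> by blast
qed

text \<open>Forward steps commute with \<open>\<eta>\<close> by naturality in \<open>T\<close>. For
  a formal inverse the naturality square of \<open>s\<close> is conjugated by the inverses of
  \<open>s\<close> and of its image, both of which exist in the quotient.\<close>

lemma zz_eq_natural:
  fixes T :: "('o, 'm) tricategory"
  assumes T: "category_laws T" and \<Psi>: "localizable_functor T T \<Psi> N N"
    and \<eta>: "natural_transformation T T id_functor \<Psi> \<eta>"
    and p: "vzigzag T N X Y p"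
  shows "zz_eq T (cone_in T N) X (on_ob \<Psi> Y) (p @ [Fwd Y (on_ob \<Psi> Y) (\<eta> Y)])
    (Fwd X (on_ob \<Psi> X) (\<eta> X) # map (zstep_map \<Psi>) p)"
  using p
proof (induction rule: zigzag.induct)
  interpret category_laws T by (rule T)
  interpret localizable_functor T T \<Psi> N N by (rule \<Psi>)
  let ?eq = "zz_eq T (cone_in T N)"
  have hom: "\<eta> X \<in> Hom T X (on_ob \<Psi> X)" if "X \<in> Ob T" for X
    using that \<eta> unfolding natural_transformation_def by (simp add: id_functor_def)
  have nat: "Cmp T X Y (on_ob \<Psi> Y) (\<eta> Y) f = Cmp T X (on_ob \<Psi> X) (on_ob \<Psi> Y) (on_hom \<Psi> X Y f) (\<eta> X)"
    if "X \<in> Ob T" "Y \<in> Ob T" "f \<in> Hom T X Y" for X Y f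
    using that \<eta> unfolding natural_transformation_def by (simp add: id_functor_def)
  note F = is_functorD[OF functor_laws]
  have fwd: "?eq X (on_ob \<Psi> Y) [Fwd X Y f, Fwd Y (on_ob \<Psi> Y) (\<eta> Y)]
      [Fwd X (on_ob \<Psi> X) (\<eta> X), Fwd (on_ob \<Psi> X) (on_ob \<Psi> Y) (on_hom \<Psi> X Y f)]"
    if X: "X \<in> Ob T" "Y \<in> Ob T" "f \<in> Hom T X Y" for X Y f
  proof -
    have "?eq X (on_ob \<Psi> Y) [Fwd X Y f, Fwd Y (on_ob \<Psi> Y) (\<eta> Y)] [Fwd X (on_ob \<Psi> Y) (Cmp T X Y (on_ob \<Psi> Y) (\<eta> Y) f)]"
      by (rule zeq_comp) (use X F hom in auto)
    moreover have "?eq X (on_ob \<Psi> Y) [Fwd X (on_ob \<Psi> X) (\<eta> X), Fwd (on_ob \<Psi> X) (on_ob \<Psi> Y) (on_hom \<Psi> X Y f)]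
        [Fwd X (on_ob \<Psi> Y) (Cmp T X Y (on_ob \<Psi> Y) (\<eta> Y) f)]"
      unfolding nat[OF X] by (rule zeq_comp) (use X F hom in auto)
    ultimately show ?thesis by (blast intro: zeq_trans zeq_sym)
  qed
  {
    case (zz_nil X)
    then show ?case using hom F by (auto intro!: zeq_refl zigzag_Fwd)
  next
    case (zz_fwd X Y f Z p)
    have "?eq X (on_ob \<Psi> Z) ([Fwd X Y f] @ (p @ [Fwd Z (on_ob \<Psi> Z) (\<eta> Z)]))
       ([Fwd X Y f] @ (Fwd Y (on_ob \<Psi> Y) (\<eta> Y) # map (zstep_map \<Psi>) p))"
      by (rule zz_eq_append(2)[OF zigzag_Fwd zz_fwd(5)]) (use zz_fwd in auto)
    moreover have "?eq X (on_ob \<Psi> Z) ([Fwd X Y f, Fwd Y (on_ob \<Psi> Y) (\<eta> Y)] @ map (zstep_map \<Psi>) p)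
       ([Fwd X (on_ob \<Psi> X) (\<eta> X), Fwd (on_ob \<Psi> X) (on_ob \<Psi> Y) (on_hom \<Psi> X Y f)] @ map (zstep_map \<Psi>) p)"
      by (rule zz_eq_append(1)[OF fwd zigzag_map]) (use zz_fwd in auto)
    ultimately show ?case using zeq_trans by fastforce
  next
    case (zz_bwd X Y s Z p)
    let ?\<Psi>s = "on_hom \<Psi> X Y s"
    let ?b = "Bwd (on_ob \<Psi> X) (on_ob \<Psi> Y) ?\<Psi>s"
    have \<Psi>s: "?\<Psi>s \<in> Hom T (on_ob \<Psi> X) (on_ob \<Psi> Y)" "(on_ob \<Psi> X, on_ob \<Psi> Y, ?\<Psi>s) \<in> cone_in T N"
      using zz_bwd F cone by auto
    \<comment> \<open>Three moves: insert the image of \<open>s\<close> followed by its formal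
      inverse, exchange it with \<open>\<eta>\<close> by naturality at \<open>s\<close>, then cancel
      \<open>s\<close> against its own formal inverse.\<close>
    have 1: "?eq Y (on_ob \<Psi> X) ([Bwd X Y s, Fwd X (on_ob \<Psi> X) (\<eta> X)] @ [])
       ([Bwd X Y s, Fwd X (on_ob \<Psi> X) (\<eta> X)] @ [Fwd (on_ob \<Psi> X) (on_ob \<Psi> Y) ?\<Psi>s, ?b])"
      by (rule zz_eq_append(2)[OF _ zeq_sym[OF zeq_inv1]])
        (use zz_bwd F \<Psi>s hom in \<open>auto intro!: zigzag.intros\<close>)
    have 2: "?eq Y (on_ob \<Psi> X) ([Bwd X Y s] @ ([Fwd X (on_ob \<Psi> X) (\<eta> X), Fwd (on_ob \<Psi> X) (on_ob \<Psi> Y) ?\<Psi>s] @ [?b]))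
       ([Bwd X Y s] @ ([Fwd X Y s, Fwd Y (on_ob \<Psi> Y) (\<eta> Y)] @ [?b]))"
      by (intro zz_eq_append(2)[OF zigzag_Bwd] zz_eq_append(1)[OF zeq_sym[OF fwd] zigzag_Bwd])
        (use zz_bwd F \<Psi>s in auto)
    have 3: "?eq Y (on_ob \<Psi> X) ([Bwd X Y s, Fwd X Y s] @ [Fwd Y (on_ob \<Psi> Y) (\<eta> Y), ?b])
       ([] @ [Fwd Y (on_ob \<Psi> Y) (\<eta> Y), ?b])"
      by (rule zz_eq_append(1)[OF zeq_inv2]) (use zz_bwd F \<Psi>s hom in \<open>auto intro!: zigzag.intros\<close>)
    have bwd: "?eq Y (on_ob \<Psi> X) [Bwd X Y s, Fwd X (on_ob \<Psi> X) (\<eta> X)] [Fwd Y (on_ob \<Psi> Y) (\<eta> Y), ?b]"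
      using zeq_trans[OF zeq_trans[OF 1[simplified] 2[simplified]] 3[simplified]] .
    have "?eq Y (on_ob \<Psi> Z) ([Bwd X Y s] @ (p @ [Fwd Z (on_ob \<Psi> Z) (\<eta> Z)]))
       ([Bwd X Y s] @ (Fwd X (on_ob \<Psi> X) (\<eta> X) # map (zstep_map \<Psi>) p))"
      by (rule zz_eq_append(2)[OF zigzag_Bwd zz_bwd(6)]) (use zz_bwd in auto)
    moreover have "?eq Y (on_ob \<Psi> Z) ([Bwd X Y s, Fwd X (on_ob \<Psi> X) (\<eta> X)] @ map (zstep_map \<Psi>) p)
       ([Fwd Y (on_ob \<Psi> Y) (\<eta> Y), ?b] @ map (zstep_map \<Psi>) p)"
      by (rule zz_eq_append(1)[OF bwd zigzag_map]) (use zz_bwd in auto)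
    ultimately show ?case using zeq_trans by fastforce
  }
qed

text \<open>Naturality comes from \<open>T\<close>, but invertibility is asked only in the quotient,
  where \<open>\<eta>\<close> may acquire an inverse that it lacks in \<open>T\<close>.\<close>

lemma verdier_natural_isomorphism:
  fixes T :: "('o, 'm) tricategory" and T' :: "('p, 'n) tricategory"
  assumes F: "localizable_functor T T' F N N'" and G: "localizable_functor T' T G N' N"
    and \<eta>: "natural_transformation T T id_functor (comp_functor G F) \<eta>"
    and iso: "\<And>X. X \<in> Ob T \<Longrightarrow> is_iso (verdier_quotient T N) X (on_ob G (on_ob F X))
      (vclass T N X (on_ob G (on_ob F X)) [Fwd X (on_ob G (on_ob F X)) (\<eta> X)])"
  shows "natural_isomorphism (verdier_quotient T N) (verdier_quotient T N) id_functor
    (comp_functor (verdier_functor T N G) (verdier_functor T' N' F))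
    (\<lambda>X. vclass T N X (on_ob G (on_ob F X)) [Fwd X (on_ob G (on_ob F X)) (\<eta> X)])"
proof -
  interpret F: localizable_functor T T' F N N' by (rule F)
  interpret G: localizable_functor T' T G N' N by (rule G)
  have \<Psi>: "localizable_functor T T (comp_functor G F) N N"
    using is_functor_comp[OF F.functor_laws G.functor_laws] F.cone G.cone
    by unfold_locales (auto simp: comp_functor_def)
  have step: "zstep_map (comp_functor G F) = zstep_map G \<circ> zstep_map F"
  proof
    show "zstep_map (comp_functor G F) x = (zstep_map G \<circ> zstep_map F) x" for x
      by (cases x) (simp_all add: comp_functor_def)
  qed
  have hom: "\<eta> X \<in> Hom T X (on_ob G (on_ob F X))" if "X \<in> Ob T" for X
    using that \<eta> unfolding natural_transformation_def by (simp add: id_functor_def comp_functor_def)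
  have zz: "vzigzag T N X (on_ob G (on_ob F X)) [Fwd X (on_ob G (on_ob F X)) (\<eta> X)]"
    if "X \<in> Ob T" for X
    using that hom is_functorD(1)[OF F.functor_laws] is_functorD(1)[OF G.functor_laws] by (intro zigzag_Fwd) auto
  have "natural_transformation (verdier_quotient T N) (verdier_quotient T N) id_functor
    (comp_functor (verdier_functor T N G) (verdier_functor T' N' F))
    (\<lambda>X. vclass T N X (on_ob G (on_ob F X)) [Fwd X (on_ob G (on_ob F X)) (\<eta> X)])"
    unfolding natural_transformation_def
  proof (intro conjI ballI, goal_cases)
    case (2 X Y f)
    from 2(3) obtain p where p: "vzigzag T N X Y p" "f = vclass T N X Y p"
      by (rule zz_class_cases)
    have "zz_eq T (cone_in T N) X (on_ob G (on_ob F Y)) (p @ [Fwd Y (on_ob G (on_ob F Y)) (\<eta> Y)])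
      (Fwd X (on_ob G (on_ob F X)) (\<eta> X) # map (zstep_map G) (map (zstep_map F) p))"
      using zz_eq_natural[OF F.T.category_laws_axioms \<Psi> \<eta> p(1)] by (simp add: step) (simp add: comp_functor_def)
    then show ?case
      using 2(1,2) p zz F.zigzag_map[OF p(1)] G.zigzag_map[OF F.zigzag_map[OF p(1)]]
      by (simp add: id_functor_def comp_functor_def F.T.category_laws_axioms F.T.zz_class_eq del: map_map)
  qed (simp add: id_functor_def comp_functor_def zz)
  then show ?thesis unfolding natural_isomorphism_def
    using iso by (simp add: id_functor_def comp_functor_def)
qed

text \<open>The two ways to become invertible: the inverse is the class of an inverse in
  \<open>T\<close>, or the formal inverse added by the localization.\<close>

lemma verdier_is_iso:
  fixes T :: "('o, 'm) tricategory"
  assumes T: "category_laws T" and ob: "X \<in> Ob T" "Y \<in> Ob T"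
    and s: "is_iso T X Y s \<or> s \<in> Hom T X Y \<and> (X, Y, s) \<in> cone_in T N"
  shows "is_iso (verdier_quotient T N) X Y (vclass T N X Y [Fwd X Y s])"
  using s
proof
  interpret category_laws T by (rule T)
  assume "is_iso T X Y s"
  then obtain g where g: "s \<in> Hom T X Y" "g \<in> Hom T Y X" "Cmp T X Y X g s = Idm T X" "Cmp T Y X Y s g = Idm T Y"
    unfolding is_iso_def by blast
  have 1: "zz_eq T (cone_in T N) X X [Fwd X Y s, Fwd Y X g] []" "zz_eq T (cone_in T N) Y Y [Fwd Y X g, Fwd X Y s] []"
    using zeq_comp[of X T Y X s g] zeq_comp[of Y T X Y g s] zeq_id[of X T] zeq_id[of Y T] ob g zeq_trans by metis+
  have z: "vzigzag T N X Y [Fwd X Y s]" "vzigzag T N Y X [Fwd Y X g]"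
    using ob g by (auto intro: zigzag_Fwd)
  show ?thesis unfolding is_iso_def using T 1 z
    by (intro conjI bexI[of _ "vclass T N Y X [Fwd Y X g]"]) (simp_all add: zz_class_eq)
next
  interpret category_laws T by (rule T)
  assume s: "s \<in> Hom T X Y \<and> (X, Y, s) \<in> cone_in T N"
  then have 1: "zz_eq T (cone_in T N) X X [Fwd X Y s, Bwd X Y s] []" "zz_eq T (cone_in T N) Y Y [Bwd X Y s, Fwd X Y s] []"
    and z: "vzigzag T N X Y [Fwd X Y s]" "vzigzag T N Y X [Bwd X Y s]"
    using ob by (auto intro: zigzag_Fwd zigzag_Bwd zeq_inv1 zeq_inv2)
  show ?thesis unfolding is_iso_def using T 1 z
    by (intro conjI bexI[of _ "vclass T N Y X [Bwd X Y s]"]) (simp_all add: zz_class_eq)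
qed

text \<open>The formal core of the equivalence. The disjunctions let one unit be an isomorphism
  before localization while the other becomes one only through its cone.\<close>

theorem verdier_triangle_equivalent:
  assumes T: "verdier_pair T N" and T': "verdier_pair T' N'"
    and F: "strict_triangle_functor T T' F" "\<And>X. X \<in> N \<Longrightarrow> on_ob F X \<in> N'"
    and G: "strict_triangle_functor T' T G" "\<And>X. X \<in> N' \<Longrightarrow> on_ob G X \<in> N"
    and \<eta>: "natural_transformation T T id_functor (comp_functor G F) \<eta>"
      "\<And>X. X \<in> Ob T \<Longrightarrow> is_iso T X (on_ob G (on_ob F X)) (\<eta> X) \<or> (X, on_ob G (on_ob F X), \<eta> X) \<in> cone_in T N"
    and \<epsilon>: "natural_transformation T' T' id_functor (comp_functor F G) \<epsilon>"
      "\<And>X. X \<in> Ob T' \<Longrightarrow> is_iso T' X (on_ob F (on_ob G X)) (\<epsilon> X) \<or> (X, on_ob F (on_ob G X), \<epsilon> X) \<in> cone_in T' N'"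
  shows "triangle_equivalent (verdier_quotient T N) (verdier_quotient T' N')"
proof -
  interpret T: verdier_pair T N by (rule T)
  interpret T': verdier_pair T' N' by (rule T')
  interpret F: localizable_functor T T' F N N'
    by (rule strict_localizable[OF T.shift_category_axioms T'.shift_category_axioms F])
  interpret G: localizable_functor T' T G N' N
    by (rule strict_localizable[OF T'.shift_category_axioms T.shift_category_axioms G])
  let ?Q = "verdier_quotient T N" and ?Q' = "verdier_quotient T' N'"
  let ?F = "verdier_functor T' N' F" and ?G = "verdier_functor T N G"
  note ob = is_functorD(1)[OF F.functor_laws] is_functorD(1)[OF G.functor_laws]
  have "\<eta> X \<in> Hom T X (on_ob G (on_ob F X))" if "X \<in> Ob T" for X
    using \<eta>(1) that by (simp add: natural_transformation_def id_functor_def comp_functor_def)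
  then have \<eta>': "natural_isomorphism ?Q ?Q id_functor (comp_functor ?G ?F)
    (\<lambda>X. vclass T N X (on_ob G (on_ob F X)) [Fwd X (on_ob G (on_ob F X)) (\<eta> X)])"
    using \<eta>(2) ob by (intro verdier_natural_isomorphism[OF F.localizable_functor_axioms G.localizable_functor_axioms \<eta>(1)]
      verdier_is_iso T.category_laws_axioms) auto
  have "\<epsilon> X \<in> Hom T' X (on_ob F (on_ob G X))" if "X \<in> Ob T'" for X
    using \<epsilon>(1) that by (simp add: natural_transformation_def id_functor_def comp_functor_def)
  then have "natural_isomorphism ?Q' ?Q' id_functor (comp_functor ?F ?G)
    (\<lambda>X. vclass T' N' X (on_ob F (on_ob G X)) [Fwd X (on_ob F (on_ob G X)) (\<epsilon> X)])"
    using \<epsilon>(2) ob by (intro verdier_natural_isomorphism[OF G.localizable_functor_axioms F.localizable_functor_axioms \<epsilon>(1)]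
      verdier_is_iso T'.category_laws_axioms) auto
  moreover have "is_functor ?Q' ?Q' id_functor" by (simp add: is_functor_def id_functor_def)
  ultimately have "\<exists>\<epsilon>. natural_isomorphism ?Q' ?Q' (comp_functor ?F ?G) id_functor \<epsilon>"
    using natural_isomorphism_inverse verdier_quotient_laws[OF T'.category_laws_axioms]
      is_functor_comp[OF G.is_functor_verdier F.is_functor_verdier] by blast
  with \<eta>' have "equivalence_of_categories ?Q ?Q' ?F"
    unfolding equivalence_of_categories_def using F.is_functor_verdier G.is_functor_verdier by blast
  then show ?thesis unfolding triangle_equivalent_def
    using strict_triangle_functor_imp[OF T.verdier_shift_category T'.verdier_shift_category
      verdier_functor_strict[OF T T' F]] by blast
qed

section \<open>Abelian groups and modules\<close>

lemma Ab_cat_simps [simp]: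
  "Idm Ab_cat G = (\<lambda>x \<in> carrier G. x)"
  "Cmp Ab_cat G H K g f = compose (carrier G) g f"
  "Plus Ab_cat G H f g = (\<lambda>x \<in> carrier G. f x \<otimes>\<^bsub>H\<^esub> g x)"
  "Zero Ab_cat G H = (\<lambda>x \<in> carrier G. \<one>\<^bsub>H\<^esub>)"
  "Neg Ab_cat G H f = (\<lambda>x \<in> carrier G. inv\<^bsub>H\<^esub> f x)"
  by (simp_all add: Ab_cat_def)

lemma Ob_Ab_cat: "G \<in> Ob Ab_cat \<longleftrightarrow> comm_group G \<and> small (carrier G)"
  by (simp add: Ab_cat_def)

lemma Hom_Ab_cat: "f \<in> Hom Ab_cat G H \<longleftrightarrow> f \<in> hom G H \<and> f \<in> extensional (carrier G)"
  by (simp add: Ab_cat_def)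

lemma Ab_cat_laws: "preadditive_laws Ab_cat"
proof
  fix G H K L :: "'a monoid" and f g h
  assume *: "G \<in> Ob Ab_cat"
  interpret G: comm_group G using * by (simp add: Ob_Ab_cat)
  show "Idm Ab_cat G \<in> Hom Ab_cat G G"
    by (auto simp: Hom_Ab_cat hom_def)
  {
    assume **: "H \<in> Ob Ab_cat"
    interpret H: comm_group H using ** by (simp add: Ob_Ab_cat)
    show "Zero Ab_cat G H \<in> Hom Ab_cat G H" by (auto simp: Hom_Ab_cat hom_def)
    {
      assume f: "f \<in> Hom Ab_cat G H"
      show "Cmp Ab_cat G H H (Idm Ab_cat H) f = f" "Cmp Ab_cat G G H f (Idm Ab_cat G) = f"
        "Plus Ab_cat G H (Zero Ab_cat G H) f = f" "Plus Ab_cat G H (Neg Ab_cat G H f) f = Zero Ab_cat G H"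
        using f by (auto simp: Hom_Ab_cat hom_def compose_def fun_eq_iff restrict_def extensional_def Pi_iff)
      show "Neg Ab_cat G H f \<in> Hom Ab_cat G H"
        using f by (auto simp: Hom_Ab_cat hom_def Pi_iff H.inv_mult)
      assume g: "g \<in> Hom Ab_cat G H"
      show "Plus Ab_cat G H f g \<in> Hom Ab_cat G H"
        using f g by (auto simp: Hom_Ab_cat hom_def Pi_iff H.m_ac)
      show "Plus Ab_cat G H f g = Plus Ab_cat G H g f"
        using f g by (auto simp: Hom_Ab_cat hom_def Pi_iff H.m_comm restrict_def)
      assume h: "h \<in> Hom Ab_cat G H"
      show "Plus Ab_cat G H (Plus Ab_cat G H f g) h = Plus Ab_cat G H f (Plus Ab_cat G H g h)"
        using f g h by (auto simp: Hom_Ab_cat hom_def Pi_iff H.m_assoc restrict_def)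
    }
    assume "K \<in> Ob Ab_cat"
    then interpret K: comm_group K by (simp add: Ob_Ab_cat)
    show "f \<in> Hom Ab_cat G H \<Longrightarrow> g \<in> Hom Ab_cat H K \<Longrightarrow> Cmp Ab_cat G H K g f \<in> Hom Ab_cat G K"
      by (auto simp: Hom_Ab_cat hom_def Pi_iff compose_def)
    show "f \<in> Hom Ab_cat G H \<Longrightarrow> g \<in> Hom Ab_cat H K \<Longrightarrow> h \<in> Hom Ab_cat K L \<Longrightarrow>
      Cmp Ab_cat G H L (Cmp Ab_cat H K L h g) f = Cmp Ab_cat G K L h (Cmp Ab_cat G H K g f)"
      by (auto simp: Hom_Ab_cat hom_def Pi_iff compose_def restrict_def)
    show "f \<in> Hom Ab_cat G H \<Longrightarrow> g \<in> Hom Ab_cat H K \<Longrightarrow> h \<in> Hom Ab_cat H K \<Longrightarrow>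
      Cmp Ab_cat G H K (Plus Ab_cat H K g h) f = Plus Ab_cat G K (Cmp Ab_cat G H K g f) (Cmp Ab_cat G H K h f)"
      by (auto simp: Hom_Ab_cat hom_def Pi_iff compose_def restrict_def)
    show "f \<in> Hom Ab_cat G H \<Longrightarrow> g \<in> Hom Ab_cat G H \<Longrightarrow> h \<in> Hom Ab_cat H K \<Longrightarrow>
      Cmp Ab_cat G H K h (Plus Ab_cat G H f g) = Plus Ab_cat G K (Cmp Ab_cat G H K h f) (Cmp Ab_cat G H K h g)"
      by (auto simp: Hom_Ab_cat hom_def Pi_iff compose_def restrict_def)
  }
qed

section \<open>Modules through their additive groups\<close>

definition add_group :: "('r, 'a, 'x) module_scheme \<Rightarrow> 'a monoid" where
  "add_group M = \<lparr>carrier = carrier M, mult = add M, one = zero M\<rparr>"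

lemma add_group_simps [simp]:
  "carrier (add_group M) = carrier M" "mult (add_group M) = add M" "one (add_group M) = zero M"
  "m_inv (add_group M) = a_inv M"
  by (simp_all add: add_group_def m_inv_def[abs_def] a_inv_def)

lemma comm_group_add_group: "abelian_group M \<Longrightarrow> comm_group (add_group M)"
proof -
  assume "abelian_group M"
  then interpret abelian_group M .
  show ?thesis by (intro comm_groupI) (auto simp: a_ac)
qed

text \<open>All operations on homomorphisms of modules are those of the underlying groups. The laws
  of \<open>Mod_cat\<close> are therefore inherited from \<open>Ab_cat\<close>, and only linearity
  over \<open>R\<close> is left to check.\<close>

lemma Mod_cat_simps:
  "Idm (Mod_cat R) M = Idm Ab_cat (add_group M)"
  "Cmp (Mod_cat R) L M N g f = Cmp Ab_cat (add_group L) (add_group M) (add_group N) g f"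
  "Plus (Mod_cat R) M N f g = Plus Ab_cat (add_group M) (add_group N) f g"
  "Zero (Mod_cat R) M N = Zero Ab_cat (add_group M) (add_group N)"
  "Neg (Mod_cat R) M N f = Neg Ab_cat (add_group M) (add_group N) f"
  by (simp_all add: Mod_cat_def)

lemma Ob_Mod_cat: "M \<in> Ob (Mod_cat R) \<longleftrightarrow> right_module R M \<and> small (carrier M)"
  by (simp add: Mod_cat_def)

lemma add_group_Ob: "M \<in> Ob (Mod_cat R) \<Longrightarrow> add_group M \<in> Ob Ab_cat"
  unfolding Ob_Mod_cat Ob_Ab_cat
  by (auto simp: right_module_def intro: comm_group_add_group)

lemma Hom_Mod_cat: "f \<in> Hom (Mod_cat R) M N \<longleftrightarrow> f \<in> Hom Ab_cat (add_group M) (add_group N) \<and>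
  (\<forall>a \<in> carrier R. \<forall>x \<in> carrier M. f (a \<odot>\<^bsub>M\<^esub> x) = a \<odot>\<^bsub>N\<^esub> f x)"
  by (auto simp: Mod_cat_def rmod_hom_def Hom_Ab_cat hom_def)

lemma hom_add_group_closed:
  "f \<in> Hom Ab_cat (add_group M) (add_group N) \<Longrightarrow> x \<in> carrier M \<Longrightarrow> f x \<in> carrier N"
  by (auto simp: Hom_Ab_cat hom_def)

context right_module
begin

lemma smult_zero [simp]: "a \<in> carrier R \<Longrightarrow> a \<odot>\<^bsub>M\<^esub> \<zero>\<^bsub>M\<^esub> = \<zero>\<^bsub>M\<^esub>"
  using smult_r_distr[of a "\<zero>\<^bsub>M\<^esub>" "\<zero>\<^bsub>M\<^esub>"] smult_closed[of a "\<zero>\<^bsub>M\<^esub>"] by (simp add: M.add.l_cancel_one')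

lemma smult_minus: "a \<in> carrier R \<Longrightarrow> x \<in> carrier M \<Longrightarrow> a \<odot>\<^bsub>M\<^esub> (\<ominus>\<^bsub>M\<^esub> x) = \<ominus>\<^bsub>M\<^esub> (a \<odot>\<^bsub>M\<^esub> x)"
  using smult_r_distr[of a "\<ominus>\<^bsub>M\<^esub> x" x] smult_closed by (simp add: M.l_neg M.minus_equality)

end

lemma Mod_cat_laws: "preadditive_laws (Mod_cat R)"
proof -
  interpret Ab: preadditive_laws Ab_cat by (rule Ab_cat_laws)
  note mod = Ob_Mod_cat[THEN iffD1, THEN conjunct1]
  have smult: "a \<odot>\<^bsub>M\<^esub> x \<in> carrier M" if "M \<in> Ob (Mod_cat R)" "a \<in> carrier R" "x \<in> carrier M" for M a x
    using that by (rule right_module.smult_closed[OF mod])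
  note cl = hom_add_group_closed smult
  show ?thesis
    apply unfold_locales
    subgoal for M using Ab.idm_closed[OF add_group_Ob] by (auto simp: Hom_Mod_cat Mod_cat_simps(1) smult)
    subgoal using Ab.cmp_closed[OF add_group_Ob add_group_Ob add_group_Ob]
      by (auto simp: Hom_Mod_cat Mod_cat_simps(2) compose_def cl)
    subgoal by (simp add: Hom_Mod_cat Mod_cat_simps add_group_Ob del: Ab_cat_simps)
    subgoal by (simp add: Hom_Mod_cat Mod_cat_simps add_group_Ob del: Ab_cat_simps)
    subgoal by (simp add: Hom_Mod_cat Mod_cat_simps add_group_Ob Ab.cmp_assoc del: Ab_cat_simps)
    subgoal using Ab.plus_closed[OF add_group_Ob add_group_Ob]
      by (auto simp: Hom_Mod_cat Mod_cat_simps(3) cl right_module.smult_r_distr[OF mod])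
    subgoal using Ab.zero_closed[OF add_group_Ob add_group_Ob]
      by (auto simp: Hom_Mod_cat Mod_cat_simps(4) cl right_module.smult_zero[OF mod])
    subgoal using Ab.neg_closed[OF add_group_Ob add_group_Ob]
      by (auto simp: Hom_Mod_cat Mod_cat_simps(5) cl right_module.smult_minus[OF mod])
    subgoal by (simp add: Hom_Mod_cat Mod_cat_simps add_group_Ob Ab.plus_assoc del: Ab_cat_simps)
    subgoal by (simp add: Hom_Mod_cat Mod_cat_simps add_group_Ob Ab.plus_comm del: Ab_cat_simps)
    subgoal by (simp add: Hom_Mod_cat Mod_cat_simps add_group_Ob del: Ab_cat_simps)
    subgoal by (simp add: Hom_Mod_cat Mod_cat_simps add_group_Ob del: Ab_cat_simps)
    subgoal by (simp add: Hom_Mod_cat Mod_cat_simps add_group_Ob Ab.cmp_plus_left del: Ab_cat_simps)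
    subgoal by (simp add: Hom_Mod_cat Mod_cat_simps add_group_Ob Ab.cmp_plus_right del: Ab_cat_simps)
    done
qed

section \<open>Categories of additive functors\<close>

lemma functor_category_simps:
  "Ob (additive_functor_category C D) = {F. additive_functor C D F}"
  "Hom (additive_functor_category C D) F G = {\<eta>. natural_transformation C D F G \<eta>} \<inter> extensional (Ob C)"
  "Idm (additive_functor_category C D) F = (\<lambda>X \<in> Ob C. Idm D (on_ob F X))"
  "Cmp (additive_functor_category C D) F G H \<beta> \<alpha> =
     (\<lambda>X \<in> Ob C. Cmp D (on_ob F X) (on_ob G X) (on_ob H X) (\<beta> X) (\<alpha> X))"
  "Plus (additive_functor_category C D) F G \<alpha> \<beta> = (\<lambda>X \<in> Ob C. Plus D (on_ob F X) (on_ob G X) (\<alpha> X) (\<beta> X))"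
  "Zero (additive_functor_category C D) F G = (\<lambda>X \<in> Ob C. Zero D (on_ob F X) (on_ob G X))"
  "Neg (additive_functor_category C D) F G \<alpha> = (\<lambda>X \<in> Ob C. Neg D (on_ob F X) (on_ob G X) (\<alpha> X))"
  by (simp_all add: additive_functor_category_def)

lemma additive_functor_is_functor: "additive_functor C D F \<Longrightarrow> is_functor C D F"
  unfolding additive_functor_def by blast

lemma additive_functor_plus:
  "\<lbrakk>additive_functor C D F; X \<in> Ob C; Y \<in> Ob C; f \<in> Hom C X Y; g \<in> Hom C X Y\<rbrakk> \<Longrightarrow>
      on_hom F X Y (Plus C X Y f g) = Plus D (on_ob F X) (on_ob F Y) (on_hom F X Y f) (on_hom F X Y g)"
  unfolding additive_functor_def by blast

lemmas additive_functorD = is_functorD[OF additive_functor_is_functor] additive_functor_plus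

lemma natural_transformationD:
  assumes "natural_transformation C D F G \<eta>"
  shows "X \<in> Ob C \<Longrightarrow> \<eta> X \<in> Hom D (on_ob F X) (on_ob G X)"
    and "\<lbrakk>X \<in> Ob C; Y \<in> Ob C; f \<in> Hom C X Y\<rbrakk> \<Longrightarrow>
      Cmp D (on_ob F X) (on_ob F Y) (on_ob G Y) (\<eta> Y) (on_hom F X Y f) =
        Cmp D (on_ob F X) (on_ob G X) (on_ob G Y) (on_hom G X Y f) (\<eta> X)"
  using assms unfolding natural_transformation_def by blast+

context preadditive_laws
begin

lemma functor_category_laws: "preadditive_laws (additive_functor_category C A)"
proof -
  have cmp: "natural_transformation C A F H (\<lambda>X \<in> Ob C. Cmp A (on_ob F X) (on_ob G X) (on_ob H X) (\<beta> X) (\<alpha> X))"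
    if F: "additive_functor C A F" "additive_functor C A G" "additive_functor C A H"
      and a: "natural_transformation C A F G \<alpha>" and b: "natural_transformation C A G H \<beta>" for F G H \<alpha> \<beta>
    unfolding natural_transformation_def
  proof (intro conjI ballI)
    fix X Y f assume X: "X \<in> Ob C" "Y \<in> Ob C" "f \<in> Hom C X Y"
    note o = F(1)[THEN additive_functorD(1)] F(2)[THEN additive_functorD(1)] F(3)[THEN additive_functorD(1)]
      F(1)[THEN additive_functorD(2)] F(2)[THEN additive_functorD(2)] F(3)[THEN additive_functorD(2)]
      natural_transformationD(1)[OF a] natural_transformationD(1)[OF b]
    show "Cmp A (on_ob F X) (on_ob F Y) (on_ob H Y) ((\<lambda>X\<in>Ob C. Cmp A (on_ob F X) (on_ob G X) (on_ob H X) (\<beta> X) (\<alpha> X)) Y) (on_hom F X Y f) =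
       Cmp A (on_ob F X) (on_ob H X) (on_ob H Y) (on_hom H X Y f)
        ((\<lambda>X\<in>Ob C. Cmp A (on_ob F X) (on_ob G X) (on_ob H X) (\<beta> X) (\<alpha> X)) X)"
      using X o by (simp add: cmp_assoc natural_transformationD(2)[OF a]
         cmp_eq_left[OF _ _ _ _ _ _ _ natural_transformationD(2)[OF b, symmetric]])
  qed (use F[THEN additive_functorD(1)] natural_transformationD(1)[OF a] natural_transformationD(1)[OF b] in auto)
  show ?thesis
    apply (unfold_locales; unfold functor_category_simps)
    subgoal by (auto simp: natural_transformation_def additive_functorD)
    subgoal using cmp by auto
    subgoal by (rule extensionalityI[of _ "Ob C"])
       (auto intro!: cmp_idm_left dest: additive_functorD(1) natural_transformationD(1))
    subgoal by (rule extensionalityI[of _ "Ob C"])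
       (auto intro!: cmp_idm_right dest: additive_functorD(1) natural_transformationD(1))
    subgoal by (rule extensionalityI[of _ "Ob C"])
       (auto intro!: cmp_assoc dest: additive_functorD(1) natural_transformationD(1))
    subgoal by (auto simp: natural_transformation_def additive_functorD cmp_plus_left cmp_plus_right)
    subgoal by (auto simp: natural_transformation_def additive_functorD)
    subgoal by (auto simp: natural_transformation_def additive_functorD)
    subgoal by (rule extensionalityI[of _ "Ob C"])
       (auto intro!: plus_assoc dest: additive_functorD(1) natural_transformationD(1))
    subgoal by (rule extensionalityI[of _ "Ob C"])
       (auto intro!: plus_comm dest: additive_functorD(1) natural_transformationD(1))
    subgoal by (rule extensionalityI[of _ "Ob C"])
       (auto intro!: zero_plus dest: additive_functorD(1) natural_transformationD(1))
    subgoal by (rule extensionalityI[of _ "Ob C"])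
       (auto intro!: neg_plus dest: additive_functorD(1) natural_transformationD(1))
    subgoal by (rule extensionalityI[of _ "Ob C"])
       (auto intro!: cmp_plus_left dest: additive_functorD(1) natural_transformationD(1))
    subgoal by (rule extensionalityI[of _ "Ob C"])
       (auto intro!: cmp_plus_right dest: additive_functorD(1) natural_transformationD(1))
    done
qed

text \<open>Biproducts of the values are chosen object by object. The diagonal matrix
  \<open>i F(f) p + j G(f) q\<close> turns the choices into a functor and makes the inclusions and
  projections natural.\<close>

lemma functor_category_biproduct:
  assumes bip: "\<And>U V. \<lbrakk>U \<in> Ob A; V \<in> Ob A\<rbrakk> \<Longrightarrow> \<exists>W iU iV pU pV. W \<in> Ob A \<and> is_biproduct A U V W iU iV pU pV"
    and F: "F \<in> Ob (additive_functor_category C A)" and G: "G \<in> Ob (additive_functor_category C A)"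
  shows "\<exists>H iF iG pF pG. H \<in> Ob (additive_functor_category C A) \<and>
    is_biproduct (additive_functor_category C A) F G H iF iG pF pG"
proof -
  note F = additive_functorD[OF F[unfolded functor_category_simps mem_Collect_eq]]
  note G = additive_functorD[OF G[unfolded functor_category_simps mem_Collect_eq]]
  have "\<forall>X \<in> Ob C. \<exists>W iU iV pU pV. W \<in> Ob A \<and> is_biproduct A (on_ob F X) (on_ob G X) W iU iV pU pV"
    using bip F(1) G(1) by blast
  then obtain W i j p q where W: "\<And>X. X \<in> Ob C \<Longrightarrow> W X \<in> Ob A"
    and bi: "\<And>X. X \<in> Ob C \<Longrightarrow> is_biproduct A (on_ob F X) (on_ob G X) (W X) (i X) (j X) (p X) (q X)"
    by metis
  note bh = biproductD(1-4)[OF bi]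
  define H where "H = \<lparr>on_ob = W, on_hom = (\<lambda>X Y f. Plus A (W X) (W Y)
    (Cmp A (W X) (on_ob F Y) (W Y) (i Y) (Cmp A (W X) (on_ob F X) (on_ob F Y) (on_hom F X Y f) (p X)))
    (Cmp A (W X) (on_ob G Y) (W Y) (j Y) (Cmp A (W X) (on_ob G X) (on_ob G Y) (on_hom G X Y f) (q X))))\<rparr>"
  have HO: "on_ob H = W" and HM: "\<And>X Y f. on_hom H X Y f = Plus A (W X) (W Y)
    (Cmp A (W X) (on_ob F Y) (W Y) (i Y) (Cmp A (W X) (on_ob F X) (on_ob F Y) (on_hom F X Y f) (p X)))
    (Cmp A (W X) (on_ob G Y) (W Y) (j Y) (Cmp A (W X) (on_ob G X) (on_ob G Y) (on_hom G X Y f) (q X)))"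
    by (simp_all add: H_def)
  have H: "additive_functor C A H"
    unfolding additive_functor_def is_functor_def HO HM
    using W F G bh biproductD(9)[OF bi]
    by (simp add: cmp_plus_left cmp_plus_right cmp_assoc biproduct_cmp[OF bi] plus_assoc plus_lcomm)
  have "natural_transformation C A F H (restrict i (Ob C))" "natural_transformation C A G H (restrict j (Ob C))"
    "natural_transformation C A H F (restrict p (Ob C))" "natural_transformation C A H G (restrict q (Ob C))"
    unfolding natural_transformation_def HO HM using W F(1,2) G(1,2) bh
    by (simp_all add: cmp_plus_left cmp_plus_right cmp_assoc biproduct_cmp[OF bi] biproductD[OF bi])
  then have "is_biproduct (additive_functor_category C A) F G H (restrict i (Ob C)) (restrict j (Ob C))
     (restrict p (Ob C)) (restrict q (Ob C))"
    unfolding is_biproduct_def functor_category_simps HO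
    using biproductD(5-9)[OF bi] by (auto simp: fun_eq_iff)
  then show ?thesis using H unfolding functor_category_simps by blast
qed

end

section \<open>Smallness\<close>

lemma infinite_times_eqpoll: "infinite A \<Longrightarrow> A \<times> A \<approx> A"
  by (simp add: eqpoll_iff_card_of_ordIso card_of_Times_same_infinite)

lemma lepoll_total: "A \<lesssim> B \<or> B \<lesssim> A"
  unfolding lepoll_def card_of_ordLeq by (rule ordLeq_total[OF card_of_Well_order card_of_Well_order])

text \<open>If the factors are not both finite, the larger one is infinite and equipollent to its
  square, which bounds the product.\<close>

lemma times_lesspoll:
  assumes C: "infinite C" and A: "A \<prec> C" and B: "B \<prec> C"
  shows "A \<times> B \<prec> C"
proof (cases "finite A \<and> finite B")
  case True
  then show ?thesis using C by (auto intro: finite_lesspoll_infinite)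
next
  case False
  have *: "A' \<lesssim> B' \<Longrightarrow> B' \<prec> C \<Longrightarrow> infinite A' \<or> infinite B' \<Longrightarrow> A' \<times> B' \<prec> C" for A' :: "'z set" and B' :: "'w set"
  proof -
    assume le: "A' \<lesssim> B'" and B': "B' \<prec> C" and "infinite A' \<or> infinite B'"
    then have "infinite B'" using lepoll_iff_finite_card by (metis finite_surj lepoll_iff)
    then have "B' \<times> B' \<approx> B'" by (rule infinite_times_eqpoll)
    moreover have "A' \<times> B' \<lesssim> B' \<times> B'" using le by (intro times_lepoll_mono lepoll_refl)
    ultimately show "A' \<times> B' \<prec> C" using B' by (meson eq_lesspoll_trans lesspoll_trans1)
  qed
  show ?thesis
  proof (cases "A \<lesssim> B")
    case True
    then show ?thesis using * B False by blast
  next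
    case False
    then have "B \<times> A \<prec> C" using * A lepoll_total \<open>\<not> (finite A \<and> finite B)\<close> by blast
    then show ?thesis using times_commute_eqpoll eq_lesspoll_trans by blast
  qed
qed

lemma PiE_lessThan_lesspoll:
  assumes C: "infinite C" and A: "A \<prec> C"
  shows "(\<Pi>\<^sub>E i \<in> {..<n::nat}. A) \<prec> C"
proof (induction n)
  case 0
  then show ?case using C by (simp add: finite_lesspoll_infinite)
next
  case (Suc n)
  have "(\<Pi>\<^sub>E i \<in> {..<Suc n}. A) \<lesssim> A \<times> (\<Pi>\<^sub>E i \<in> {..<n}. A)"
    unfolding lessThan_Suc PiE_insert_eq by (rule image_lepoll)
  then show ?case using times_lesspoll[OF C A Suc] lesspoll_trans1 by blast
qed

text \<open>Replaces a set of another type, such as a set of homomorphisms, by a small copy in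
  \<open>'u\<close> that can carry an object of \<open>Ab_cat\<close>.\<close>

lemma small_image_exists:
  fixes A :: "'a set"
  assumes "A \<prec> (UNIV :: 'u set)"
  shows "\<exists>g :: 'a \<Rightarrow> 'u. inj_on g A \<and> small (g ` A)"
proof -
  obtain g :: "'a \<Rightarrow> 'u" where "inj_on g A" using assms unfolding lesspoll_def lepoll_def by blast
  moreover have "g ` A \<lesssim> A" by (rule image_lepoll)
  ultimately show ?thesis unfolding small_def using assms lesspoll_trans1 by blast
qed

section \<open>Counting homomorphisms out of finitely generated modules\<close>

lemma rmod_homD:
  assumes "f \<in> rmod_hom R M N"
  shows "x \<in> carrier M \<Longrightarrow> f x \<in> carrier N"
    and "x \<in> carrier M \<Longrightarrow> y \<in> carrier M \<Longrightarrow> f (x \<oplus>\<^bsub>M\<^esub> y) = f x \<oplus>\<^bsub>N\<^esub> f y"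
    and "a \<in> carrier R \<Longrightarrow> x \<in> carrier M \<Longrightarrow> f (a \<odot>\<^bsub>M\<^esub> x) = a \<odot>\<^bsub>N\<^esub> f x"
    and "f \<in> extensional (carrier M)"
  using assms unfolding rmod_hom_def hom_def by auto

lemma free_rmod_simps [simp]:
  "carrier (free_rmod R n) = (\<Pi>\<^sub>E i \<in> {..<n}. carrier R)"
  "zero (free_rmod R n) = (\<lambda>i \<in> {..<n}. \<zero>\<^bsub>R\<^esub>)"
  "x \<oplus>\<^bsub>free_rmod R n\<^esub> y = (\<lambda>i \<in> {..<n}. x i \<oplus>\<^bsub>R\<^esub> y i)"
  "a \<odot>\<^bsub>free_rmod R n\<^esub> x = (\<lambda>i \<in> {..<n}. x i \<otimes>\<^bsub>R\<^esub> a)"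
  by (simp_all add: free_rmod_def)

text \<open>Induction on a bound for the nonzero coordinates, splitting off the last one as a
  multiple of a basis vector. Stated for functions that are linear on the carrier, so that it
  applies to composites without making them extensional.\<close>

lemma free_rmod_hom_eq:
  fixes R (structure)
  assumes R: "ring R" and M: "right_module R M"
    and g: "\<And>x. x \<in> carrier (free_rmod R n) \<Longrightarrow> g x \<in> carrier M \<and> g' x \<in> carrier M"
    and add: "\<And>x y. x \<in> carrier (free_rmod R n) \<Longrightarrow> y \<in> carrier (free_rmod R n) \<Longrightarrow>
      g (x \<oplus>\<^bsub>free_rmod R n\<^esub> y) = g x \<oplus>\<^bsub>M\<^esub> g y \<and> g' (x \<oplus>\<^bsub>free_rmod R n\<^esub> y) = g' x \<oplus>\<^bsub>M\<^esub> g' y"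
    and smult: "\<And>a x. a \<in> carrier R \<Longrightarrow> x \<in> carrier (free_rmod R n) \<Longrightarrow>
      g (a \<odot>\<^bsub>free_rmod R n\<^esub> x) = a \<odot>\<^bsub>M\<^esub> g x \<and> g' (a \<odot>\<^bsub>free_rmod R n\<^esub> x) = a \<odot>\<^bsub>M\<^esub> g' x"
    and basis: "\<And>i. i < n \<Longrightarrow> g (\<lambda>j \<in> {..<n}. if j = i then \<one> else \<zero>) = g' (\<lambda>j \<in> {..<n}. if j = i then \<one> else \<zero>)"
    and x: "x \<in> carrier (free_rmod R n)"
  shows "g x = g' x"
proof -
  interpret R: ring R by (rule R)
  interpret M: right_module R M by (rule M)
  let ?F = "free_rmod R n"
  have zero: "zero ?F \<in> carrier ?F" "zero ?F \<oplus>\<^bsub>?F\<^esub> zero ?F = zero ?F" by auto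
  have z: "g (zero ?F) = \<zero>\<^bsub>M\<^esub>" "g' (zero ?F) = \<zero>\<^bsub>M\<^esub>"
    using add[OF zero(1) zero(1)] g[OF zero(1)] unfolding zero(2) by (metis M.M.add.l_cancel_one')+
  have "\<forall>i. k \<le> i \<and> i < n \<longrightarrow> x i = \<zero> \<Longrightarrow> x \<in> carrier ?F \<Longrightarrow> g x = g' x" for k x
  proof (induction k arbitrary: x)
    case 0
    then have "x = zero ?F" by (auto simp: PiE_def extensional_def fun_eq_iff)
    then show ?case using z by (simp only:)
  next
    case (Suc k)
    show ?case
    proof (cases "k < n")
      case False
      then show ?thesis using Suc by simp
    next
      case True
      \<comment> \<open>Erase coordinate \<open>k\<close>; then \<open>x\<close> is \<open>y\<close>
        plus the basis vector at \<open>k\<close> scaled by \<open>x k\<close>.\<close>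
      define y where "y = (\<lambda>i \<in> {..<n}. if i = k then \<zero> else x i)"
      let ?e = "\<lambda>j \<in> {..<n}. if j = k then \<one> else \<zero>"
      have xi: "x i \<in> carrier R" if "i < n" for i
        using PiE_mem[of x "{..<n}" "\<lambda>_. carrier R" i] Suc(3) that by simp
      have y: "y \<in> carrier ?F" and e: "?e \<in> carrier ?F"
        using xi by (simp_all add: y_def restrict_PiE_iff)
      have ae: "x k \<odot>\<^bsub>?F\<^esub> ?e \<in> carrier ?F" using xi[OF True] by (simp add: restrict_PiE_iff)
      have "y i \<oplus> (x k \<odot>\<^bsub>?F\<^esub> ?e) i = x i" if "i < n" for i
        using that xi[OF that] xi[OF True] by (simp add: y_def)
      then have x: "x = y \<oplus>\<^bsub>?F\<^esub> (x k \<odot>\<^bsub>?F\<^esub> ?e)"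
        using Suc(3) by (intro extensionalityI[of _ "{..<n}"]) (auto simp: PiE_def)
      have "\<forall>i. k \<le> i \<and> i < n \<longrightarrow> y i = \<zero>" using Suc(2) by (auto simp: y_def)
      then have "g y = g' y" using y by (rule Suc(1))
      then have "g (y \<oplus>\<^bsub>?F\<^esub> (x k \<odot>\<^bsub>?F\<^esub> ?e)) = g' (y \<oplus>\<^bsub>?F\<^esub> (x k \<odot>\<^bsub>?F\<^esub> ?e))"
        using add[OF y ae] smult[OF xi[OF True] e] basis[OF True] by (simp only:)
      then show ?thesis unfolding x[symmetric] .
    qed
  qed
  moreover have "\<forall>i. n \<le> i \<and> i < n \<longrightarrow> x i = \<zero>" by (meson leD)
  ultimately show ?thesis using x by blast
qed

text \<open>A homomorphism is determined by its values on the \<open>n\<close> generators, so the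
  set of homomorphisms embeds into \<open>n\<close>-tuples from \<open>M\<close>.\<close>

lemma rmod_hom_lesspoll:
  fixes C :: "'c set"
  assumes C: "infinite C" and R: "ring R" and M: "right_module R M" "carrier M \<prec> C"
    and P: "finitely_generated R P"
  shows "rmod_hom R P M \<prec> C"
proof -
  interpret R: ring R by (rule R)
  obtain n \<psi> where \<psi>: "\<psi> \<in> rmod_hom R (free_rmod R n) P" and surj: "\<psi> ` carrier (free_rmod R n) = carrier P"
    using P unfolding finitely_generated_def by blast
  let ?e = "\<lambda>i. \<lambda>j \<in> {..<n}. if j = i then \<one>\<^bsub>R\<^esub> else \<zero>\<^bsub>R\<^esub>"
  let ?r = "\<lambda>f. \<lambda>i \<in> {..<n}. f (\<psi> (?e i))"
  have e: "?e i \<in> carrier (free_rmod R n)" for i by auto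
  note \<psi>D = rmod_homD[OF \<psi>]
  have "inj_on ?r (rmod_hom R P M)"
  proof (rule inj_onI)
    fix f f' assume f: "f \<in> rmod_hom R P M" and f': "f' \<in> rmod_hom R P M" and eq: "?r f = ?r f'"
    have basis: "f (\<psi> (?e i)) = f' (\<psi> (?e i))" if "i < n" for i
      using fun_cong[OF eq, of i] that by simp
    have "f (\<psi> x) = f' (\<psi> x)" if "x \<in> carrier (free_rmod R n)" for x
      by (rule free_rmod_hom_eq[OF R M(1), where g = "\<lambda>x. f (\<psi> x)" and g' = "\<lambda>x. f' (\<psi> x)", OF _ _ _ basis that])
         (simp_all only: \<psi>D rmod_homD[OF f] rmod_homD[OF f'] simp_thms)
    then have "f x = f' x" if "x \<in> carrier P" for x using that surj by (metis imageE)
    then show "f = f'" using rmod_homD(4)[OF f] rmod_homD(4)[OF f'] by (rule extensionalityI[rotated 2])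
  qed
  moreover have "?r ` rmod_hom R P M \<subseteq> (\<Pi>\<^sub>E i \<in> {..<n}. carrier M)"
    using \<psi>D(1)[OF e] by (simp add: image_subset_iff restrict_PiE_iff rmod_homD(1))
  ultimately have "rmod_hom R P M \<lesssim> (\<Pi>\<^sub>E i \<in> {..<n}. carrier M)" unfolding lepoll_def by blast
  then show ?thesis using PiE_lessThan_lesspoll[OF C M(2)] lesspoll_trans1 by blast
qed

lemma finitely_presented_generated: "finitely_presented R P \<Longrightarrow> finitely_generated R P"
  unfolding finitely_presented_def finitely_generated_def by blast

section \<open>Direct sums of abelian groups\<close>

text \<open>Pairs have to be elements of \<open>'u\<close> again: an infinite universe admits a
  bijection with its square, and the product group is moved along it.\<close>

lemma Ab_cat_biproduct:
  fixes G H :: "'u monoid"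
  assumes U: "infinite (UNIV :: 'u set)" and G: "G \<in> Ob Ab_cat" and H: "H \<in> Ob Ab_cat"
  shows "\<exists>W iG iH pG pH. W \<in> Ob Ab_cat \<and> is_biproduct Ab_cat G H W iG iH pG pH"
proof -
  interpret G: comm_group G using G by (simp add: Ob_Ab_cat)
  interpret H: comm_group H using H by (simp add: Ob_Ab_cat)
  have "(UNIV :: 'u set) \<times> (UNIV :: 'u set) \<approx> (UNIV :: 'u set)" using U by (rule infinite_times_eqpoll)
  then obtain c :: "'u \<times> 'u \<Rightarrow> 'u" where c: "bij c" unfolding eqpoll_def by auto
  define d where "d = inv_into UNIV c"
  have dc [simp]: "d (c x) = x" for x unfolding d_def using c by (simp add: bij_is_inj)
  define W where "W = \<lparr>carrier = c ` (carrier G \<times> carrier H),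
    mult = (\<lambda>x y. c (fst (d x) \<otimes>\<^bsub>G\<^esub> fst (d y), snd (d x) \<otimes>\<^bsub>H\<^esub> snd (d y))), one = c (\<one>\<^bsub>G\<^esub>, \<one>\<^bsub>H\<^esub>)\<rparr>"
  have W: "carrier W = c ` (carrier G \<times> carrier H)"
    "x \<otimes>\<^bsub>W\<^esub> y = c (fst (d x) \<otimes>\<^bsub>G\<^esub> fst (d y), snd (d x) \<otimes>\<^bsub>H\<^esub> snd (d y))" "\<one>\<^bsub>W\<^esub> = c (\<one>\<^bsub>G\<^esub>, \<one>\<^bsub>H\<^esub>)" for x y
    by (simp_all add: W_def)
  have "comm_group W"
  proof (rule comm_groupI)
    fix x assume "x \<in> carrier W"
    then obtain a b where x: "x = c (a, b)" "a \<in> carrier G" "b \<in> carrier H" by (auto simp: W)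
    then show "\<exists>y \<in> carrier W. y \<otimes>\<^bsub>W\<^esub> x = \<one>\<^bsub>W\<^esub>"
      by (intro bexI[of _ "c (inv\<^bsub>G\<^esub> a, inv\<^bsub>H\<^esub> b)"]) (auto simp: W)
  qed (auto simp: W G.m_ac H.m_ac)
  moreover have "small (carrier W)"
  proof -
    have "carrier G \<times> carrier H \<prec> (UNIV :: 'u set)"
      using G H U by (intro times_lesspoll) (auto simp: Ob_Ab_cat small_def)
    then show ?thesis unfolding W small_def using image_lepoll lesspoll_trans1 by blast
  qed
  ultimately have "W \<in> Ob Ab_cat" by (simp add: Ob_Ab_cat)
  moreover have "is_biproduct Ab_cat G H W (\<lambda>x \<in> carrier G. c (x, \<one>\<^bsub>H\<^esub>)) (\<lambda>y \<in> carrier H. c (\<one>\<^bsub>G\<^esub>, y))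
     (\<lambda>z \<in> carrier W. fst (d z)) (\<lambda>z \<in> carrier W. snd (d z))"
    unfolding is_biproduct_def by (auto simp: Hom_Ab_cat hom_def W compose_def fun_eq_iff)
  ultimately show ?thesis by blast
qed

section \<open>The Yoneda embedding\<close>

text \<open>Morphism sets are encoded in the universe \<open>'u\<close> by an arbitrarily chosen injection.\<close>

definition hom_code :: "('o, 'm) preadditive \<Rightarrow> 'o \<Rightarrow> 'o \<Rightarrow> 'm \<Rightarrow> 'u" where
  "hom_code A X Y = (SOME g. inj_on g (Hom A X Y) \<and> small (g ` Hom A X Y))"

definition hom_decode :: "('o, 'm) preadditive \<Rightarrow> 'o \<Rightarrow> 'o \<Rightarrow> 'u \<Rightarrow> 'm" where
  "hom_decode A X Y = inv_into (Hom A X Y) (hom_code A X Y)"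

definition hom_group :: "('o, 'm) preadditive \<Rightarrow> 'o \<Rightarrow> 'o \<Rightarrow> 'u monoid" where
  "hom_group A X Y = \<lparr>carrier = hom_code A X Y ` Hom A X Y,
     mult = (\<lambda>a b. hom_code A X Y (Plus A X Y (hom_decode A X Y a) (hom_decode A X Y b))),
     one = hom_code A X Y (Zero A X Y)\<rparr>"

definition hom_functor :: "('o, 'm) preadditive \<Rightarrow> 'o \<Rightarrow> ('o, 'm, 'u monoid, 'u \<Rightarrow> 'u) cfunctor" where
  "hom_functor A M = \<lparr>on_ob = (\<lambda>X. hom_group A X M),
     on_hom = (\<lambda>X Y f. \<lambda>a \<in> carrier (hom_group A X M). hom_code A Y M (Cmp A Y X M (hom_decode A X M a) f))\<rparr>"

text \<open>The represented object ranges over all of \<open>A\<close>, while \<open>P\<close>,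
  later finite presentation, cuts down the objects at which transformations have components.\<close>

definition yoneda :: "('o, 'm) preadditive \<Rightarrow> ('o \<Rightarrow> bool) \<Rightarrow>
    ('o, 'm, ('o, 'm, 'u monoid, 'u \<Rightarrow> 'u) cfunctor, 'o \<Rightarrow> 'u \<Rightarrow> 'u) cfunctor" where
  "yoneda A P = \<lparr>on_ob = hom_functor A,
     on_hom = (\<lambda>M N g. \<lambda>X \<in> {X \<in> Ob A. P X}. \<lambda>a \<in> carrier (hom_group A X M).
       hom_code A X N (Cmp A X M N g (hom_decode A X M a)))\<rparr>"

lemma opposite_simps [simp]:
  "Ob (opposite C) = Ob C" "Hom (opposite C) X Y = Hom C Y X" "Idm (opposite C) = Idm C"
  "Cmp (opposite C) X Y Z g f = Cmp C Z Y X f g" "Plus (opposite C) X Y f g = Plus C Y X f g"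
  by (simp_all add: opposite_def)

lemma full_subcategory_simps [simp]:
  fixes C :: "('o, 'm) preadditive"
  shows "Ob (full_subcategory C P) = {X \<in> Ob C. P X}" "Hom (full_subcategory C P) = Hom C"
  "Idm (full_subcategory C P) = Idm C" "Cmp (full_subcategory C P) = Cmp C" "Plus (full_subcategory C P) = Plus C"
  by (simp_all add: full_subcategory_def)

text \<open>The parameter \<open>U\<close> brings the universe type \<open>'u\<close> into the
  locale: codes have this type, but it does not occur in the types of \<open>A\<close> and
  \<open>P\<close>.\<close>

locale small_homs = preadditive_laws A for A :: "('o, 'm) preadditive" +
  fixes P :: "'o \<Rightarrow> bool" and U :: "'u set"
  assumes U: "U = UNIV"
    and small_hom: "\<lbrakk>X \<in> Ob A; P X; M \<in> Ob A\<rbrakk> \<Longrightarrow> Hom A X M \<prec> U"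
begin

context
  fixes X M assumes X: "X \<in> Ob A" "P X" and M: "M \<in> Ob A"
begin

lemma hom_code: "inj_on (hom_code A X M :: 'm \<Rightarrow> 'u) (Hom A X M)" "small ((hom_code A X M :: 'm \<Rightarrow> 'u) ` Hom A X M)"
  using someI_ex[OF small_image_exists[OF small_hom[OF X M, unfolded U]]] unfolding hom_code_def by auto

lemma hom_decode_code [simp]: "f \<in> Hom A X M \<Longrightarrow> hom_decode A X M (hom_code A X M f :: 'u) = f"
  unfolding hom_decode_def using hom_code(1) by (rule inv_into_f_f)

lemma carrier_hom_group: "carrier (hom_group A X M) = (hom_code A X M :: 'm \<Rightarrow> 'u) ` Hom A X M"
  by (simp add: hom_group_def)

lemma code_closed [simp]: "f \<in> Hom A X M \<Longrightarrow> (hom_code A X M f :: 'u) \<in> carrier (hom_group A X M)"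
  by (simp add: hom_group_def)

lemma mult_hom_group [simp]: "f \<in> Hom A X M \<Longrightarrow> g \<in> Hom A X M \<Longrightarrow>
  hom_code A X M f \<otimes>\<^bsub>hom_group A X M\<^esub> hom_code A X M g = (hom_code A X M (Plus A X M f g) :: 'u)"
  by (simp add: hom_group_def)

lemma hom_group_Ob: "(hom_group A X M :: 'u monoid) \<in> Ob Ab_cat"
proof -
  have "comm_group (hom_group A X M :: 'u monoid)"
  proof (rule comm_groupI)
    show "\<exists>y \<in> carrier (hom_group A X M). y \<otimes>\<^bsub>hom_group A X M\<^esub> x = \<one>\<^bsub>hom_group A X M\<^esub>"
      if "x \<in> carrier (hom_group A X M)" for x :: 'u
    proof -
      obtain f where f: "f \<in> Hom A X M" "x = hom_code A X M f" using \<open>x \<in> _\<close> by (auto simp: carrier_hom_group)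
      then show ?thesis using X M
        by (intro bexI[of _ "hom_code A X M (Neg A X M f)"]) (simp, simp add: hom_group_def, simp)
    qed
  qed (use X M in \<open>auto simp: carrier_hom_group plus_assoc plus_comm plus_lcomm, auto simp: hom_group_def\<close>)
  then show ?thesis using hom_code(2) by (simp add: Ob_Ab_cat carrier_hom_group)
qed

text \<open>Every element of the coded group is the code of a morphism. Maps out of it are therefore
  constructed, and by the next lemma compared, on codes alone.\<close>

lemma hom_group_HomI:
  fixes h :: "'u \<Rightarrow> 'u"
  assumes "h \<in> extensional (carrier (hom_group A X M))"
    and "\<And>x. x \<in> Hom A X M \<Longrightarrow> h (hom_code A X M x) \<in> carrier G"
    and "\<And>x y. x \<in> Hom A X M \<Longrightarrow> y \<in> Hom A X M \<Longrightarrow>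
      h (hom_code A X M (Plus A X M x y)) = h (hom_code A X M x) \<otimes>\<^bsub>G\<^esub> h (hom_code A X M y)"
  shows "h \<in> Hom Ab_cat (hom_group A X M) G"
  unfolding Hom_Ab_cat hom_def using assms by (auto simp: carrier_hom_group)

lemma hom_group_ext:
  fixes h h' :: "'u \<Rightarrow> 'b"
  assumes "h \<in> extensional (carrier (hom_group A X M))" "h' \<in> extensional (carrier (hom_group A X M))"
    and "\<And>x. x \<in> Hom A X M \<Longrightarrow> h (hom_code A X M x) = h' (hom_code A X M x)"
  shows "h = h'"
  by (rule extensionalityI[OF assms(1,2)]) (auto simp: carrier_hom_group assms(3))

end

lemma on_hom_hom_functor [simp]:
  "\<lbrakk>X \<in> Ob A; P X; M \<in> Ob A; x \<in> Hom A X M\<rbrakk> \<Longrightarrow>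
    on_hom (hom_functor A M) X Y f (hom_code A X M x :: 'u) = hom_code A Y M (Cmp A Y X M x f)"
  by (simp add: hom_functor_def)

lemma on_hom_hom_functor_extensional [simp]:
  "on_hom (hom_functor A M) X Y f \<in> extensional (carrier (hom_group A X M))"
  by (simp add: hom_functor_def)

lemma on_ob_hom_functor [simp]: "on_ob (hom_functor A M) X = hom_group A X M"
  by (simp add: hom_functor_def)

lemma on_hom_hom_functor_closed [simp]:
  "\<lbrakk>X \<in> Ob A; P X; Y \<in> Ob A; P Y; M \<in> Ob A; f \<in> Hom A Y X\<rbrakk> \<Longrightarrow>
     (on_hom (hom_functor A M) X Y f :: 'u \<Rightarrow> 'u) \<in> Hom Ab_cat (hom_group A X M) (hom_group A Y M)"
  by (intro hom_group_HomI) (simp_all add: cmp_plus_left)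

lemma hom_functor_additive:
  assumes M: "M \<in> Ob A"
  shows "additive_functor (opposite (full_subcategory A P)) Ab_cat (hom_functor A M :: ('o, 'm, 'u monoid, 'u \<Rightarrow> 'u) cfunctor)"
  unfolding additive_functor_def is_functor_def
proof (intro conjI ballI, goal_cases)
  case (3 X)
  then show ?case using M by (intro hom_group_ext[of X M]) auto
next
  case (4 X Y Z f g)
  then show ?case using M by (intro hom_group_ext[of X M]) (auto simp: compose_def cmp_assoc)
next
  case (5 X Y f g)
  then show ?case using M by (intro hom_group_ext[of X M]) (auto simp: cmp_plus_right)
qed (use M in \<open>auto simp: hom_group_Ob\<close>)

lemma on_hom_yoneda [simp]:
  "\<lbrakk>X \<in> Ob A; P X; M \<in> Ob A; x \<in> Hom A X M\<rbrakk> \<Longrightarrow>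
    on_hom (yoneda A P) M N g X (hom_code A X M x :: 'u) = hom_code A X N (Cmp A X M N g x)"
  by (simp add: yoneda_def)

lemma on_hom_yoneda_extensional [simp]:
  "on_hom (yoneda A P) M N g \<in> extensional {X \<in> Ob A. P X}"
  "X \<in> Ob A \<Longrightarrow> P X \<Longrightarrow> on_hom (yoneda A P) M N g X \<in> extensional (carrier (hom_group A X M))"
  by (simp_all add: yoneda_def)

lemma on_ob_yoneda [simp]: "on_ob (yoneda A P) M = hom_functor A M"
  by (simp add: yoneda_def)

lemma on_hom_yoneda_closed [simp]:
  "\<lbrakk>X \<in> Ob A; P X; M \<in> Ob A; N \<in> Ob A; g \<in> Hom A M N\<rbrakk> \<Longrightarrow>
     (on_hom (yoneda A P) M N g X :: 'u \<Rightarrow> 'u) \<in> Hom Ab_cat (hom_group A X M) (hom_group A X N)"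
  by (intro hom_group_HomI) (simp_all add: cmp_plus_right)

lemma yoneda_additive:
  "additive_functor A (additive_functor_category (opposite (full_subcategory A P)) Ab_cat)
     (yoneda A P :: ('o, 'm, ('o, 'm, 'u monoid, 'u \<Rightarrow> 'u) cfunctor, 'o \<Rightarrow> 'u \<Rightarrow> 'u) cfunctor)"
proof -
  \<comment> \<open>Transformations are extensional twice, in the object and in the group element;
    this reduces their equality to values on codes.\<close>
  have ext: "\<alpha> = \<beta>" if "\<alpha> \<in> extensional {X \<in> Ob A. P X}" "\<beta> \<in> extensional {X \<in> Ob A. P X}" and M: "M \<in> Ob A"
      and e: "\<And>X. X \<in> Ob A \<Longrightarrow> P X \<Longrightarrow> \<alpha> X \<in> extensional (carrier (hom_group A X M)) \<and> \<beta> X \<in> extensional (carrier (hom_group A X M))"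
      and eq: "\<And>X x. X \<in> Ob A \<Longrightarrow> P X \<Longrightarrow> x \<in> Hom A X M \<Longrightarrow> \<alpha> X (hom_code A X M x) = \<beta> X (hom_code A X M x)"
    for \<alpha> \<beta> :: "'o \<Rightarrow> 'u \<Rightarrow> 'u" and M
  proof (rule extensionalityI[OF that(1,2)])
    show "\<alpha> X = \<beta> X" if "X \<in> {X \<in> Ob A. P X}" for X
      using that M e eq by (intro hom_group_ext[of X M]) auto
  qed
  show ?thesis unfolding additive_functor_def[of A] is_functor_def[of A] functor_category_simps
  proof (intro conjI ballI, goal_cases)
    case (2 M N g)
    have "natural_transformation (opposite (full_subcategory A P)) Ab_cat (hom_functor A M) (hom_functor A N)
      (on_hom (yoneda A P) M N g :: 'o \<Rightarrow> 'u \<Rightarrow> 'u)"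
      unfolding natural_transformation_def
    proof (intro conjI ballI, goal_cases)
      case (2 X Y f)
      with \<open>M \<in> _\<close> \<open>N \<in> _\<close> \<open>g \<in> _\<close> show ?case
        by (intro hom_group_ext[of X M]) (auto simp: compose_def cmp_assoc)
    qed (use 2 in auto)
    then show ?case by simp
  next
    case (3 M)
    then show ?case by (intro ext[of _ _ M]) auto
  next
    case (4 L M N f g)
    then show ?case by (intro ext[of _ _ L]) (auto simp: cmp_assoc compose_def)
  next
    case (5 M N f g)
    then show ?case by (intro ext[of _ _ M]) (auto simp: cmp_plus_left)
  qed (simp add: hom_functor_additive)
qed

end

type_synonym 'u fp_functor = "(('u, 'u) module, 'u \<Rightarrow> 'u, 'u monoid, 'u \<Rightarrow> 'u) cfunctor"

section \<open>The regular module\<close>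

lemma regular_rmod_simps [simp]:
  "carrier (regular_rmod R) = carrier R" "add (regular_rmod R) = add R" "zero (regular_rmod R) = zero R"
  "a \<odot>\<^bsub>regular_rmod R\<^esub> x = x \<otimes>\<^bsub>R\<^esub> a"
  by (simp_all add: regular_rmod_def)

lemma regular_rmod_right_module: "ring R \<Longrightarrow> right_module R (regular_rmod R)"
proof -
  assume "ring R"
  then interpret ring R .
  have "abelian_group (regular_rmod R)"
    by (intro abelian_groupI) (auto simp: a_ac intro: bexI[of _ "\<ominus>\<^bsub>R\<^esub> _"] l_neg)
  then show ?thesis unfolding right_module_def right_module_axioms_def
    by (auto simp: \<open>ring R\<close> l_distr r_distr m_assoc)
qed

text \<open>One generator and no relations: the presentation is
  \<open>R^0 -> R^1 -> R\<close>.\<close>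

lemma regular_rmod_finitely_presented:
  assumes "ring R" shows "finitely_presented R (regular_rmod R)"
proof -
  interpret ring R by fact
  let ?\<phi> = "\<lambda>x \<in> carrier (free_rmod R 0). \<lambda>i \<in> {..<1::nat}. \<zero>\<^bsub>R\<^esub>"
  let ?\<psi> = "\<lambda>x \<in> carrier (free_rmod R 1). x 0"
  have "?\<phi> \<in> rmod_hom R (free_rmod R 0) (free_rmod R 1)"
    by (auto simp: rmod_hom_def hom_def restrict_PiE_iff intro!: restrict_ext)
  moreover have "?\<psi> \<in> rmod_hom R (free_rmod R 1) (regular_rmod R)"
    by (auto simp: rmod_hom_def hom_def)
  moreover have "?\<psi> ` carrier (free_rmod R 1) = carrier (regular_rmod R)"
  proof (intro equalityI subsetI)
    fix x assume "x \<in> carrier (regular_rmod R)"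
    then show "x \<in> ?\<psi> ` carrier (free_rmod R 1)" by (intro image_eqI[of _ _ "\<lambda>i \<in> {..<1}. x"]) auto
  qed auto
  moreover have "?\<phi> ` carrier (free_rmod R 0) = a_kernel (free_rmod R 1) (regular_rmod R) ?\<psi>"
  proof (intro equalityI subsetI)
    fix x assume "x \<in> a_kernel (free_rmod R 1) (regular_rmod R) ?\<psi>"
    then have x: "x \<in> (\<Pi>\<^sub>E i \<in> {..<1}. carrier R)" "x 0 = \<zero>\<^bsub>R\<^esub>"
      by (simp_all add: a_kernel_def kernel_def split: if_splits)
    have "x = (\<lambda>i \<in> {..<1}. \<zero>\<^bsub>R\<^esub>)"
      by (rule extensionalityI[of _ "{..<1}"]) (use x in \<open>simp_all add: PiE_def\<close>)
    then show "x \<in> ?\<phi> ` carrier (free_rmod R 0)" by simp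
  next
    fix x assume "x \<in> ?\<phi> ` carrier (free_rmod R 0)"
    then have "x = (\<lambda>i \<in> {..<1}. \<zero>\<^bsub>R\<^esub>)" by simp
    then show "x \<in> a_kernel (free_rmod R 1) (regular_rmod R) ?\<psi>"
      by (simp add: a_kernel_def kernel_def restrict_PiE_iff)
  qed
  ultimately show ?thesis unfolding finitely_presented_def by blast
qed

text \<open>The unique homomorphism from the regular module that takes the value \<open>x\<close> at
  one, inverse to evaluation at one in the isomorphism of \<open>Hom(R, M)\<close> with
  \<open>M\<close>.\<close>

definition scalar_map :: "('r, 'x) ring_scheme \<Rightarrow> ('r, 'a) module \<Rightarrow> 'a \<Rightarrow> 'r \<Rightarrow> 'a" where
  "scalar_map R M x = (\<lambda>r \<in> carrier R. r \<odot>\<^bsub>M\<^esub> x)"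

lemma Cmp_Mod_cat_apply: "x \<in> carrier L \<Longrightarrow> Cmp (Mod_cat R) L M N g f x = g (f x)"
  by (simp add: Mod_cat_def compose_eq)

lemma Mod_cat_homD:
  assumes "f \<in> Hom (Mod_cat R) M N"
  shows "x \<in> carrier M \<Longrightarrow> f x \<in> carrier N"
    and "x \<in> carrier M \<Longrightarrow> y \<in> carrier M \<Longrightarrow> f (x \<oplus>\<^bsub>M\<^esub> y) = f x \<oplus>\<^bsub>N\<^esub> f y"
    and "a \<in> carrier R \<Longrightarrow> x \<in> carrier M \<Longrightarrow> f (a \<odot>\<^bsub>M\<^esub> x) = a \<odot>\<^bsub>N\<^esub> f x"
    and "f \<in> extensional (carrier M)"
  using assms rmod_homD[of f R M N] by (auto simp: Mod_cat_def)

lemma Mod_cat_homI: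
  assumes "f \<in> extensional (carrier M)" and "\<And>x. x \<in> carrier M \<Longrightarrow> f x \<in> carrier N"
    and "\<And>x y. x \<in> carrier M \<Longrightarrow> y \<in> carrier M \<Longrightarrow> f (x \<oplus>\<^bsub>M\<^esub> y) = f x \<oplus>\<^bsub>N\<^esub> f y"
    and "\<And>a x. a \<in> carrier R \<Longrightarrow> x \<in> carrier M \<Longrightarrow> f (a \<odot>\<^bsub>M\<^esub> x) = a \<odot>\<^bsub>N\<^esub> f x"
  shows "f \<in> Hom (Mod_cat R) M N"
  using assms by (auto simp: Mod_cat_def rmod_hom_def hom_def)

lemma Mod_cat_hom_zero:
  assumes "M \<in> Ob (Mod_cat R)" "N \<in> Ob (Mod_cat R)" and f: "f \<in> Hom (Mod_cat R) M N"
  shows "f \<zero>\<^bsub>M\<^esub> = \<zero>\<^bsub>N\<^esub>"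
proof -
  interpret M: right_module R M using assms by (simp add: Ob_Mod_cat)
  interpret N: right_module R N using assms by (simp add: Ob_Mod_cat)
  show ?thesis using Mod_cat_homD(1,2)[OF f, of "\<zero>\<^bsub>M\<^esub>"] by (metis M.M.zero_closed M.M.l_zero N.M.add.l_cancel_one')
qed

lemma Cmp_Ab_cat_apply: "Cmp Ab_cat G H K g f = Cmp Ab_cat G H' K g' f' \<Longrightarrow> x \<in> carrier G \<Longrightarrow> g (f x) = g' (f' x)"
  by (metis Ab_cat_simps(2) compose_eq)

section \<open>Acyclic complexes of modules\<close>

text \<open>Since the differential squares to zero, only the inclusion of cycles in boundaries
  carries content.\<close>

lemma acyclic_modules_iff:
  assumes X: "X \<in> complexes (Mod_cat R)"
  shows "acyclic_modules X \<longleftrightarrow> (\<forall>n. \<forall>x \<in> carrier (cobj X (n + 1)).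
    cdiff X (n + 1) x = \<zero>\<^bsub>cobj X (n + 2)\<^esub> \<longrightarrow> x \<in> cdiff X n ` carrier (cobj X n))"
proof -
  have "cdiff X (n + 1) (cdiff X n x) = \<zero>\<^bsub>cobj X (n + 2)\<^esub>" if "x \<in> carrier (cobj X n)" for n x
    using fun_cong[OF cdiff_cdiff(1)[OF X, of n], of x] that by (simp add: Cmp_Mod_cat_apply) (simp add: Mod_cat_def)
  moreover have "cdiff X n x \<in> carrier (cobj X (n + 1))" if "x \<in> carrier (cobj X n)" for n x
    using Mod_cat_homD(1)[OF cdiff_closed(1)[OF X]] that by blast
  moreover have "a_kernel (cobj X (n + 1)) (cobj X (n + 2)) (cdiff X (n + 1)) =
      {x \<in> carrier (cobj X (n + 1)). cdiff X (n + 1) x = \<zero>\<^bsub>cobj X (n + 2)\<^esub>}" for n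
    by (simp add: a_kernel_def kernel_def)
  ultimately show ?thesis unfolding acyclic_modules_def by blast
qed

text \<open>A cycle of \<open>Y\<close> is moved to \<open>X\<close> by the inverse, bounded there,
  and the bounding element is moved back by \<open>f\<close>.\<close>

lemma acyclic_modules_iso:
  assumes X: "X \<in> complexes (Mod_cat R)" "Y \<in> complexes (Mod_cat R)" and f: "f \<in> chain_maps (Mod_cat R) X Y"
    and iso: "\<And>n. is_iso (Mod_cat R) (cobj X n) (cobj Y n) (f n)" and ac: "acyclic_modules X"
  shows "acyclic_modules Y"
proof -
  interpret preadditive_laws "Mod_cat R" by (rule Mod_cat_laws)
  obtain g where g: "g \<in> chain_maps (Mod_cat R) Y X"
    and fg: "\<And>n. Cmp (Mod_cat R) (cobj Y n) (cobj X n) (cobj Y n) (f n) (g n) = Idm (Mod_cat R) (cobj Y n)"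
    using chain_map_inverse[OF X f iso] by metis
  have fg': "f n (g n y) = y" if "y \<in> carrier (cobj Y n)" for n y
    using fun_cong[OF fg[of n], of y] that by (simp add: Cmp_Mod_cat_apply) (simp add: Mod_cat_def)
  have comm: "cdiff W n (h n x) = h (n + 1) (cdiff V n x)"
    if "h \<in> chain_maps (Mod_cat R) V W" "x \<in> carrier (cobj V n)" for h V W n x
    using fun_cong[OF chain_map_comm(1)[OF that(1), of n], of x] that(2) by (simp add: Cmp_Mod_cat_apply)
  note closed = Mod_cat_homD(1)[OF chain_map_closed[OF g]] Mod_cat_homD(1)[OF chain_map_closed[OF f]]
  show ?thesis unfolding acyclic_modules_iff[OF X(2)]
  proof (intro allI ballI impI)
    fix n y assume y: "y \<in> carrier (cobj Y (n + 1))" "cdiff Y (n + 1) y = \<zero>\<^bsub>cobj Y (n + 2)\<^esub>"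
    have "cdiff X (n + 1) (g (n + 1) y) = g (n + 2) (cdiff Y (n + 1) y)"
      using comm[OF g y(1)] by (simp add: add.assoc)
    also have "\<dots> = \<zero>\<^bsub>cobj X (n + 2)\<^esub>"
      unfolding y(2) by (rule Mod_cat_hom_zero[where R = R]) (use X g in auto)
    finally obtain x where x: "x \<in> carrier (cobj X n)" "g (n + 1) y = cdiff X n x"
      using ac closed(1)[OF y(1)] unfolding acyclic_modules_iff[OF X(1)] by blast
    have "y = f (n + 1) (cdiff X n x)" using fg'[OF y(1)] x(2) by simp
    also have "\<dots> = cdiff Y n (f n x)" using comm[OF f x(1)] by simp
    finally show "y \<in> cdiff Y n ` carrier (cobj Y n)" using closed(2)[OF x(1)] by blast
  qed
qed

text \<open>Evaluate \<open>id = d s + s d\<close> at a cycle \<open>x\<close>: the second term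
  vanishes and \<open>x = d (s x)\<close>.\<close>

lemma acyclic_modules_contractible:
  assumes C: "C \<in> complexes (Mod_cat R)"
    and s: "\<And>n. s n \<in> Hom (Mod_cat R) (cobj C n) (cobj C (n - 1))"
    and b: "\<And>n. homotopy_boundary (Mod_cat R) C C s n = Idm (Mod_cat R) (cobj C n)"
  shows "acyclic_modules C"
  unfolding acyclic_modules_iff[OF C]
proof (intro allI ballI impI)
  fix n x assume x: "x \<in> carrier (cobj C (n + 1))" "cdiff C (n + 1) x = \<zero>\<^bsub>cobj C (n + 2)\<^esub>"
  interpret M: right_module R "cobj C (n + 1)" using complex_ob[OF C] by (simp add: Ob_Mod_cat)
  have s1: "s (n + 1) \<in> Hom (Mod_cat R) (cobj C (n + 1)) (cobj C n)"
    and s2: "s (n + 2) \<in> Hom (Mod_cat R) (cobj C (n + 2)) (cobj C (n + 1))"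
    using s[of "n + 1"] s[of "n + 2"] by (simp_all add: add.commute)
  have sx: "s (n + 1) x \<in> carrier (cobj C n)" using Mod_cat_homD(1)[OF s1 x(1)] .
  have dsx: "cdiff C n (s (n + 1) x) \<in> carrier (cobj C (n + 1))"
    using Mod_cat_homD(1)[OF cdiff_closed(1)[OF C] sx] .
  have "x = Idm (Mod_cat R) (cobj C (n + 1)) x" using x(1) by (simp add: Mod_cat_def)
  also have "\<dots> = cdiff C n (s (n + 1) x) \<oplus>\<^bsub>cobj C (n + 1)\<^esub> s (n + 2) (cdiff C (n + 1) x)"
    unfolding b[symmetric] homotopy_boundary_def using x(1)
    by (simp add: Mod_cat_simps(3) Cmp_Mod_cat_apply add.assoc)
  also have "s (n + 2) (cdiff C (n + 1) x) = \<zero>\<^bsub>cobj C (n + 1)\<^esub>"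
    unfolding x(2) by (rule Mod_cat_hom_zero[where R = R]) (use C s2 in auto)
  finally show "x \<in> cdiff C n ` carrier (cobj C n)" using sx dsx by (metis M.M.r_zero image_eqI)
qed

lemma acyclic_modules_shift:
  assumes X: "X \<in> complexes (Mod_cat R)" and ac: "acyclic_modules X"
  shows "acyclic_modules (shift_complex (Mod_cat R) X)"
proof -
  interpret preadditive_laws "Mod_cat R" by (rule Mod_cat_laws)
  have ac': "x \<in> cdiff X n ` carrier (cobj X n)"
    if "x \<in> carrier (cobj X (n + 1))" "cdiff X (n + 1) x = \<zero>\<^bsub>cobj X (n + 2)\<^esub>" for n x
    using ac that unfolding acyclic_modules_iff[OF X] by blast
  have neg: "cdiff (shift_complex (Mod_cat R) X) n x = \<ominus>\<^bsub>cobj X (n + 2)\<^esub> cdiff X (n + 1) x"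
    if "x \<in> carrier (cobj X (n + 1))" for n x
    using that by (simp add: cdiff_shift_complex(1) Mod_cat_def)
  show ?thesis unfolding acyclic_modules_iff[OF shift_complex_closed[OF X]]
  proof (intro allI ballI impI)
    fix n x
    interpret M1: right_module R "cobj X (n + 1)" using complex_ob[OF X] by (simp add: Ob_Mod_cat)
    interpret M2: right_module R "cobj X (n + 2)" using complex_ob[OF X] by (simp add: Ob_Mod_cat)
    interpret M3: right_module R "cobj X (n + 3)" using complex_ob[OF X] by (simp add: Ob_Mod_cat)
    assume "x \<in> carrier (cobj (shift_complex (Mod_cat R) X) (n + 1))"
      "cdiff (shift_complex (Mod_cat R) X) (n + 1) x = \<zero>\<^bsub>cobj (shift_complex (Mod_cat R) X) (n + 2)\<^esub>"
    then have x: "x \<in> carrier (cobj X (n + 2))" "\<ominus>\<^bsub>cobj X (n + 3)\<^esub> cdiff X (n + 2) x = \<zero>\<^bsub>cobj X (n + 3)\<^esub>"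
      using neg[of x "n + 1"] by (auto simp: add.assoc)
    have d: "cdiff X (n + 2) \<in> Hom (Mod_cat R) (cobj X (n + 2)) (cobj X (n + 3))"
      using cdiff_closed(1)[OF X, of "n + 2"] by (simp add: add.assoc)
    have "cdiff X (n + 2) x = \<zero>\<^bsub>cobj X (n + 3)\<^esub>"
      using x Mod_cat_homD(1)[OF d x(1)] by (metis M3.M.add.inv_eq_1_iff)
    then obtain z where z: "z \<in> carrier (cobj X (n + 1))" "x = cdiff X (n + 1) z"
      using ac'[of x "n + 1"] x(1) by (auto simp: add.assoc)
    \<comment> \<open>The differential of the shift is negated, so the preimage found in
      \<open>X\<close> has to be negated as well.\<close>
    have "x = cdiff (shift_complex (Mod_cat R) X) n (\<ominus>\<^bsub>cobj X (n + 1)\<^esub> z)"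
    proof -
      note dh = Mod_cat_homD[OF cdiff_closed(3)[OF X, of n]]
      have "cdiff X (n + 1) (\<ominus>\<^bsub>cobj X (n + 1)\<^esub> z) \<oplus>\<^bsub>cobj X (n + 2)\<^esub> cdiff X (n + 1) z = \<zero>\<^bsub>cobj X (n + 2)\<^esub>"
        using dh(2)[of "\<ominus>\<^bsub>cobj X (n + 1)\<^esub> z" z] z(1) Mod_cat_hom_zero[OF _ _ cdiff_closed(3)[OF X, of n]] X
        by (simp add: M1.M.l_neg)
      then have "\<ominus>\<^bsub>cobj X (n + 2)\<^esub> (cdiff X (n + 1) (\<ominus>\<^bsub>cobj X (n + 1)\<^esub> z)) = cdiff X (n + 1) z"
        using dh(1) z(1) by (metis M1.M.a_inv_closed M2.M.minus_equality M2.M.minus_minus)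
      then show ?thesis using neg z by simp
    qed
    then show "x \<in> cdiff (shift_complex (Mod_cat R) X) n ` carrier (cobj (shift_complex (Mod_cat R) X) n)"
      using z(1) by auto
  qed
qed

section \<open>Evaluation at the regular module\<close>

locale small_ring = ring R for R :: "('u, 'x) ring_scheme" (structure) +
  assumes infinite_universe: "infinite (UNIV :: 'u set)" and small_carrier: "small (carrier R)"
begin

abbreviation "MR \<equiv> Mod_cat R"
abbreviation "FR \<equiv> fp_functor_cat R"

sublocale Mod: preadditive_laws MR
  by (rule Mod_cat_laws)

text \<open>Finite presentation provides finite generation, hence the bound on homomorphisms that
  leaves room for their codes in the universe.\<close>

sublocale Mod: small_homs MR "finitely_presented R" "UNIV :: 'u set"
proof
  show "Hom MR X M \<prec> (UNIV :: 'u set)"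
    if "X \<in> Ob MR" "finitely_presented R X" "M \<in> Ob MR" for X M
    using rmod_hom_lesspoll[OF infinite_universe ring_axioms _ _ finitely_presented_generated[OF that(2)], of M] that(3)
    by (simp add: Mod_cat_def small_def)
qed simp

abbreviation "RR \<equiv> regular_rmod R"

lemma RR_Ob [simp]: "RR \<in> Ob MR" and RR_fp [simp]: "finitely_presented R RR"
  using regular_rmod_right_module[OF ring_axioms] regular_rmod_finitely_presented[OF ring_axioms] small_carrier
  by (simp_all add: Ob_Mod_cat)

section \<open>The Yoneda correspondence for the regular module\<close>

lemma scalar_map_closed [simp]:
  assumes "M \<in> Ob MR" "x \<in> carrier M"
  shows "scalar_map R M x \<in> Hom MR RR M"
proof -
  interpret M: right_module R M using assms by (simp add: Ob_Mod_cat)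
  show ?thesis using assms(2)
    by (intro Mod_cat_homI) (auto simp: scalar_map_def M.smult_closed M.smult_l_distr M.smult_assoc)
qed

lemma Cmp_scalar_map:
  assumes "M \<in> Ob MR" "N \<in> Ob MR" "x \<in> carrier M" and f: "f \<in> Hom MR M N"
  shows "Cmp MR RR M N f (scalar_map R M x) = scalar_map R N (f x)"
  using assms(3) by (auto simp: scalar_map_def Mod_cat_def compose_def fun_eq_iff Mod_cat_homD(3)[OF f])

lemma scalar_map_add:
  assumes "M \<in> Ob MR" "x \<in> carrier M" "y \<in> carrier M"
  shows "scalar_map R M (x \<oplus>\<^bsub>M\<^esub> y) = Plus MR RR M (scalar_map R M x) (scalar_map R M y)"
proof -
  interpret M: right_module R M using assms by (simp add: Ob_Mod_cat)
  show ?thesis using assms by (auto simp: scalar_map_def Mod_cat_def M.smult_r_distr)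
qed

text \<open>The endomorphism \<open>scalar_map R RR a\<close> is left multiplication by
  \<open>a\<close>. Precomposition with it is thus the right action of \<open>a\<close> on the
  corresponding element.\<close>

lemma scalar_map_smult:
  assumes "M \<in> Ob MR" "x \<in> carrier M" "a \<in> carrier R"
  shows "scalar_map R M (a \<odot>\<^bsub>M\<^esub> x) = Cmp MR RR RR M (scalar_map R M x) (scalar_map R RR a)"
proof -
  have "scalar_map R M x a = a \<odot>\<^bsub>M\<^esub> x" using assms by (simp add: scalar_map_def)
  then show ?thesis using assms Cmp_scalar_map[OF RR_Ob assms(1), of a "scalar_map R M x"] by simp
qed

lemma scalar_map_one: "scalar_map R RR \<one> = Idm MR RR"
  by (auto simp: scalar_map_def Mod_cat_def)

lemma scalar_map_apply_one: "M \<in> Ob MR \<Longrightarrow> x \<in> carrier M \<Longrightarrow> scalar_map R M x \<one> = x"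
  by (simp add: scalar_map_def right_module.smult_one Ob_Mod_cat)

lemma scalar_map_of_apply_one:
  assumes f: "f \<in> Hom MR RR M"
  shows "scalar_map R M (f \<one>) = f"
proof (rule extensionalityI[of _ "carrier R"])
  show "scalar_map R M (f \<one>) r = f r" if "r \<in> carrier R" for r
    using Mod_cat_homD(3)[OF f that, of \<one>] that by (simp add: scalar_map_def)
qed (use Mod_cat_homD(4)[OF f] in \<open>auto simp: scalar_map_def\<close>)

text \<open>\<open>R\<close> acts on its regular right module by left multiplications;
  contravariance of \<open>F\<close> turns this into a right action on \<open>F(R)\<close>.\<close>

definition evaluation_module :: "'u fp_functor \<Rightarrow> ('u, 'u) module" where
  "evaluation_module F = \<lparr>carrier = carrier (on_ob F RR), mult = undefined, one = undefined,
     zero = one (on_ob F RR), add = mult (on_ob F RR),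
     smult = (\<lambda>a. on_hom F RR RR (scalar_map R RR a))\<rparr>"

definition evaluation where
  "evaluation = \<lparr>on_ob = evaluation_module, on_hom = (\<lambda>F G \<eta>. \<eta> RR)\<rparr>"

lemma evaluation_simps [simp]: "on_ob evaluation F = evaluation_module F" "on_hom evaluation F G \<eta> = \<eta> RR"
  by (simp_all add: evaluation_def)

lemma evaluation_module_simps [simp]:
  "carrier (evaluation_module F) = carrier (on_ob F RR)"
  "add (evaluation_module F) = mult (on_ob F RR)"
  "zero (evaluation_module F) = one (on_ob F RR)"
  "a \<odot>\<^bsub>evaluation_module F\<^esub> x = on_hom F RR RR (scalar_map R RR a) x"
  by (simp_all add: evaluation_module_def)

lemma add_group_evaluation_module [simp]: "add_group (evaluation_module F) = on_ob F RR"
  by (simp add: add_group_def)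

lemma Ob_fp_functor_cat: "F \<in> Ob FR \<longleftrightarrow> additive_functor (opposite (fp_mod_cat R)) Ab_cat F"
  by (simp add: fp_functor_cat_def functor_category_simps)

lemma fp_mod_cat_simps [simp]:
  "Ob (fp_mod_cat R) = {M \<in> Ob MR. finitely_presented R M}" "Hom (fp_mod_cat R) = Hom MR"
  "Idm (fp_mod_cat R) = Idm MR" "Cmp (fp_mod_cat R) = Cmp MR" "Plus (fp_mod_cat R) = Plus MR"
  by (simp_all add: fp_mod_cat_def)

lemma fp_functorD:
  assumes F: "F \<in> Ob FR"
    and X: "X \<in> Ob MR" "finitely_presented R X"
  shows "on_ob F X \<in> Ob Ab_cat"
    and "on_hom F X X (Idm MR X) = Idm Ab_cat (on_ob F X)"
    and "\<lbrakk>Y \<in> Ob MR; finitely_presented R Y; f \<in> Hom MR Y X\<rbrakk>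
      \<Longrightarrow> on_hom F X Y f \<in> Hom Ab_cat (on_ob F X) (on_ob F Y)"
    and "\<lbrakk>Y \<in> Ob MR; finitely_presented R Y; Z \<in> Ob MR; finitely_presented R Z;
        f \<in> Hom MR Y X; g \<in> Hom MR Z Y; x \<in> carrier (on_ob F X)\<rbrakk>
      \<Longrightarrow> on_hom F X Z (Cmp MR Z Y X f g) x = on_hom F Y Z g (on_hom F X Y f x)"
    and "\<lbrakk>Y \<in> Ob MR; finitely_presented R Y; f \<in> Hom MR Y X; g \<in> Hom MR Y X;
        x \<in> carrier (on_ob F X)\<rbrakk>
      \<Longrightarrow> on_hom F X Y (Plus MR Y X f g) x = on_hom F X Y f x \<otimes>\<^bsub>on_ob F Y\<^esub> on_hom F X Y g x"
    and "\<lbrakk>Y \<in> Ob MR; finitely_presented R Y; f \<in> Hom MR Y X; x \<in> carrier (on_ob F X)\<rbrakk>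
      \<Longrightarrow> on_hom F X Y f x \<in> carrier (on_ob F Y)"
    and "\<lbrakk>Y \<in> Ob MR; finitely_presented R Y; f \<in> Hom MR Y X; x \<in> carrier (on_ob F X);
        y \<in> carrier (on_ob F X)\<rbrakk>
      \<Longrightarrow> on_hom F X Y f (x \<otimes>\<^bsub>on_ob F X\<^esub> y) = on_hom F X Y f x \<otimes>\<^bsub>on_ob F Y\<^esub> on_hom F X Y f y"
proof -
  note D = additive_functorD[OF F[unfolded Ob_fp_functor_cat]]
  show "on_ob F X \<in> Ob Ab_cat" and "on_hom F X X (Idm MR X) = Idm Ab_cat (on_ob F X)"
    using D(1,3)[of X] X by auto
  {
    assume Y: "Y \<in> Ob MR" "finitely_presented R Y" and f: "f \<in> Hom MR Y X"
    show h: "on_hom F X Y f \<in> Hom Ab_cat (on_ob F X) (on_ob F Y)" using D(2)[of X Y f] X Y f by simp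
    assume x: "x \<in> carrier (on_ob F X)"
    show "on_hom F X Y f x \<in> carrier (on_ob F Y)"
      using h x by (auto simp: Hom_Ab_cat hom_def)
    show "y \<in> carrier (on_ob F X) \<Longrightarrow> on_hom F X Y f (x \<otimes>\<^bsub>on_ob F X\<^esub> y) = on_hom F X Y f x \<otimes>\<^bsub>on_ob F Y\<^esub> on_hom F X Y f y"
      using h x by (auto simp: Hom_Ab_cat hom_def)
    show "g \<in> Hom MR Y X \<Longrightarrow>
      on_hom F X Y (Plus MR Y X f g) x = on_hom F X Y f x \<otimes>\<^bsub>on_ob F Y\<^esub> on_hom F X Y g x"
      using D(5)[of X Y f g] X Y f x by simp
    show "Z \<in> Ob MR \<Longrightarrow> finitely_presented R Z \<Longrightarrow> g \<in> Hom MR Z Y \<Longrightarrow>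
      on_hom F X Z (Cmp MR Z Y X f g) x = on_hom F Y Z g (on_hom F X Y f x)"
      using D(4)[of X Y Z f g] X Y f x by (simp add: compose_eq)
  }
qed

lemma evaluation_module_Ob [simp]:
  assumes F: "F \<in> Ob FR"
  shows "evaluation_module F \<in> Ob MR"
proof -
  note D = fp_functorD[OF F RR_Ob RR_fp]
  interpret G: comm_group "on_ob F RR" using D(1) by (simp add: Ob_Ab_cat)
  have "abelian_group (evaluation_module F)"
    by (intro abelian_groupI) (auto simp: G.m_ac intro: bexI[of _ "inv\<^bsub>on_ob F RR\<^esub> _"])
  moreover have "right_module_axioms R (evaluation_module F)"
  proof (unfold right_module_axioms_def, intro conjI allI impI, goal_cases)
    case (2 a b x)
    then show ?case using scalar_map_add[OF RR_Ob, of a b] D(5) by simp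
  next
    case (4 a b x)
    \<comment> \<open>The product is read as an element of the regular module under a scalar, so
      that it becomes a composite of left multiplications; \<open>F\<close> reverses the composite,
      as the associativity of right modules demands.\<close>
    then have "a \<otimes> b = b \<odot>\<^bsub>RR\<^esub> a" by simp
    with 4 show ?case using scalar_map_smult[OF RR_Ob, of a b] D(4) by simp
  next
    case (5 x)
    then show ?case using D(2) by (simp add: scalar_map_one)
  qed (use D(6,7) in auto)
  ultimately show ?thesis using D(1) ring_axioms by (simp add: Ob_Mod_cat Ob_Ab_cat right_module_def)
qed

sublocale Ab: preadditive_laws "Ab_cat :: ('u monoid, 'u \<Rightarrow> 'u) preadditive"
  by (rule Ab_cat_laws)

sublocale Fun: preadditive_laws FR
  unfolding fp_functor_cat_def by (rule Ab.functor_category_laws)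

lemma Hom_fp_functor_cat: "\<eta> \<in> Hom FR F G \<longleftrightarrow>
  natural_transformation (opposite (fp_mod_cat R)) Ab_cat F G \<eta> \<and> \<eta> \<in> extensional (Ob (fp_mod_cat R))"
  by (simp add: fp_functor_cat_def functor_category_simps)

lemma fp_natural:
  assumes \<eta>: "\<eta> \<in> Hom FR F G" and X: "X \<in> Ob MR" "finitely_presented R X"
  shows "\<eta> X \<in> Hom Ab_cat (on_ob F X) (on_ob G X)"
    and "x \<in> carrier (on_ob F X) \<Longrightarrow> \<eta> X x \<in> carrier (on_ob G X)"
    and "\<lbrakk>Y \<in> Ob MR; finitely_presented R Y; f \<in> Hom MR Y X; x \<in> carrier (on_ob F X)\<rbrakk> \<Longrightarrow>
      \<eta> Y (on_hom F X Y f x) = on_hom G X Y f (\<eta> X x)"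
proof -
  note D = natural_transformationD[OF \<eta>[unfolded Hom_fp_functor_cat, THEN conjunct1]]
  show h: "\<eta> X \<in> Hom Ab_cat (on_ob F X) (on_ob G X)" using D(1)[of X] X by simp
  show "x \<in> carrier (on_ob F X) \<Longrightarrow> \<eta> X x \<in> carrier (on_ob G X)"
    using h by (auto simp: Hom_Ab_cat hom_def)
  show "\<lbrakk>Y \<in> Ob MR; finitely_presented R Y; f \<in> Hom MR Y X; x \<in> carrier (on_ob F X)\<rbrakk> \<Longrightarrow>
      \<eta> Y (on_hom F X Y f x) = on_hom G X Y f (\<eta> X x)"
    using Cmp_Ab_cat_apply[OF D(2)[of X Y f]] X by simp
qed

text \<open>Linearity of the component of a transformation at \<open>R\<close> is its naturality
  along left multiplications.\<close>

sublocale Ev: additive_functor_laws FR MR evaluation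
proof
  show "additive_functor FR MR evaluation"
    unfolding additive_functor_def[of FR] is_functor_def[of FR]
  proof (intro conjI ballI, goal_cases)
    case (2 F G \<eta>)
    have "\<eta> RR (on_hom F RR RR (scalar_map R RR a) x) = on_hom G RR RR (scalar_map R RR a) (\<eta> RR x)"
      if "a \<in> carrier R" "x \<in> carrier (on_ob F RR)" for a x
      using fp_natural(3)[OF 2(3) RR_Ob RR_fp RR_Ob RR_fp] that by simp
    then show ?case using fp_natural(1)[OF 2(3) RR_Ob RR_fp] by (simp add: Hom_Mod_cat)
  qed (simp_all add: Mod_cat_simps fp_functor_cat_def functor_category_simps del: Ab_cat_simps)
qed

sublocale Yo: additive_functor_laws MR FR "yoneda MR (finitely_presented R)"
  by unfold_locales (use Mod.yoneda_additive in \<open>simp add: fp_functor_cat_def fp_mod_cat_def\<close>)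

end

section \<open>Unit transformations\<close>

context small_ring
begin

abbreviation "yfp \<equiv> yoneda MR (finitely_presented R) ::
  (('u, 'u) module, 'u \<Rightarrow> 'u, 'u fp_functor, ('u, 'u) module \<Rightarrow> 'u \<Rightarrow> 'u) cfunctor"

abbreviation code :: "('u, 'u) module \<Rightarrow> ('u, 'u) module \<Rightarrow> ('u \<Rightarrow> 'u) \<Rightarrow> 'u" where
  "code \<equiv> hom_code MR"

definition module_unit :: "('u, 'u) module \<Rightarrow> 'u \<Rightarrow> 'u" where
  "module_unit M = (\<lambda>x \<in> carrier M. code RR M (scalar_map R M x))"

lemma module_unit_closed:
  assumes M: "M \<in> Ob MR"
  shows "module_unit M \<in> Hom MR M (evaluation_module (hom_functor MR M))"
proof -
  interpret M: right_module R M using M by (simp add: Ob_Mod_cat)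
  show ?thesis
    by (rule Mod_cat_homI)
       (use M in \<open>simp_all add: module_unit_def M.smult_closed scalar_map_add scalar_map_smult\<close>)
qed

text \<open>The Yoneda lemma at \<open>R\<close>: a homomorphism from the regular module is the same
  as its value at one.\<close>

lemma module_unit_iso:
  assumes M: "M \<in> Ob MR"
  shows "is_iso MR M (evaluation_module (hom_functor MR M)) (module_unit M)"
proof -
  interpret M: right_module R M using M by (simp add: Ob_Mod_cat)
  let ?E = "evaluation_module (hom_functor MR M)"
  \<comment> \<open>The inverse decodes to a homomorphism and evaluates it at one.\<close>
  let ?d = "\<lambda>b \<in> carrier ?E. hom_decode MR RR M b \<one>"
  have E: "\<exists>f. f \<in> Hom MR RR M \<and> b = code RR M f" if "b \<in> carrier ?E" for b
    using that M by (auto simp: Mod.carrier_hom_group)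
  have d: "?d (code RR M f) = f \<one>" if "f \<in> Hom MR RR M" for f
    using that M by simp
  have f1: "f \<one> \<in> carrier M" if "f \<in> Hom MR RR M" for f
    using Mod_cat_homD(1)[OF that, of \<one>] by simp
  have "?d \<in> Hom MR ?E M"
  proof (rule Mod_cat_homI)
    fix b c assume "b \<in> carrier ?E" "c \<in> carrier ?E"
    then obtain f g where f: "f \<in> Hom MR RR M" "b = code RR M f"
      and g: "g \<in> Hom MR RR M" "c = code RR M g" using E by blast
    have "?d (b \<oplus>\<^bsub>?E\<^esub> c) = Plus MR RR M f g \<one>" using f g M d[of "Plus MR RR M f g"] by simp
    also have "\<dots> = f \<one> \<oplus>\<^bsub>M\<^esub> g \<one>" by (simp add: Mod_cat_def)
    finally show "?d (b \<oplus>\<^bsub>?E\<^esub> c) = ?d b \<oplus>\<^bsub>M\<^esub> ?d c" using f g d by simp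
  next
    fix a b assume a: "a \<in> carrier R" and "b \<in> carrier ?E"
    then obtain f where f: "f \<in> Hom MR RR M" "b = code RR M f" using E by blast
    have "?d (a \<odot>\<^bsub>?E\<^esub> b) = Cmp MR RR RR M f (scalar_map R RR a) \<one>"
      using f M a d[of "Cmp MR RR RR M f (scalar_map R RR a)"] by simp
    also have "\<dots> = f a" using a by (simp add: Cmp_Mod_cat_apply scalar_map_def)
    also have "\<dots> = a \<odot>\<^bsub>M\<^esub> f \<one>" using Mod_cat_homD(3)[OF f(1) a, of \<one>] a by simp
    finally show "?d (a \<odot>\<^bsub>?E\<^esub> b) = a \<odot>\<^bsub>M\<^esub> ?d b" using f d by simp
  next
    fix b assume "b \<in> carrier ?E"
    then obtain f where f: "f \<in> Hom MR RR M" "b = code RR M f" using E by blast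
    show "?d b \<in> carrier M" unfolding f(2) d[OF f(1)] by (rule f1[OF f(1)])
  qed simp
  moreover have "Cmp MR M ?E M ?d (module_unit M) = Idm MR M"
  proof (rule extensionalityI[of _ "carrier M"])
    show "Cmp MR M ?E M ?d (module_unit M) x = Idm MR M x" if x: "x \<in> carrier M" for x
    proof -
      have "Cmp MR M ?E M ?d (module_unit M) x = ?d (code RR M (scalar_map R M x))"
        using x by (simp only: Cmp_Mod_cat_apply module_unit_def restrict_apply')
      then show ?thesis using x M by (simp only: d scalar_map_closed scalar_map_apply_one) (simp add: Mod_cat_def)
    qed
  qed (simp_all add: Mod_cat_def)
  moreover have "Cmp MR ?E M ?E (module_unit M) ?d = Idm MR ?E"
  proof (rule extensionalityI[of _ "carrier ?E"])
    show "Cmp MR ?E M ?E (module_unit M) ?d b = Idm MR ?E b" if b: "b \<in> carrier ?E" for b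
    proof -
      obtain f where f: "f \<in> Hom MR RR M" "b = code RR M f" using E[OF b] by blast
      have "Cmp MR ?E M ?E (module_unit M) ?d b = module_unit M (f \<one>)"
        using f b by (simp only: Cmp_Mod_cat_apply d)
      also have "\<dots> = b" using f1[OF f(1)] f by (simp add: module_unit_def scalar_map_of_apply_one)
      finally show ?thesis using b by (simp add: Mod_cat_def)
    qed
  qed (simp_all add: Mod_cat_def)
  ultimately show ?thesis unfolding is_iso_def using module_unit_closed[OF M] by blast
qed

lemma module_unit_natural:
  "natural_transformation MR MR id_functor (comp_functor evaluation yfp) module_unit"
  unfolding natural_transformation_def
proof (intro conjI ballI, goal_cases)
  case (1 M)
  then show ?case using module_unit_closed by (simp add: id_functor_def comp_functor_def)
next
  case (2 M N g)
  then have "module_unit N (g x) = on_hom yfp M N g RR (module_unit M x)" if "x \<in> carrier M" for x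
    using that Mod_cat_homD(1)[OF 2(3) that] by (simp add: module_unit_def Cmp_scalar_map)
  then show ?case by (auto simp: id_functor_def comp_functor_def Mod_cat_def compose_def)
qed

section \<open>The unit on functors and its naturality\<close>

definition evaluation_map :: "'u fp_functor \<Rightarrow> ('u, 'u) module \<Rightarrow> 'u \<Rightarrow> 'u \<Rightarrow> 'u" where
  "evaluation_map F P x = (\<lambda>p \<in> carrier P. on_hom F P RR (scalar_map R P p) x)"

definition functor_unit :: "'u fp_functor \<Rightarrow> ('u, 'u) module \<Rightarrow> 'u \<Rightarrow> 'u" where
  "functor_unit F = (\<lambda>P \<in> Ob (fp_mod_cat R). \<lambda>x \<in> carrier (on_ob F P). code P (evaluation_module F) (evaluation_map F P x))"

text \<open>The scalars of \<open>F(R)\<close> act through \<open>F\<close> of left multiplications,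
  so for \<open>P = R\<close> the map \<open>evaluation_map\<close> unfolds to
  \<open>scalar_map\<close>. Through this identity evaluation turns the unit into an
  isomorphism.\<close>

lemma functor_unit_regular: "F \<in> Ob FR \<Longrightarrow> functor_unit F RR = module_unit (evaluation_module F)"
  by (simp add: functor_unit_def module_unit_def evaluation_map_def scalar_map_def[of _ "evaluation_module F"])

lemma evaluation_map_closed:
  assumes F: "F \<in> Ob FR" and P: "P \<in> Ob MR" "finitely_presented R P"
    and x: "x \<in> carrier (on_ob F P)"
  shows "evaluation_map F P x \<in> Hom MR P (evaluation_module F)"
proof -
  interpret P: right_module R P using P by (simp add: Ob_Mod_cat)
  note D = fp_functorD[OF F P]
  show ?thesis
    by (rule Mod_cat_homI)
       (use P x in \<open>simp_all add: evaluation_map_def D P.smult_closed scalar_map_add scalar_map_smult\<close>)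
qed

lemma functor_unit_apply:
  "\<lbrakk>P \<in> Ob MR; finitely_presented R P; x \<in> carrier (on_ob F P)\<rbrakk> \<Longrightarrow>
    functor_unit F P x = code P (evaluation_module F) (evaluation_map F P x)"
  by (simp add: functor_unit_def)

lemma functor_unit_closed:
  assumes F: "F \<in> Ob FR"
  shows "functor_unit F \<in> Hom FR F (hom_functor MR (evaluation_module F))"
  unfolding Hom_fp_functor_cat natural_transformation_def
proof (intro conjI ballI)
  let ?E = "evaluation_module F"
  note E = evaluation_module_Ob[OF F]
  have hom: "functor_unit F P \<in> Hom Ab_cat (on_ob F P) (hom_group MR P ?E)"
    if P: "P \<in> Ob MR" "finitely_presented R P" for P
  proof -
    note D = fp_functorD[OF F P]
    interpret G: comm_group "on_ob F P" using D(1) by (simp add: Ob_Ab_cat)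
    have "evaluation_map F P (x \<otimes>\<^bsub>on_ob F P\<^esub> y) = Plus MR P ?E (evaluation_map F P x) (evaluation_map F P y)"
      if "x \<in> carrier (on_ob F P)" "y \<in> carrier (on_ob F P)" for x y
    proof -
      have "Plus MR P ?E (evaluation_map F P x) (evaluation_map F P y) =
        (\<lambda>p \<in> carrier P. evaluation_map F P x p \<otimes>\<^bsub>on_ob F RR\<^esub> evaluation_map F P y p)"
        by (simp add: Mod_cat_def)
      then show ?thesis unfolding evaluation_map_def[of F P "x \<otimes>\<^bsub>on_ob F P\<^esub> y"]
        using that P D(7)[OF RR_Ob RR_fp] by (auto simp: evaluation_map_def intro!: restrict_ext)
    qed
    then show ?thesis using P E evaluation_map_closed[OF F P]
      by (auto simp: Hom_Ab_cat hom_def functor_unit_apply) (simp add: functor_unit_def)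
  qed
  then show "functor_unit F P \<in> Hom Ab_cat (on_ob F P) (on_ob (hom_functor MR ?E) P)"
    if "P \<in> Ob (opposite (fp_mod_cat R))" for P using that by simp
  show "functor_unit F \<in> extensional (Ob (fp_mod_cat R))" by (simp add: functor_unit_def)
  fix P Q f assume PQ: "P \<in> Ob (opposite (fp_mod_cat R))" "Q \<in> Ob (opposite (fp_mod_cat R))"
    and "f \<in> Hom (opposite (fp_mod_cat R)) P Q"
  then have P: "P \<in> Ob MR" "finitely_presented R P" and Q: "Q \<in> Ob MR" "finitely_presented R Q"
    and f: "f \<in> Hom MR Q P" by auto
  note D = fp_functorD[OF F P]
  have "evaluation_map F Q (on_hom F P Q f x) = Cmp MR Q P ?E (evaluation_map F P x) f"
    if x: "x \<in> carrier (on_ob F P)" for x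
  proof (rule extensionalityI[of _ "carrier Q"])
    fix q assume q: "q \<in> carrier Q"
    \<comment> \<open>Composing \<open>f\<close> with \<open>r \<mapsto> q r\<close> gives
      \<open>r \<mapsto> f(q) r\<close>, by linearity of \<open>f\<close>; then contravariant
      functoriality of \<open>F\<close> applies.\<close>
    have "on_hom F Q RR (scalar_map R Q q) (on_hom F P Q f x) = on_hom F P RR (scalar_map R P (f q)) x"
      using D(4)[OF Q RR_Ob RR_fp f scalar_map_closed[OF Q(1) q] x] Cmp_scalar_map[OF Q(1) P(1) q f] by simp
    then show "evaluation_map F Q (on_hom F P Q f x) q = Cmp MR Q P ?E (evaluation_map F P x) f q"
      using q Mod_cat_homD(1)[OF f q] by (simp add: Cmp_Mod_cat_apply evaluation_map_def)
  qed (simp_all add: evaluation_map_def Mod_cat_def)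
  then have "functor_unit F Q (on_hom F P Q f x) = on_hom (hom_functor MR ?E) P Q f (functor_unit F P x)"
    if "x \<in> carrier (on_ob F P)" for x
    using that P Q f E D(6)[OF Q f that] evaluation_map_closed[OF F P that] by (simp add: functor_unit_apply)
  then show "Cmp Ab_cat (on_ob F P) (on_ob F Q) (on_ob (hom_functor MR ?E) Q) (functor_unit F Q) (on_hom F P Q f) =
    Cmp Ab_cat (on_ob F P) (on_ob (hom_functor MR ?E) P) (on_ob (hom_functor MR ?E) Q)
      (on_hom (hom_functor MR ?E) P Q f) (functor_unit F P)"
    by (auto simp: compose_def)
qed

lemma functor_unit_natural:
  "natural_transformation FR FR id_functor (comp_functor yfp evaluation) functor_unit"
  unfolding natural_transformation_def[of FR]
proof (intro conjI ballI, goal_cases)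
  case (1 F)
  then show ?case using functor_unit_closed by (simp add: id_functor_def comp_functor_def)
next
  case (2 F G \<alpha>)
  then have F: "F \<in> Ob FR" and G: "G \<in> Ob FR" and \<alpha>: "\<alpha> \<in> Hom FR F G" by auto
  have "functor_unit G P (\<alpha> P x) = on_hom yfp (evaluation_module F) (evaluation_module G) (\<alpha> RR) P (functor_unit F P x)"
    if P: "P \<in> Ob MR" "finitely_presented R P" and x: "x \<in> carrier (on_ob F P)" for P x
  proof -
    \<comment> \<open>Pointwise in \<open>p\<close> this is naturality of \<open>\<alpha>\<close>
      along \<open>r \<mapsto> p r\<close>.\<close>
    have "evaluation_map G P (\<alpha> P x) = Cmp MR P (evaluation_module F) (evaluation_module G) (\<alpha> RR) (evaluation_map F P x)"
    proof (rule extensionalityI[of _ "carrier P"])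
      show "evaluation_map G P (\<alpha> P x) p =
        Cmp MR P (evaluation_module F) (evaluation_module G) (\<alpha> RR) (evaluation_map F P x) p"
        if p: "p \<in> carrier P" for p
        using fp_natural(3)[OF \<alpha> P RR_Ob RR_fp scalar_map_closed[OF P(1) p] x] p
        by (simp add: evaluation_map_def Cmp_Mod_cat_apply)
    qed (simp_all add: evaluation_map_def Mod_cat_def)
    then show ?thesis using P x F G fp_natural(2)[OF \<alpha> P x] evaluation_map_closed[OF F P x]
      by (simp add: functor_unit_apply)
  qed
  then show ?case
    by (auto simp: fp_functor_cat_def functor_category_simps id_functor_def comp_functor_def compose_def
        intro!: restrict_ext)
qed

section \<open>The equivalence\<close>

text \<open>The module structure on \<open>F(R)\<close> keeps carrier and neutral element, so both
  sides compare the same kernels and images.\<close>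

lemma acyclic_groups_evaluate:
  "acyclic_groups (evaluate_complex RR X) \<longleftrightarrow> acyclic_modules (complex_image evaluation X)"
  unfolding acyclic_groups_def acyclic_modules_def a_kernel_def kernel_def
  by (simp add: evaluate_complex_def)

abbreviation "KM \<equiv> homotopy_category MR"
abbreviation "KF \<equiv> homotopy_category FR"
abbreviation "NM \<equiv> {X \<in> Ob KM. acyclic_modules X}"
abbreviation "NF \<equiv> {X \<in> Ob KF. acyclic_groups (evaluate_complex RR X)}"

lemma verdier_pair_modules: "verdier_pair KM NM"
proof -
  interpret K: shift_category KM by (rule Mod.homotopy_shift_category)
  show ?thesis
  proof
    fix X Y s assume "(X, Y, s) \<in> cone_in KM NM"
    then show "(ShO KM X, ShO KM Y, ShM KM X Y s) \<in> cone_in KM NM"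
      using Mod.cone_in_shift[of NM X Y s] acyclic_modules_shift by auto
  qed
qed

lemma verdier_pair_functors: "verdier_pair KF NF"
proof -
  interpret K: shift_category KF by (rule Fun.homotopy_shift_category)
  show ?thesis
  proof
    fix X Y s assume "(X, Y, s) \<in> cone_in KF NF"
    then show "(ShO KF X, ShO KF Y, ShM KF X Y s) \<in> cone_in KF NF"
      using Fun.cone_in_shift[of NF X Y s] acyclic_modules_shift[OF Ev.complex_image_closed]
      by (auto simp: acyclic_groups_evaluate Ev.complex_image_shift)
  qed
qed

text \<open>The cone of the unit at \<open>X\<close> is mapped by evaluation to the cone of an isomorphism of complexes
  of modules, hence to a contractible complex.\<close>

lemma functor_unit_cone:
  assumes X: "X \<in> complexes FR"
  shows "(X, complex_image yfp (complex_image evaluation X),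
    homotopy_class FR X (complex_image yfp (complex_image evaluation X)) (\<lambda>n. functor_unit (cobj X n)))
    \<in> cone_in KF NF"
proof -
  let ?Z = "complex_image yfp (complex_image evaluation X)" and ?u = "\<lambda>n. functor_unit (cobj X n)"
  have u: "?u \<in> chain_maps FR X ?Z"
    by (rule Fun.homotopy_natural_transformation(2)[OF Ev.additive_functor_laws_axioms
      Yo.additive_functor_laws_axioms functor_unit_natural X])
  \<comment> \<open>Biproducts of functors are formed objectwise from coded direct sums of small
    groups.\<close>
  have "\<exists>C i p. is_mapping_cone FR X ?Z ?u C i p"
    by (intro Fun.mapping_cone_exists X u Yo.complex_image_closed Ev.complex_image_closed)
       (use Ab.functor_category_biproduct Ab_cat_biproduct[OF infinite_universe] in \<open>unfold fp_functor_cat_def, blast\<close>)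
  then obtain C i p where cone: "is_mapping_cone FR X ?Z ?u C i p" by blast
  then have C: "C \<in> complexes FR" unfolding is_mapping_cone_def by blast
  have "acyclic_modules (complex_image evaluation C)"
  proof (rule Mod.cone_of_iso_contractible[OF Ev.is_mapping_cone_image[OF cone]])
    show "is_iso MR (cobj (complex_image evaluation X) n) (cobj (complex_image evaluation ?Z) n)
       (chain_image evaluation X ?Z ?u n)" for n
      using X module_unit_iso by (simp add: chain_image_def functor_unit_regular)
  qed (rule acyclic_modules_contractible[OF Ev.complex_image_closed[OF C]])
  then have "C \<in> NF" using C by (simp add: acyclic_groups_evaluate)
  then show ?thesis using Fun.homotopy_category_triangle[OF cone] unfolding cone_in_def by blast
qed

text \<open>The Yoneda functor leads from modules to functors, evaluation leads back. The unit on
  modules is invertible already in the homotopy category; the unit on functors is inverted because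
  its cone is \<open>R\<close>-acyclic.\<close>

theorem derived_equivalence: "triangle_equivalent (derived_Mod R) (derived_R_fp_functors R)"
  unfolding derived_Mod_def derived_R_fp_functors_def Let_def
proof (rule verdier_triangle_equivalent[OF verdier_pair_modules verdier_pair_functors
    Yo.homotopy_functor_strict _ Ev.homotopy_functor_strict _
    Mod.homotopy_natural_transformation(1)[OF Yo.additive_functor_laws_axioms Ev.additive_functor_laws_axioms module_unit_natural] _
    Fun.homotopy_natural_transformation(1)[OF Ev.additive_functor_laws_axioms Yo.additive_functor_laws_axioms functor_unit_natural]], goal_cases)
  have unit: "(\<lambda>n. module_unit (cobj X n)) \<in> chain_maps MR X (complex_image evaluation (complex_image yfp X))"
    if "X \<in> complexes MR" for X
    by (rule Mod.homotopy_natural_transformation(2)[OF Yo.additive_functor_laws_axioms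
      Ev.additive_functor_laws_axioms module_unit_natural that])
  have iso: "is_iso MR (cobj X n) (cobj (complex_image evaluation (complex_image yfp X)) n) (module_unit (cobj X n))"
    if "X \<in> complexes MR" for X n
    using module_unit_iso that by simp
  {
    \<comment> \<open>Acyclicity of the Yoneda image is tested at \<open>R\<close>, where the
      degreewise unit identifies it with \<open>X\<close> as a complex of modules.\<close>
    case (1 X)
    then show ?case using acyclic_modules_iso[OF _ _ unit iso] by (simp add: acyclic_groups_evaluate)
  next
    case (2 X)
    then show ?case by (simp add: acyclic_groups_evaluate)
  next
    case (3 X)
    then show ?case using Mod.chain_iso[OF _ _ unit iso] by simp
  next
    case (4 X)
    then show ?case using functor_unit_cone by simp
  }
qed

end

theorem theorem3p1p10:
  fixes R :: "('u, 'x) ring_scheme"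
  assumes "infinite (UNIV :: 'u set)"
    and "ring R" and "small (carrier R)"
    and "right_coherent R"
  shows "triangle_equivalent (derived_Mod R) (derived_R_fp_functors R)"
proof -
  interpret small_ring R
    using assms by (simp add: small_ring_def small_ring_axioms_def)
  show ?thesis by (rule derived_equivalence)
qed

end
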